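(* Let $(G,V)$ be an orthogonal representation of a compact Lie group $G$ on a Euclidean space $V$ and suppose that $V=V_1\oplus V_2$ is a $G$-invariant (orthogonal) decomposition. Let $k$ be a nonnegative integer. If $\mathrm{copol}(G,V)\leq k$, then $\mathrm{copol}(G,V_i)\leq k$ for $i=1,2$.
   Context: An orthogonal representation $(G,V)$ is a linear isometric action of a compact Lie group $G$ on a finite-dimensional Euclidean space $V$. A point is called $G$-regular if it lies on a principal orbit. For a nonnegative integer $k$, a $k$-section of $(G,V)$ is a connected, complete submanifold $\Sigma$ of $V$ such that: (C1) $\Sigma$ is totally geodesic in $V$; (C2) $\Sigma$ intersects all $G$-orbits; (C3) for every $G$-regular point $p\in\Sigma$, $T_p\Sigma$ contains the normal space $\nu_p(Gp)$ of the orbit as a subspace of codimension $k$; (C4) for every $G$-regular point $p\in\Sigma$, if $gp\in\Sigma$ for some $g\in G$, then $g\Sigma=\Sigma$. Through a given $G$-regular point, the set of all $k$-sections ($k=0,1,2,\dots$) has a unique minimal element with respect to inclusion; if this minimal element is a $k_0$-section then the copolarity is $\mathrm{copol}(G,V)=k_0$ (independent of the regular point). *)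

theory Defs
  imports "HOL-Analysis.Analysis" "HOL-Algebra.Group_Action"
begin

section \<open>Smooth maps and submanifolds of Euclidean spaces\<close>

text \<open>Meant for open \<open>U\<close> only. In finite dimension, continuity of all directional derivatives
  is continuity of the total derivative.\<close>

primrec Ck_on :: "nat \<Rightarrow> 'a::euclidean_space set \<Rightarrow> ('a \<Rightarrow> 'b::real_normed_vector) \<Rightarrow> bool" where
  "Ck_on 0 U f \<longleftrightarrow> continuous_on U f"
| "Ck_on (Suc k) U f \<longleftrightarrow> (\<forall>x\<in>U. f differentiable (at x)) \<and>
     (\<forall>v. Ck_on k U (\<lambda>x. frechet_derivative f (at x) v))"

text \<open>Smoothness on an arbitrary subset: locally the restriction of a smooth map defined on an
  open set. On open sets, and on relatively open subsets of linear subspaces, this is the usual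
  notion.\<close>

definition smooth_on :: "'a::euclidean_space set \<Rightarrow> ('a \<Rightarrow> 'b::real_normed_vector) \<Rightarrow> bool" where
  "smooth_on S f \<longleftrightarrow>
     (\<forall>x\<in>S. \<exists>U F. open U \<and> x \<in> U \<and> (\<forall>k. Ck_on k U F) \<and> (\<forall>y\<in>U \<inter> S. F y = f y))"

definition diffeomorphism_on ::
  "'a::euclidean_space set \<Rightarrow> 'b::euclidean_space set \<Rightarrow> ('a \<Rightarrow> 'b) \<Rightarrow> ('b \<Rightarrow> 'a) \<Rightarrow> bool" where
  "diffeomorphism_on S T f g \<longleftrightarrow> homeomorphism S T f g \<and> smooth_on S f \<and> smooth_on T g"

text \<open>Embedded submanifolds without boundary. The parameter domains are open subsets of
  \<open>d\<close>-dimensional linear subspaces, so that dimension \<open>d = 0\<close> is included.\<close>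

definition submanifold :: "'a::euclidean_space set \<Rightarrow> bool" where
  "submanifold M \<longleftrightarrow>
     (\<exists>d. \<forall>p\<in>M. \<exists>(E :: 'a set) W U f g. subspace E \<and> dim E = d \<and> openin (top_of_set E) W \<and>
        openin (top_of_set M) U \<and> p \<in> U \<and> diffeomorphism_on W U f g)"

definition tangent_space :: "'a::euclidean_space set \<Rightarrow> 'a \<Rightarrow> 'a set" where
  "tangent_space M p =
     {v. \<exists>\<gamma> e::real. e > 0 \<and> smooth_on {-e<..<e} \<gamma> \<and> \<gamma> ` {-e<..<e} \<subseteq> M \<and> \<gamma> 0 = p \<and>
         (\<gamma> has_vector_derivative v) (at 0)}"

text \<open>The normal space at \<open>p\<close> of \<open>M\<close> as a submanifold of the linear space \<open>V\<close>.\<close>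

definition normal_space :: "'a::euclidean_space set \<Rightarrow> 'a set \<Rightarrow> 'a \<Rightarrow> 'a set" where
  "normal_space V M p = V \<inter> (tangent_space M p)\<^sup>\<bottom>"

text \<open>The second fundamental form of \<open>M\<close> in \<open>V\<close> vanishes: the ambient derivative of a tangent field
  \<open>X\<close> along a curve \<open>\<gamma>\<close> in \<open>M\<close> has no normal component.\<close>

definition totally_geodesic :: "'a::euclidean_space set \<Rightarrow> 'a set \<Rightarrow> bool" where
  "totally_geodesic V M \<longleftrightarrow>
     (\<forall>\<gamma> X e::real. e > 0 \<longrightarrow> smooth_on {-e<..<e} \<gamma> \<longrightarrow> smooth_on {-e<..<e} X \<longrightarrow>
        (\<forall>t\<in>{-e<..<e}. \<gamma> t \<in> M \<and> X t \<in> tangent_space M (\<gamma> t)) \<longrightarrow>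
        (\<forall>n\<in>normal_space V M (\<gamma> 0). vector_derivative X (at 0) \<bullet> n = 0))"

text \<open>Riemannian distance of the induced metric on a connected submanifold. Stating the length
  via \<open>has_integral\<close> discards paths of infinite length, for which \<open>integral\<close> would be \<open>0\<close>.
  The value off \<open>M\<close> only serves the axioms of \<open>Metric_space\<close>, which are not relativised.\<close>

definition riemannian_dist :: "'a::euclidean_space set \<Rightarrow> 'a \<Rightarrow> 'a \<Rightarrow> real" where
  "riemannian_dist M p q =
     (if p \<in> M \<and> q \<in> M
      then Inf {L. \<exists>\<gamma>. valid_path \<gamma> \<and> path_image \<gamma> \<subseteq> M \<and> pathstart \<gamma> = p \<and> pathfinish \<gamma> = q \<and>
                   ((\<lambda>t. norm (vector_derivative \<gamma> (at t))) has_integral L) {0..1}}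
      else 0)"

definition complete_submanifold :: "'a::euclidean_space set \<Rightarrow> bool" where
  "complete_submanifold M \<longleftrightarrow> submanifold M \<and> Metric_space.mcomplete M (riemannian_dist M)"


section \<open>Orthogonal representations of compact Lie groups\<close>

text \<open>The topology \<open>T\<close> and the charts \<open>(U, \<phi>) \<in> \<A>\<close> make the carrier of \<open>G\<close> a smooth manifold
  modelled on a linear subspace \<open>E\<close> of a Euclidean space. An arbitrary subspace is allowed in order
  to include dimension \<open>0\<close>, i.e. finite groups. Second countability is automatic by compactness.\<close>

locale compact_Lie_group = group G
  for G :: "('g, 'm) monoid_scheme" (structure) +
  fixes T :: "'g topology"
    and E :: "'e::euclidean_space set"
    and \<A> :: "('g set \<times> ('g \<Rightarrow> 'e)) set"
  assumes topspace_eq: "topspace T = carrier G"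
    and compact: "compact_space T"
    and Hausdorff: "Hausdorff_space T"
    and subspace_model: "subspace E"
    and charts_cover: "(\<Union>(U, \<phi>)\<in>\<A>. U) = carrier G"
    and charts: "\<And>U \<phi>. (U, \<phi>) \<in> \<A> \<Longrightarrow> openin T U \<and> openin (top_of_set E) (\<phi> ` U) \<and>
          homeomorphic_map (subtopology T U) (top_of_set (\<phi> ` U)) \<phi>"
    and transition_smooth: "\<And>U \<phi> U' \<psi>. (U, \<phi>) \<in> \<A> \<Longrightarrow> (U', \<psi>) \<in> \<A> \<Longrightarrow>
          smooth_on (\<phi> ` (U \<inter> U')) (\<lambda>x. \<psi> (inv_into U \<phi> x))"
    and mult_continuous: "continuous_map (prod_topology T T) T (\<lambda>(g, h). g \<otimes> h)"
    and mult_smooth: "\<And>U \<phi> U' \<phi>' U'' \<psi>.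
          (U, \<phi>) \<in> \<A> \<Longrightarrow> (U', \<phi>') \<in> \<A> \<Longrightarrow> (U'', \<psi>) \<in> \<A> \<Longrightarrow>
          smooth_on {(\<phi> g, \<phi>' h) | g h. g \<in> U \<and> h \<in> U' \<and> g \<otimes> h \<in> U''}
            (\<lambda>(x, y). \<psi> (inv_into U \<phi> x \<otimes> inv_into U' \<phi>' y))"
    and inv_continuous: "continuous_map T T (\<lambda>g. inv g)"
    and inv_smooth: "\<And>U \<phi> U' \<psi>. (U, \<phi>) \<in> \<A> \<Longrightarrow> (U', \<psi>) \<in> \<A> \<Longrightarrow>
          smooth_on {\<phi> g | g. g \<in> U \<and> inv g \<in> U'} (\<lambda>x. \<psi> (inv (inv_into U \<phi> x)))"

text \<open>Only continuity of the action is assumed; continuous finite-dimensional representations of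
  Lie groups are automatically smooth.\<close>

locale orthogonal_representation =
  compact_Lie_group G T E \<A> + group_action G V \<rho>
  for G :: "('g, 'm) monoid_scheme" (structure)
    and T :: "'g topology"
    and E :: "'e::euclidean_space set"
    and \<A> :: "('g set \<times> ('g \<Rightarrow> 'e)) set"
    and V :: "'v::euclidean_space set"
    and \<rho> :: "'g \<Rightarrow> 'v \<Rightarrow> 'v" +
  assumes subspace_space: "subspace V"
    and act_add: "\<And>g x y. g \<in> carrier G \<Longrightarrow> x \<in> V \<Longrightarrow> y \<in> V \<Longrightarrow> \<rho> g (x + y) = \<rho> g x + \<rho> g y"
    and act_scaleR: "\<And>g c x. g \<in> carrier G \<Longrightarrow> x \<in> V \<Longrightarrow> \<rho> g (c *\<^sub>R x) = c *\<^sub>R \<rho> g x"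
    and act_norm: "\<And>g x. g \<in> carrier G \<Longrightarrow> x \<in> V \<Longrightarrow> norm (\<rho> g x) = norm x"
    and act_continuous:
      "continuous_map (prod_topology T (top_of_set V)) (top_of_set V) (\<lambda>(g, x). \<rho> g x)"

text \<open>Principal orbits are the orbits of maximal orbit type: their isotropy groups are conjugate
  to a subgroup of every isotropy group.\<close>

definition principal_orbit ::
  "('g, 'm) monoid_scheme \<Rightarrow> 'v set \<Rightarrow> ('g \<Rightarrow> 'v \<Rightarrow> 'v) \<Rightarrow> 'v set \<Rightarrow> bool" where
  "principal_orbit G V \<rho> Q \<longleftrightarrow> Q \<in> orbits G V \<rho> \<and>
     (\<forall>p\<in>Q. \<forall>q\<in>V. \<exists>g\<in>carrier G.
        g <#\<^bsub>G\<^esub> stabilizer G \<rho> p #>\<^bsub>G\<^esub> inv\<^bsub>G\<^esub> g \<subseteq> stabilizer G \<rho> q)"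

definition regular_point ::
  "('g, 'm) monoid_scheme \<Rightarrow> 'v set \<Rightarrow> ('g \<Rightarrow> 'v \<Rightarrow> 'v) \<Rightarrow> 'v \<Rightarrow> bool" where
  "regular_point G V \<rho> p \<longleftrightarrow> (\<exists>Q. principal_orbit G V \<rho> Q \<and> p \<in> Q)"


section \<open>Sections and copolarity\<close>

definition k_section ::
  "('g, 'm) monoid_scheme \<Rightarrow> 'v::euclidean_space set \<Rightarrow> ('g \<Rightarrow> 'v \<Rightarrow> 'v) \<Rightarrow> nat \<Rightarrow> 'v set \<Rightarrow> bool"
where
  "k_section G V \<rho> k \<Sigma> \<longleftrightarrow>
     \<Sigma> \<subseteq> V \<and> connected \<Sigma> \<and> complete_submanifold \<Sigma> \<and>
     totally_geodesic V \<Sigma> \<and>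
     (\<forall>Q\<in>orbits G V \<rho>. \<Sigma> \<inter> Q \<noteq> {}) \<and>
     (\<forall>p\<in>\<Sigma>. regular_point G V \<rho> p \<longrightarrow>
        normal_space V (orbit G \<rho> p) p \<subseteq> tangent_space \<Sigma> p \<and>
        dim (tangent_space \<Sigma> p) = dim (normal_space V (orbit G \<rho> p) p) + k) \<and>
     (\<forall>p\<in>\<Sigma>. regular_point G V \<rho> p \<longrightarrow>
        (\<forall>g\<in>carrier G. \<rho> g p \<in> \<Sigma> \<longrightarrow> \<rho> g ` \<Sigma> = \<Sigma>))"

definition sections_through ::
  "('g, 'm) monoid_scheme \<Rightarrow> 'v::euclidean_space set \<Rightarrow> ('g \<Rightarrow> 'v \<Rightarrow> 'v) \<Rightarrow> 'v \<Rightarrow> 'v set set" where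
  "sections_through G V \<rho> p = {\<Sigma>. p \<in> \<Sigma> \<and> (\<exists>k. k_section G V \<rho> k \<Sigma>)}"

definition minimal_section_through ::
  "('g, 'm) monoid_scheme \<Rightarrow> 'v::euclidean_space set \<Rightarrow> ('g \<Rightarrow> 'v \<Rightarrow> 'v) \<Rightarrow> 'v \<Rightarrow> 'v set \<Rightarrow> bool"
where
  "minimal_section_through G V \<rho> p \<Sigma> \<longleftrightarrow> \<Sigma> \<in> sections_through G V \<rho> p \<and>
     (\<forall>\<Sigma>'\<in>sections_through G V \<rho> p. \<Sigma>' \<subseteq> \<Sigma> \<longrightarrow> \<Sigma>' = \<Sigma>)"

text \<open>For an orthogonal representation, a regular point exists, and the \<open>k\<close> below exists and depends
  neither on the regular point nor on the minimal section.\<close>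

definition copol ::
  "('g, 'm) monoid_scheme \<Rightarrow> 'v::euclidean_space set \<Rightarrow> ('g \<Rightarrow> 'v \<Rightarrow> 'v) \<Rightarrow> nat" where
  "copol G V \<rho> = (THE k. \<exists>p \<Sigma>. regular_point G V \<rho> p \<and> minimal_section_through G V \<rho> p \<Sigma> \<and>
     k_section G V \<rho> k \<Sigma>)"

end

theory Submission
  imports Defs
begin

text \<open>A \<open>k\<close>-section contains \<open>0\<close> and is flat, hence it is a linear subspace; conversely, linear subspaces
  satisfy all the differential geometric requirements. The closed linear group \<open>H\<close> of the representation
  has the tangent spaces \<open>\<hh> p\<close> at its orbits, where \<open>\<hh>\<close> is its Lie algebra, so the normal spaces have
  the same dimension at all regular points, and the intersection \<open>M\<^sub>p\<close> of all sections through a regular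
  point \<open>p\<close> is the minimal section. It does not change if \<open>p\<close> moves to another regular point of \<open>M\<^sub>p\<close>.

  For \<open>p\<close> regular in \<open>V1\<close>, let \<open>S p\<close> be the set of all \<open>v \<in> V1\<close> that lie in \<open>M\<^sub>p\<^sub>+\<^sub>y\<close> for generic \<open>y \<in> V2\<close>.
  If \<open>q \<in> S p\<close> is regular in \<open>V1\<close>, then for generic \<open>y\<close> the point \<open>q + y\<close> is a regular point of \<open>M\<^sub>p\<^sub>+\<^sub>y\<close>, so
  \<open>M\<^sub>q\<^sub>+\<^sub>y = M\<^sub>p\<^sub>+\<^sub>y\<close> and \<open>S q = S p\<close>. By equivariance \<open>S p\<close> is a section of \<open>V1\<close>. Since the normal space
  at \<open>p + y\<close> meets \<open>V1\<close> in the normal space at \<open>p\<close>, the codimension of the latter in \<open>S p\<close> is at most that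
  of the former in \<open>M\<^sub>p\<^sub>+\<^sub>y\<close>.\<close>

section \<open>The Riemannian distance\<close>

text \<open>For one fixed \<open>y\<close> there is no reason why the trace on \<open>V1\<close> of
  the minimal section at \<open>p + y\<close> should satisfy (C4): \<open>q + y\<close> may fail to
  be regular for another regular \<open>q\<close> of \<open>V1\<close>, and an element that takes
  \<open>p\<close> to \<open>q\<close> moves \<open>y\<close> as well. Hence the passage to generic
  \<open>y\<close>. Regularity of \<open>p + y\<close> is an open and dense condition on
  \<open>y\<close>, so finitely many such conditions can be met at once, and the group permutes
  them; this makes \<open>S p\<close> linear and equivariant in \<open>p\<close>. If
  \<open>N\<close> and \<open>M\<close> denote the normal space and the minimal section at
  \<open>p + y\<close>, then \<open>S p + N\<close> lies in \<open>M\<close> and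
  \<open>S p \<inter> N\<close> in the normal space at \<open>p\<close> in \<open>V1\<close>; the
  dimension formula for sums gives the estimate. Existence and density of regular points come from
  shortest segments from a point to an orbit (Kleiner), openness from the fixed space of the
  isotropy group, whose dimension is maximal exactly at regular points. Tangent vectors of orbits
  are velocities of curves that come without lifts to the group; a linear bound on the distance of
  suitable lifts from \<open>1\<close> turns them into elements of the Lie algebra.\<close>

abbreviation speed :: "(real \<Rightarrow> 'a::real_normed_vector) \<Rightarrow> real \<Rightarrow> real" where
  "speed \<gamma> t \<equiv> norm (vector_derivative \<gamma> (at t))"

lemma valid_path_has_vector_derivative:
  assumes "valid_path \<gamma>"
  obtains S where "finite S"
    "\<And>t. t \<in> {0..1} - S \<Longrightarrow> (\<gamma> has_vector_derivative vector_derivative \<gamma> (at t)) (at t)"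
proof -
  obtain S where S: "finite S" "\<gamma> C1_differentiable_on ({0..1} - S)"
    using assms unfolding valid_path_def piecewise_C1_differentiable_on_def by blast
  then have "(\<gamma> has_vector_derivative vector_derivative \<gamma> (at t)) (at t)" if "t \<in> {0..1} - S" for t
    using that vector_derivative_works unfolding C1_differentiable_on_eq by blast
  with S(1) show ?thesis using that by blast
qed

text \<open>The displacement is the integral of the velocity, by the fundamental theorem of calculus
  off the finitely many corners.\<close>

lemma dist_le_length:
  fixes \<gamma> :: "real \<Rightarrow> 'a::euclidean_space"
  assumes \<gamma>: "valid_path \<gamma>" and L: "(speed \<gamma> has_integral L) {0..1}"
  shows "dist (pathstart \<gamma>) (pathfinish \<gamma>) \<le> L"
proof -
  obtain S where S: "finite S"
    "\<And>t. t \<in> {0..1} - S \<Longrightarrow> (\<gamma> has_vector_derivative vector_derivative \<gamma> (at t)) (at t)"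
    using valid_path_has_vector_derivative[OF \<gamma>] by metis
  have "continuous_on {0..1} \<gamma>"
    using valid_path_imp_path[OF \<gamma>] by (simp add: path_def)
  then have I: "((\<lambda>t. vector_derivative \<gamma> (at t)) has_integral (\<gamma> 1 - \<gamma> 0)) {0..1}"
    by (intro fundamental_theorem_of_calculus_interior_strong[OF S(1)] S(2)) auto
  have "norm (integral {0..1} (\<lambda>t. vector_derivative \<gamma> (at t))) \<le> integral {0..1} (speed \<gamma>)"
    by (rule Henstock_Kurzweil_Integration.integral_norm_bound_integral) (use I L in auto)
  then show ?thesis
    using integral_unique[OF I] integral_unique[OF L]
    by (simp add: pathstart_def pathfinish_def dist_norm norm_minus_commute)
qed

text \<open>Change of variables \<open>t \<mapsto> m * t + c\<close>, which by \<open>img\<close>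
  takes \<open>{a..b}\<close> onto \<open>{0..1}\<close>. The values \<open>-1\<close> and
  \<open>2\<close> of \<open>m\<close> give the reversed path and the two halves of a
  concatenation.\<close>

lemma speed_has_integral_affine:
  fixes g h :: "real \<Rightarrow> 'a::euclidean_space"
  assumes g: "valid_path g" and L: "(speed g has_integral L) {0..1}" and m: "m \<noteq> 0" and "a < b"
    and img: "(\<lambda>x. (1 / m) *\<^sub>R x + - ((1 / m) *\<^sub>R c)) ` {0..1} = {a..b}"
    and h: "\<And>t. t \<in> {a..b} \<Longrightarrow> h t = g (m * t + c)"
  shows "(speed h has_integral L) {a..b}"
proof -
  obtain S where S: "finite S"
    "\<And>t. t \<in> {0..1} - S \<Longrightarrow> (g has_vector_derivative vector_derivative g (at t)) (at t)"
    using valid_path_has_vector_derivative[OF g] by metis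
  have range: "m * t + c \<in> {0..1}" if "t \<in> {a..b}" for t
    using that m unfolding img[symmetric] by (auto simp: field_simps)
  have "((\<lambda>t. speed g (m *\<^sub>R t + c)) has_integral (1 / (\<bar>m\<bar> ^ DIM(real))) *\<^sub>R L)
      ((\<lambda>x. (1 / m) *\<^sub>R x + - ((1 / m) *\<^sub>R c)) ` cbox 0 1)"
    by (rule has_integral_affinity) (use L m in simp_all)
  then have "((\<lambda>t. speed g (m * t + c)) has_integral L / \<bar>m\<bar>) {a..b}"
    using img by simp
  from has_integral_mult_right[OF this, of "\<bar>m\<bar>"]
  have I: "((\<lambda>t. \<bar>m\<bar> * speed g (m * t + c)) has_integral L) {a..b}"
    using m by simp
  \<comment> \<open>The endpoints are excluded because \<open>h\<close> is known only on
    \<open>{a..b}\<close>, which does not determine its two-sided derivative there.\<close>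
  let ?S = "{a, b} \<union> (\<lambda>x. (x - c) / m) ` S"
  show ?thesis
  proof (rule has_integral_spike_finite[OF _ _ I])
    show "finite ?S" using S(1) by simp
    fix t assume t: "t \<in> {a..b} - ?S"
    then have mt: "m * t + c \<in> {0..1} - S"
      using range[of t] m by (auto simp: image_iff field_simps)
    have "((\<lambda>s. m * s + c) has_vector_derivative m) (at t)"
      by (auto intro!: derivative_eq_intros)
    from vector_diff_chain_at[OF this S(2)[OF mt]]
    have "((\<lambda>s. g (m * s + c)) has_vector_derivative m *\<^sub>R vector_derivative g (at (m * t + c))) (at t)"
      by (simp add: comp_def)
    then have "(h has_vector_derivative m *\<^sub>R vector_derivative g (at (m * t + c))) (at t)"
      by (rule has_vector_derivative_transform_within_open[of _ _ _ "{a<..<b}"]) (use t h in auto)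
    then show "speed h t = \<bar>m\<bar> * speed g (m * t + c)"
      by (simp add: vector_derivative_at)
  qed
qed

lemma speed_has_integral_reversepath:
  fixes g :: "real \<Rightarrow> 'a::euclidean_space"
  assumes "valid_path g" "(speed g has_integral L) {0..1}"
  shows "(speed (reversepath g) has_integral L) {0..1}"
proof (rule speed_has_integral_affine[OF assms, of "-1" _ _ 1])
  show "(\<lambda>x. (1 / - 1) *\<^sub>R x + - ((1 / - 1) *\<^sub>R 1)) ` {0..1} = {0..1::real}"
    by (auto simp: image_iff intro!: bexI[of _ "1 - _"])
qed (auto simp: reversepath_def)

lemma speed_has_integral_joinpaths:
  fixes g h :: "real \<Rightarrow> 'a::euclidean_space"
  assumes g: "valid_path g" "(speed g has_integral L) {0..1}"
    and h: "valid_path h" "(speed h has_integral L') {0..1}" and "pathfinish g = pathstart h"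
  shows "(speed (g +++ h) has_integral (L + L')) {0..1}"
proof (rule has_integral_combine[of 0 "1/2" 1])
  show "(speed (g +++ h) has_integral L) {0..1/2}"
  proof (rule speed_has_integral_affine[OF g, of 2 _ _ 0])
    show "(\<lambda>x. (1 / 2) *\<^sub>R x + - ((1 / 2) *\<^sub>R 0)) ` {0..1} = {0..1/2::real}"
      by (auto simp: image_iff intro!: bexI[of _ "2 * _"])
  qed (auto simp: joinpaths_def)
  show "(speed (g +++ h) has_integral L') {1/2..1}"
  proof (rule speed_has_integral_affine[OF h, of 2 _ _ "-1"])
    show "(\<lambda>x. (1 / 2) *\<^sub>R x + - ((1 / 2) *\<^sub>R - 1)) ` {0..1} = {1/2..1::real}"
      by (auto simp: image_iff field_simps intro!: bexI[of _ "2 * _ - 1"])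
    show "(g +++ h) t = h (2 * t + - 1)" if "t \<in> {1/2..1}" for t
    proof (cases "t = 1/2")
      case True
      then show ?thesis using assms(5) by (simp add: joinpaths_def pathfinish_def pathstart_def True)
    qed (use that in \<open>auto simp: joinpaths_def\<close>)
  qed auto
qed auto

definition path_lengths :: "'a::euclidean_space set \<Rightarrow> 'a \<Rightarrow> 'a \<Rightarrow> real set" where
  "path_lengths M p q = {L. \<exists>\<gamma>. valid_path \<gamma> \<and> path_image \<gamma> \<subseteq> M \<and> pathstart \<gamma> = p \<and>
     pathfinish \<gamma> = q \<and> (speed \<gamma> has_integral L) {0..1}}"

lemma riemannian_dist_eq: "p \<in> M \<Longrightarrow> q \<in> M \<Longrightarrow> riemannian_dist M p q = Inf (path_lengths M p q)"
  by (simp add: riemannian_dist_def path_lengths_def)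

lemma dist_le_path_lengths: "L \<in> path_lengths M p q \<Longrightarrow> dist p q \<le> L"
  using dist_le_length unfolding path_lengths_def by blast

lemma path_lengthsI:
  "valid_path \<gamma> \<Longrightarrow> path_image \<gamma> \<subseteq> M \<Longrightarrow> (speed \<gamma> has_integral L) {0..1} \<Longrightarrow>
    L \<in> path_lengths M (pathstart \<gamma>) (pathfinish \<gamma>)"
  unfolding path_lengths_def by blast

lemma path_lengthsE:
  assumes "L \<in> path_lengths M p q"
  obtains \<gamma> where "valid_path \<gamma>" "path_image \<gamma> \<subseteq> M" "pathstart \<gamma> = p" "pathfinish \<gamma> = q"
    "(speed \<gamma> has_integral L) {0..1}"
  using assms unfolding path_lengths_def by blast

lemma path_lengths_reverse:
  assumes "L \<in> path_lengths M p q" shows "L \<in> path_lengths M q p"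
proof -
  obtain \<gamma> where \<gamma>: "valid_path \<gamma>" "path_image \<gamma> \<subseteq> M" "pathstart \<gamma> = p" "pathfinish \<gamma> = q"
    "(speed \<gamma> has_integral L) {0..1}"
    using assms by (rule path_lengthsE)
  then have "L \<in> path_lengths M (pathstart (reversepath \<gamma>)) (pathfinish (reversepath \<gamma>))"
    by (intro path_lengthsI speed_has_integral_reversepath valid_path_imp_reverse) simp_all
  then show ?thesis using \<gamma>(3,4) by simp
qed

lemma path_lengths_commute: "path_lengths M p q = path_lengths M q p"
  using path_lengths_reverse by (intro equalityI subsetI)

lemma path_lengths_add:
  assumes "L \<in> path_lengths M x y" "L' \<in> path_lengths M y z"
  shows "L + L' \<in> path_lengths M x z"
proof -
  obtain g where g: "valid_path g" "path_image g \<subseteq> M" "pathstart g = x" "pathfinish g = y"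
    "(speed g has_integral L) {0..1}"
    using assms(1) by (rule path_lengthsE)
  obtain h where h: "valid_path h" "path_image h \<subseteq> M" "pathstart h = y" "pathfinish h = z"
    "(speed h has_integral L') {0..1}"
    using assms(2) by (rule path_lengthsE)
  have "L + L' \<in> path_lengths M (pathstart (g +++ h)) (pathfinish (g +++ h))"
    using g h
    by (intro path_lengthsI speed_has_integral_joinpaths valid_path_join subset_path_image_join)
      simp_all
  then show ?thesis using g(3) h(4) by simp
qed

lemma path_lengths_segment:
  assumes "closed_segment p q \<subseteq> M" shows "dist p q \<in> path_lengths M p q"
proof -
  have "(linepath p q has_vector_derivative (q - p)) (at t)" for t
    by (rule has_vector_derivative_linepath_within)
  then have "vector_derivative (linepath p q) (at t) = q - p" for t
    by (rule vector_derivative_at)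
  then have "(speed (linepath p q) has_integral dist p q) {0..1}"
    using has_integral_const_real[of "dist p q" 0 1] by (simp add: dist_norm norm_minus_commute)
  then show ?thesis
    unfolding path_lengths_def using assms by (intro CollectI exI[of _ "linepath p q"]) simp
qed

lemma bdd_below_path_lengths: "bdd_below (path_lengths M p q)"
  using dist_le_path_lengths by (rule bdd_belowI)

lemma riemannian_dist_le_dist:
  assumes "p \<in> M" "q \<in> M" "closed_segment p q \<subseteq> M"
  shows "riemannian_dist M p q \<le> dist p q"
  unfolding riemannian_dist_eq[OF assms(1,2)]
  by (rule cInf_lower[OF path_lengths_segment[OF assms(3)] bdd_below_path_lengths])

lemma dist_le_riemannian_dist:
  assumes "p \<in> M" "q \<in> M" "path_lengths M p q \<noteq> {}"
  shows "dist p q \<le> riemannian_dist M p q"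
  unfolding riemannian_dist_eq[OF assms(1,2)]
  by (rule cInf_greatest[OF assms(3) dist_le_path_lengths])

text \<open>\<open>ne\<close> keeps \<open>Inf\<close> away from the empty set. Definiteness holds
  because lengths bound the Euclidean distance, the triangle inequality because lengths add under
  concatenation.\<close>

lemma Metric_space_riemannian_dist:
  assumes ne: "\<And>p q. p \<in> M \<Longrightarrow> q \<in> M \<Longrightarrow> path_lengths M p q \<noteq> {}"
  shows "Metric_space M (riemannian_dist M)"
proof
  fix x y :: 'a
  show "0 \<le> riemannian_dist M x y"
  proof (cases "x \<in> M \<and> y \<in> M")
    case True
    then show ?thesis using dist_le_riemannian_dist ne by (meson order_trans zero_le_dist)
  qed (auto simp: riemannian_dist_def)
  show "riemannian_dist M x y = riemannian_dist M y x"
  proof (cases "x \<in> M \<and> y \<in> M")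
    case True
    then show ?thesis by (simp add: riemannian_dist_eq path_lengths_commute)
  qed (auto simp: riemannian_dist_def)
next
  fix x y assume xy: "x \<in> M" "y \<in> M"
  show "riemannian_dist M x y = 0 \<longleftrightarrow> x = y"
  proof
    assume "riemannian_dist M x y = 0"
    then have "dist x y \<le> 0" using dist_le_riemannian_dist[OF xy ne[OF xy]] by simp
    then show "x = y" by simp
  next
    assume "x = y"
    then have "riemannian_dist M x y \<le> 0" "dist x y \<le> riemannian_dist M x y"
      using riemannian_dist_le_dist[OF xy] dist_le_riemannian_dist[OF xy ne[OF xy]] xy by simp_all
    then show "riemannian_dist M x y = 0" using \<open>x = y\<close> by simp
  qed
next
  fix x y z assume xyz: "x \<in> M" "y \<in> M" "z \<in> M"
  have "Inf (path_lengths M x z) - L' \<le> L" if "L \<in> path_lengths M x y" "L' \<in> path_lengths M y z" for L L'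
    using cInf_lower[OF path_lengths_add[OF that] bdd_below_path_lengths] by linarith
  then have "Inf (path_lengths M x z) - L' \<le> Inf (path_lengths M x y)" if "L' \<in> path_lengths M y z" for L'
    using that ne xyz by (intro cInf_greatest) auto
  then have "Inf (path_lengths M x z) - Inf (path_lengths M x y) \<le> L'" if "L' \<in> path_lengths M y z" for L'
    using that by (simp add: algebra_simps)
  then have "Inf (path_lengths M x z) - Inf (path_lengths M x y) \<le> Inf (path_lengths M y z)"
    using ne xyz by (intro cInf_greatest) auto
  then show "riemannian_dist M x z \<le> riemannian_dist M x y + riemannian_dist M y z"
    using xyz by (simp add: riemannian_dist_eq)
qed

section \<open>Linear subspaces as submanifolds\<close>

lemma Ck_on_const: "Ck_on k U (\<lambda>x. c)"
  by (induction k arbitrary: c) (auto simp: frechet_derivative_const)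

lemma Ck_on_ident: "Ck_on k U (\<lambda>x. x)"
  by (cases k) (auto simp: Ck_on_const frechet_derivative_ident)

lemma smooth_on_if_Ck_on: "(\<And>k. Ck_on k UNIV f) \<Longrightarrow> smooth_on S f"
  unfolding smooth_on_def by (intro ballI exI[of _ UNIV]) auto

lemma has_vector_derivative_mem_subspace:
  fixes c :: "real \<Rightarrow> 'a::euclidean_space"
  assumes c: "(c has_vector_derivative v) (at 0)" and S: "subspace S"
    and mem: "e > 0" "\<And>t. t \<in> {-e<..<e} \<Longrightarrow> c t \<in> S"
  shows "v \<in> S"
proof (rule ccontr)
  assume "v \<notin> S"
  obtain a b where ab: "a \<in> span S" "\<And>w. w \<in> span S \<Longrightarrow> orthogonal b w" "v = a + b"
    using orthogonal_subspace_decomp_exists[of S v] by metis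
  have "((\<lambda>t. c t \<bullet> b) has_vector_derivative v \<bullet> b) (at 0)"
    by (rule bounded_linear.has_vector_derivative[OF bounded_linear_inner_left c])
  moreover have "((\<lambda>t. c t \<bullet> b) has_vector_derivative 0) (at 0)"
  proof (rule has_vector_derivative_transform_within_open[of "\<lambda>t. 0" _ _ "{-e<..<e}"])
    show "0 = c t \<bullet> b" if "t \<in> {-e<..<e}" for t
      using ab(2)[OF span_base[OF mem(2)[OF that]]] by (simp add: orthogonal_def inner_commute)
  qed (use mem(1) in auto)
  ultimately have "v \<bullet> b = 0" by (rule vector_derivative_unique_at)
  moreover have "a \<bullet> b = 0" using ab(1,2) by (simp add: orthogonal_def inner_commute)
  ultimately have "b = 0" using ab(3) by (simp add: inner_add_left)
  then show False using ab(1,3) \<open>v \<notin> S\<close> S by (simp add: span_eq_iff[THEN iffD2])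
qed

lemma tangent_space_subset_subspace:
  assumes "subspace S" "M \<subseteq> S" shows "tangent_space M p \<subseteq> S"
proof
  fix v assume "v \<in> tangent_space M p"
  then obtain \<gamma> e where "e > 0" "\<gamma> ` {-e<..<e} \<subseteq> M" "(\<gamma> has_vector_derivative v) (at 0)"
    unfolding tangent_space_def by blast
  then show "v \<in> S" using assms by (intro has_vector_derivative_mem_subspace[of \<gamma> v S e]) blast+
qed

lemma Ck_on_line: "Ck_on k U (\<lambda>t::real. p + t *\<^sub>R v)"
proof (cases k)
  case 0
  then show ?thesis by (simp add: continuous_intros)
next
  case (Suc n)
  have d: "((\<lambda>t. p + t *\<^sub>R v) has_derivative (\<lambda>h. h *\<^sub>R v)) (at x)" for x
    by (auto intro!: derivative_eq_intros)
  then have "frechet_derivative (\<lambda>t. p + t *\<^sub>R v) (at x) = (\<lambda>h. h *\<^sub>R v)" for x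
    by (metis frechet_derivative_at)
  then show ?thesis
    using d Suc by (auto simp: Ck_on_const differentiable_def)
qed

lemma tangent_space_subspace:
  assumes S: "subspace S" and p: "p \<in> S" shows "tangent_space S p = S"
proof
  show "tangent_space S p \<subseteq> S" by (rule tangent_space_subset_subspace[OF S]) simp
  show "S \<subseteq> tangent_space S p"
  proof
    fix v assume v: "v \<in> S"
    have "((\<lambda>t. p + t *\<^sub>R v) has_vector_derivative v) (at 0)"
      by (auto intro!: derivative_eq_intros)
    moreover have "smooth_on {-1<..<1} (\<lambda>t::real. p + t *\<^sub>R v)"
      by (intro smooth_on_if_Ck_on Ck_on_line)
    ultimately show "v \<in> tangent_space S p"
      unfolding tangent_space_def using S p v
      by (intro CollectI exI[of _ "\<lambda>t. p + t *\<^sub>R v"] exI[of _ 1])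
        (auto intro: subspace_add subspace_scale)
  qed
qed

lemma smooth_on_differentiable:
  assumes "smooth_on S f" "x \<in> interior S" shows "f differentiable (at x)"
proof -
  obtain U F where U: "open U" "x \<in> U" "\<And>k. Ck_on k U F" "\<And>y. y \<in> U \<inter> S \<Longrightarrow> F y = f y"
    using assms interior_subset unfolding smooth_on_def by (metis subsetD)
  have "F differentiable (at x)" using U(2) U(3)[of "Suc 0"] by simp
  then obtain F' where "(F has_derivative F') (at x)" by (auto simp: differentiable_def)
  then have "(f has_derivative F') (at x)"
    by (rule has_derivative_transform_within_open[of _ _ _ _ "U \<inter> interior S"])
      (use U assms(2) interior_subset in auto)
  then show ?thesis by (auto simp: differentiable_def)
qed

text \<open>A tangent field along a curve in \<open>S\<close> is itself a curve in \<open>S\<close>,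
  so its derivative stays in \<open>S\<close>.\<close>

lemma totally_geodesic_subspace:
  assumes S: "subspace S" shows "totally_geodesic V S"
  unfolding totally_geodesic_def
proof (intro allI impI ballI)
  fix \<gamma> :: "real \<Rightarrow> 'a" and X :: "real \<Rightarrow> 'a" and e :: real and n
  assume e: "e > 0" and X: "smooth_on {-e<..<e} X"
    and mem: "\<forall>t\<in>{-e<..<e}. \<gamma> t \<in> S \<and> X t \<in> tangent_space S (\<gamma> t)"
    and n: "n \<in> normal_space V S (\<gamma> 0)"
  have \<gamma>0: "\<gamma> 0 \<in> S" using mem e by auto
  have "(X has_vector_derivative vector_derivative X (at 0)) (at 0)"
    using smooth_on_differentiable[OF X, of 0] e
    by (simp add: vector_derivative_works[symmetric] interior_open)
  then have "vector_derivative X (at 0) \<in> S"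
    by (rule has_vector_derivative_mem_subspace[OF _ S e])
      (use mem tangent_space_subspace[OF S] in blast)
  then show "vector_derivative X (at 0) \<bullet> n = 0"
    using n unfolding normal_space_def tangent_space_subspace[OF S \<gamma>0]
    by (simp add: orthogonal_comp_def orthogonal_def)
qed

lemma submanifold_subspace:
  assumes S: "subspace S" shows "submanifold S"
proof -
  have "diffeomorphism_on S S (\<lambda>x. x) (\<lambda>x. x)"
    unfolding diffeomorphism_on_def
    by (auto simp: homeomorphism_def intro!: smooth_on_if_Ck_on Ck_on_ident)
  then show ?thesis
    unfolding submanifold_def using S
    by (intro exI[of _ "dim S"] ballI exI[of _ S] exI[of _ "\<lambda>x. x"]) auto
qed

text \<open>Segments stay in \<open>S\<close>, so the Riemannian distance is the Euclidean one on
  \<open>S\<close>, and \<open>S\<close> is closed.\<close>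

lemma complete_submanifold_subspace:
  assumes S: "subspace S" shows "complete_submanifold S"
proof -
  have seg: "closed_segment p q \<subseteq> S" if "p \<in> S" "q \<in> S" for p q
    using that subspace_imp_convex[OF S] by (simp add: closed_segment_subset)
  have ne: "path_lengths S p q \<noteq> {}" if "p \<in> S" "q \<in> S" for p q
    using path_lengths_segment[OF seg[OF that]] by blast
  have eq: "riemannian_dist S p q = dist p q" if "p \<in> S" "q \<in> S" for p q
    using riemannian_dist_le_dist[OF that seg[OF that]] dist_le_riemannian_dist[OF that ne[OF that]] by simp
  interpret Metric_space S "riemannian_dist S"
    by (rule Metric_space_riemannian_dist[OF ne])
  have mcomplete
    unfolding mcomplete_def
  proof (intro allI impI)
    fix \<sigma> assume "MCauchy \<sigma>"
    then have \<sigma>: "\<And>n. \<sigma> n \<in> S" "\<And>e. e > 0 \<Longrightarrow> \<exists>N. \<forall>n n'. N \<le> n \<longrightarrow> N \<le> n' \<longrightarrow> riemannian_dist S (\<sigma> n) (\<sigma> n') < e"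
      by (auto simp: MCauchy_def)
    then have "Cauchy \<sigma>" unfolding Cauchy_def by (simp add: eq)
    then obtain l where l: "\<sigma> \<longlonglongrightarrow> l" using Cauchy_convergent convergent_def by blast
    have "l \<in> S" by (rule closed_sequentially[OF closed_subspace[OF S] \<sigma>(1) l])
    then have "limitin mtopology \<sigma> l sequentially"
      using l \<sigma>(1) by (simp add: limit_metric_sequentially eq lim_sequentially)
    then show "\<exists>x. limitin mtopology \<sigma> x sequentially" by blast
  qed
  then show ?thesis by (simp add: complete_submanifold_def submanifold_subspace S)
qed

section \<open>Totally geodesic submanifolds through the origin\<close>

lemma Ck_on_subset: "Ck_on k U f \<Longrightarrow> V \<subseteq> U \<Longrightarrow> Ck_on k V f"
  by (induction k arbitrary: f) (auto intro: continuous_on_subset)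

lemma Ck_on_cong:
  assumes "open U" "Ck_on k U f" "\<And>x. x \<in> U \<Longrightarrow> f x = g x"
  shows "Ck_on k U g"
  using assms(2,3)
proof (induction k arbitrary: f g)
  case 0
  then show ?case by (simp cong: continuous_on_cong)
next
  case (Suc k)
  have d: "(g has_derivative frechet_derivative f (at x)) (at x)" if "x \<in> U" for x
    by (rule has_derivative_transform_within_open[of f _ _ _ U])
      (use Suc.prems assms(1) that in \<open>auto simp: frechet_derivative_works[symmetric]\<close>)
  have eq: "frechet_derivative f (at x) = frechet_derivative g (at x)" if "x \<in> U" for x
    by (rule frechet_derivative_at[OF d[OF that]])
  have "Ck_on k U (\<lambda>x. frechet_derivative g (at x) v)" for v
  proof (rule Suc.IH)
    show "Ck_on k U (\<lambda>x. frechet_derivative f (at x) v)" using Suc.prems(1) by simp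
  qed (rule fun_cong[OF eq])
  moreover have "g differentiable (at x)" if "x \<in> U" for x
    using d[OF that] differentiable_def by blast
  ultimately show ?case by simp
qed

text \<open>Provides the smooth test curves and test fields in a chart, which are taken along images
  of straight lines.\<close>

lemma Ck_on_compose_line:
  fixes x v :: "'a::euclidean_space"
  assumes "open J" "\<And>t. t \<in> J \<Longrightarrow> x + t *\<^sub>R v \<in> U" "Ck_on k U f"
  shows "Ck_on k J (\<lambda>t::real. f (x + t *\<^sub>R v))"
  using assms(3)
proof (induction k arbitrary: f)
  case 0
  then have "continuous_on U f" by simp
  then show ?case
    using assms(2) by (auto intro!: continuous_on_compose2[of U f] continuous_intros)
next
  case (Suc k)
  have d: "((\<lambda>t. f (x + t *\<^sub>R v)) has_derivative
      (\<lambda>h. frechet_derivative f (at (x + t *\<^sub>R v)) (h *\<^sub>R v))) (at t)" if "t \<in> J" for t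
  proof -
    have "((\<lambda>t. x + t *\<^sub>R v) has_derivative (\<lambda>h. h *\<^sub>R v)) (at t)"
      by (auto intro!: derivative_eq_intros)
    moreover have "(f has_derivative frechet_derivative f (at (x + t *\<^sub>R v))) (at (x + t *\<^sub>R v))"
      using Suc.prems assms(2)[OF that] by (simp add: frechet_derivative_works[symmetric])
    ultimately show ?thesis by (rule has_derivative_compose)
  qed
  then have eq: "frechet_derivative (\<lambda>t. f (x + t *\<^sub>R v)) (at t) h
      = frechet_derivative f (at (x + t *\<^sub>R v)) (h *\<^sub>R v)" if "t \<in> J" for t h
    using frechet_derivative_at[OF d[OF that], symmetric] by simp
  have "Ck_on k J (\<lambda>t. frechet_derivative (\<lambda>t. f (x + t *\<^sub>R v)) (at t) h)" for h
  proof (rule Ck_on_cong[OF assms(1)])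
    show "Ck_on k J (\<lambda>t. frechet_derivative f (at (x + t *\<^sub>R v)) (h *\<^sub>R v))"
      using Suc.prems by (intro Suc.IH) simp
  qed (simp add: eq)
  then show ?case using d by (auto simp: differentiable_def)
qed

text \<open>\<open>\<phi> t * exp (- C * t)\<close> is nonincreasing on \<open>{0..1}\<close> and
  starts at \<open>0\<close>.\<close>

lemma gronwall_zero:
  fixes \<phi> :: "real \<Rightarrow> real"
  assumes d: "\<And>t. t \<in> {0..1} \<Longrightarrow> (\<phi> has_real_derivative \<phi>' t) (at t)"
    and le: "\<And>t. t \<in> {0..1} \<Longrightarrow> \<phi>' t \<le> C * \<phi> t" and "\<phi> 0 = 0" "0 \<le> \<phi> 1"
  shows "\<phi> 1 = 0"
proof -
  have "\<phi> 1 * exp (- C * 1) \<le> \<phi> 0 * exp (- C * 0)"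
  proof (rule DERIV_nonpos_imp_nonincreasing[of 0 1 "\<lambda>t. \<phi> t * exp (- C * t)"])
    fix t :: real assume "0 \<le> t" "t \<le> 1"
    then have t: "t \<in> {0..1}" by simp
    have "((\<lambda>t. \<phi> t * exp (- C * t)) has_real_derivative (\<phi>' t - C * \<phi> t) * exp (- C * t)) (at t)"
      using d[OF t] by (auto intro!: derivative_eq_intros simp: algebra_simps)
    moreover have "(\<phi>' t - C * \<phi> t) * exp (- C * t) \<le> 0"
      using le[OF t] by (intro mult_nonpos_nonneg) auto
    ultimately show "\<exists>y. ((\<lambda>t. \<phi> t * exp (- C * t)) has_real_derivative y) (at t) \<and> y \<le> 0"
      by blast
  qed simp
  then have "\<phi> 1 * exp (- C) \<le> 0" using assms(3) by simp
  then show ?thesis using assms(4) by (simp add: mult_le_0_iff)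
qed

text \<open>Uniqueness for a homogeneous linear system: as twice a product is at most the sum of the
  squares, the derivative of the sum of squares \<open>\<phi>\<close> is at most
  \<open>2 * K * card B * \<phi>\<close>, and Gronwall applies.\<close>

lemma linear_system_zero:
  fixes \<omega> :: "'b \<Rightarrow> real \<Rightarrow> real"
  assumes B: "finite B"
    and d: "\<And>b t. b \<in> B \<Longrightarrow> t \<in> {0..1} \<Longrightarrow> (\<omega> b has_real_derivative (\<Sum>c\<in>B. a b c t * \<omega> c t)) (at t)"
    and bd: "\<And>b c t. b \<in> B \<Longrightarrow> c \<in> B \<Longrightarrow> t \<in> {0..1} \<Longrightarrow> \<bar>a b c t\<bar> \<le> K"
    and 0: "\<And>b. b \<in> B \<Longrightarrow> \<omega> b 0 = 0" and b: "b \<in> B"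
  shows "\<omega> b 1 = 0"
proof -
  have K: "K \<ge> 0" using bd[OF b b, of 0] by simp
  define \<phi> where "\<phi> t = (\<Sum>b\<in>B. (\<omega> b t)\<^sup>2)" for t
  define \<phi>' where "\<phi>' t = (\<Sum>b\<in>B. 2 * \<omega> b t * (\<Sum>c\<in>B. a b c t * \<omega> c t))" for t
  have "\<phi> 1 = 0"
  proof (rule gronwall_zero[of _ \<phi>'])
    fix t :: real assume t: "t \<in> {0..1}"
    show "(\<phi> has_real_derivative \<phi>' t) (at t)"
      unfolding \<phi>_def \<phi>'_def
      by (intro DERIV_sum) (use d[OF _ t] in \<open>auto intro!: derivative_eq_intros\<close>)
    have "\<phi>' t \<le> (\<Sum>b\<in>B. \<Sum>c\<in>B. K * ((\<omega> b t)\<^sup>2 + (\<omega> c t)\<^sup>2))"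
      unfolding \<phi>'_def sum_distrib_left
    proof (intro sum_mono)
      fix b c assume bc: "b \<in> B" "c \<in> B"
      have "2 * \<omega> b t * (a b c t * \<omega> c t) = a b c t * (2 * \<omega> b t * \<omega> c t)" by simp
      also have "\<dots> \<le> \<bar>a b c t\<bar> * \<bar>2 * \<omega> b t * \<omega> c t\<bar>"
        using abs_ge_self abs_mult by metis
      also have "\<dots> \<le> K * ((\<omega> b t)\<^sup>2 + (\<omega> c t)\<^sup>2)"
      proof (intro mult_mono bd bc t K)
        have "0 \<le> (\<omega> b t - \<omega> c t)\<^sup>2" "0 \<le> (\<omega> b t + \<omega> c t)\<^sup>2" by simp_all
        then show "\<bar>2 * \<omega> b t * \<omega> c t\<bar> \<le> (\<omega> b t)\<^sup>2 + (\<omega> c t)\<^sup>2"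
          by (simp only: abs_le_iff power2_sum power2_diff) linarith
      qed simp
      finally show "2 * \<omega> b t * (a b c t * \<omega> c t) \<le> K * ((\<omega> b t)\<^sup>2 + (\<omega> c t)\<^sup>2)" .
    qed
    also have "\<dots> = 2 * K * card B * \<phi> t"
      by (simp add: \<phi>_def sum.distrib sum_distrib_left[symmetric] algebra_simps)
    finally show "\<phi>' t \<le> 2 * K * card B * \<phi> t" .
  qed (use 0 in \<open>auto simp: \<phi>_def sum_nonneg\<close>)
  then have "(\<omega> b 1)\<^sup>2 = 0"
    using B b unfolding \<phi>_def by (subst (asm) sum_nonneg_eq_0_iff) auto
  then show ?thesis by simp
qed

section \<open>Local parametrizations and local flatness\<close>

lemma Ck_on_Suc_differentiable: "Ck_on (Suc k) U f \<Longrightarrow> x \<in> U \<Longrightarrow> (f has_derivative frechet_derivative f (at x)) (at x)"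
  by (simp add: frechet_derivative_works[symmetric])

text \<open>\<open>F\<close> and \<open>G\<close> are ambient smooth extensions of a parametrization
  and of its inverse, so that Frechet derivatives make sense although
  \<open>ball x0 r \<inter> E\<close> has empty interior for proper \<open>E\<close>. The ball makes
  the parameter domain star-shaped around \<open>x0\<close>, for arguments along segments.\<close>

locale local_parametrization =
  fixes M E :: "'a::euclidean_space set" and F G :: "'a \<Rightarrow> 'a" and x0 :: 'a and r :: real and N :: "'a set"
  assumes E: "subspace E" and x0: "x0 \<in> E" and r: "r > 0"
    and F: "\<And>k. Ck_on k (ball x0 r) F" and N: "open N" and G: "\<And>k. Ck_on k N G"
    and F_mem: "\<And>x. x \<in> ball x0 r \<inter> E \<Longrightarrow> F x \<in> M \<inter> N"
    and G_F: "\<And>x. x \<in> ball x0 r \<inter> E \<Longrightarrow> G (F x) = x"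
    and openin_image: "openin (top_of_set M) (F ` (ball x0 r \<inter> E))"
begin

abbreviation DF where "DF x \<equiv> frechet_derivative F (at x)"
abbreviation DG where "DG y \<equiv> frechet_derivative G (at y)"

lemma F_has_derivative: "x \<in> ball x0 r \<Longrightarrow> (F has_derivative DF x) (at x)"
  using Ck_on_Suc_differentiable[OF F] by blast

lemma G_has_derivative: "y \<in> N \<Longrightarrow> (G has_derivative DG y) (at y)"
  using Ck_on_Suc_differentiable[OF G] by blast

lemma linear_DF: "x \<in> ball x0 r \<Longrightarrow> linear (DF x)"
  using F_has_derivative by (rule has_derivative_linear)

lemma ex_line_in_domain:
  assumes x: "x \<in> ball x0 r \<inter> E" and v: "v \<in> E"
  obtains e :: real where "e > 0" "\<And>t. t \<in> {-e<..<e} \<Longrightarrow> x + t *\<^sub>R v \<in> ball x0 r \<inter> E"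
proof -
  have "open ((\<lambda>t::real. x + t *\<^sub>R v) -` ball x0 r)"
    by (intro open_vimage open_ball continuous_intros)
  moreover have "0 \<in> (\<lambda>t::real. x + t *\<^sub>R v) -` ball x0 r" using x by simp
  ultimately obtain e where "e > 0" "ball 0 e \<subseteq> (\<lambda>t::real. x + t *\<^sub>R v) -` ball x0 r"
    by (rule openE)
  then have "x + t *\<^sub>R v \<in> ball x0 r \<inter> E" if "t \<in> {-e<..<e}" for t
    using that x v E by (auto simp: dist_real_def subset_iff intro: subspace_add subspace_scale)
  with \<open>e > 0\<close> show ?thesis by (rule that)
qed

lemma has_vector_derivative_along_line:
  assumes "(f has_derivative f') (at (x + t *\<^sub>R v))"
  shows "((\<lambda>t. f (x + t *\<^sub>R v)) has_vector_derivative f' v) (at t)"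
proof -
  have "((\<lambda>t. x + t *\<^sub>R v) has_derivative (\<lambda>h. h *\<^sub>R v)) (at t)"
    by (auto intro!: derivative_eq_intros)
  from has_derivative_compose[OF this assms]
  show ?thesis
    using linear_scale[OF has_derivative_linear[OF assms]] by (simp add: has_vector_derivative_def)
qed

lemma DF_mem_tangent_space:
  assumes x: "x \<in> ball x0 r \<inter> E" and v: "v \<in> E"
  shows "DF x v \<in> tangent_space M (F x)"
proof -
  obtain e where e: "e > 0" "\<And>t. t \<in> {-e<..<e} \<Longrightarrow> x + t *\<^sub>R v \<in> ball x0 r \<inter> E"
    using ex_line_in_domain[OF x v] by blast
  have "((\<lambda>t. F (x + t *\<^sub>R v)) has_vector_derivative DF x v) (at 0)"
    by (rule has_vector_derivative_along_line) (use F_has_derivative x in simp)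
  moreover have "Ck_on k {-e<..<e} (\<lambda>t. F (x + t *\<^sub>R v))" for k
    by (rule Ck_on_compose_line[OF _ _ F]) (use e in auto)
  then have "smooth_on {-e<..<e} (\<lambda>t. F (x + t *\<^sub>R v))"
    unfolding smooth_on_def by (intro ballI exI[of _ "{-e<..<e}"]) auto
  ultimately show ?thesis
    unfolding tangent_space_def using e F_mem
    by (intro CollectI exI[of _ "\<lambda>t. F (x + t *\<^sub>R v)"] exI[of _ e]) auto
qed

text \<open>Near \<open>0\<close> a curve in \<open>M\<close> through \<open>F x\<close> stays in
  the relatively open image of \<open>F\<close>, so it is \<open>F\<close> applied to the curve
  \<open>G (\<gamma> t)\<close> in \<open>E\<close>; differentiate this identity at
  \<open>0\<close>.\<close>

lemma tangent_space_mem_DF: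
  assumes x: "x \<in> ball x0 r \<inter> E" and v: "v \<in> tangent_space M (F x)"
  shows "DG (F x) v \<in> E" "v = DF x (DG (F x) v)"
proof -
  obtain \<gamma> e where \<gamma>: "e > 0" "\<gamma> ` {-e<..<e} \<subseteq> M" "\<gamma> 0 = F x" "smooth_on {-e<..<e} \<gamma>"
    "(\<gamma> has_vector_derivative v) (at 0)"
    using v unfolding tangent_space_def by blast
  obtain Q where Q: "open Q" "F ` (ball x0 r \<inter> E) = M \<inter> Q"
    using openin_image by (auto simp: openin_open)
  have "continuous_on {-e<..<e} \<gamma>"
    using smooth_on_differentiable[OF \<gamma>(4)]
    by (intro continuous_at_imp_continuous_on ballI differentiable_imp_continuous_within)
      (simp add: interior_open)
  then have "open ({-e<..<e} \<inter> \<gamma> -` Q)"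
    by (rule continuous_open_preimage) (use Q in auto)
  moreover have "0 \<in> {-e<..<e} \<inter> \<gamma> -` Q"
    using \<gamma>(1,3) Q(2) x by auto
  ultimately obtain d where d: "d > 0" "ball 0 d \<subseteq> {-e<..<e} \<inter> \<gamma> -` Q" by (rule openE)
  have mem: "G (\<gamma> t) \<in> ball x0 r \<inter> E \<and> F (G (\<gamma> t)) = \<gamma> t" if t: "t \<in> {-d<..<d}" for t
  proof -
    have "t \<in> {-e<..<e} \<inter> \<gamma> -` Q" using d(2) t by (auto simp: dist_real_def subset_iff)
    then have "\<gamma> t \<in> F ` (ball x0 r \<inter> E)" using Q(2) \<gamma>(2) by auto
    then show ?thesis using G_F by auto
  qed
  have c: "((\<lambda>t. G (\<gamma> t)) has_vector_derivative DG (F x) v) (at 0)"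
  proof -
    have "(G has_derivative DG (F x)) (at (\<gamma> 0))" using G_has_derivative F_mem[OF x] \<gamma>(3) by simp
    from has_derivative_compose[OF \<gamma>(5)[unfolded has_vector_derivative_def] this]
    show ?thesis
      using linear_scale[OF has_derivative_linear[OF G_has_derivative]] F_mem[OF x]
      by (simp add: has_vector_derivative_def)
  qed
  then show DGE: "DG (F x) v \<in> E"
    by (rule has_vector_derivative_mem_subspace[OF _ E d(1)]) (use mem in blast)
  have "((\<lambda>t. F (G (\<gamma> t))) has_vector_derivative DF x (DG (F x) v)) (at 0)"
  proof -
    have "G (\<gamma> 0) = x" using \<gamma>(3) G_F[OF x] by simp
    then have "(F has_derivative DF x) (at (G (\<gamma> 0)))" using F_has_derivative x by simp
    from has_derivative_compose[OF c[unfolded has_vector_derivative_def] this]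
    show ?thesis
      using linear_scale[OF linear_DF] x by (simp add: has_vector_derivative_def)
  qed
  then have "(\<gamma> has_vector_derivative DF x (DG (F x) v)) (at 0)"
    by (rule has_vector_derivative_transform_within_open[of _ _ _ "{-d<..<d}"])
      (use d(1) mem in auto)
  then show "v = DF x (DG (F x) v)"
    using \<gamma>(5) vector_derivative_unique_at by blast
qed

lemma tangent_space_eq:
  assumes "x \<in> ball x0 r \<inter> E" shows "tangent_space M (F x) = DF x ` E"
  using DF_mem_tangent_space[OF assms] tangent_space_mem_DF[OF assms] by blast

lemma subspace_tangent_space:
  assumes "x \<in> ball x0 r \<inter> E" shows "subspace (tangent_space M (F x))"
  unfolding tangent_space_eq[OF assms] using assms
  by (intro linear_subspace_image linear_DF E) auto

lemma DF_apply_has_derivative: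
  "x \<in> ball x0 r \<Longrightarrow> ((\<lambda>y. DF y e) has_derivative frechet_derivative (\<lambda>y. DF y e) (at x)) (at x)"
  using Ck_on_Suc_differentiable[of 0 "ball x0 r" "\<lambda>y. DF y e" x] F[of "Suc (Suc 0)"] by simp

text \<open>\<open>DF (x + t *\<^sub>R v) e\<close> is a tangent field along the curve
  \<open>F (x + t *\<^sub>R v)\<close>, so total geodesy kills the normal part of its
  derivative.\<close>

lemma second_derivative_mem_tangent_space:
  assumes V: "subspace V" "M \<subseteq> V" and tg: "totally_geodesic V M"
    and x: "x \<in> ball x0 r \<inter> E" and v: "v \<in> E" and e: "e \<in> E"
  shows "frechet_derivative (\<lambda>y. DF y e) (at x) v \<in> tangent_space M (F x)"
proof -
  let ?w = "frechet_derivative (\<lambda>y. DF y e) (at x) v" and ?T = "tangent_space M (F x)"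
  obtain \<epsilon> where \<epsilon>: "\<epsilon> > 0" "\<And>t. t \<in> {-\<epsilon><..<\<epsilon>} \<Longrightarrow> x + t *\<^sub>R v \<in> ball x0 r \<inter> E"
    using ex_line_in_domain[OF x v] by blast
  have smooth: "smooth_on {-\<epsilon><..<\<epsilon>} (\<lambda>t. h (x + t *\<^sub>R v))" if "\<And>k. Ck_on k (ball x0 r) h" for h :: "'a \<Rightarrow> 'a"
  proof -
    have "Ck_on k {-\<epsilon><..<\<epsilon>} (\<lambda>t. h (x + t *\<^sub>R v))" for k
      by (rule Ck_on_compose_line[OF _ _ that]) (use \<epsilon> in auto)
    then show ?thesis unfolding smooth_on_def by (intro ballI exI[of _ "{-\<epsilon><..<\<epsilon>}"]) auto
  qed
  have "Ck_on k (ball x0 r) (\<lambda>y. DF y e)" for k using F[of "Suc k"] by simp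
  note sm = smooth[OF F] smooth[OF this]
  have d: "((\<lambda>t. DF (x + t *\<^sub>R v) e) has_vector_derivative ?w) (at 0)"
    by (rule has_vector_derivative_along_line[of "\<lambda>y. DF y e"]) (use DF_apply_has_derivative x in simp)
  have tan: "\<forall>t\<in>{-\<epsilon><..<\<epsilon>}. F (x + t *\<^sub>R v) \<in> M \<and> DF (x + t *\<^sub>R v) e \<in> tangent_space M (F (x + t *\<^sub>R v))"
    using \<epsilon>(2) F_mem DF_mem_tangent_space[OF _ e] by blast
  have orth: "?w \<bullet> n = 0" if "n \<in> normal_space V M (F x)" for n
  proof -
    have "\<forall>n\<in>normal_space V M (F (x + 0 *\<^sub>R v)). vector_derivative (\<lambda>t. DF (x + t *\<^sub>R v) e) (at 0) \<bullet> n = 0"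
      using tg[unfolded totally_geodesic_def, rule_format, OF \<epsilon>(1) sm(1) sm(2) tan[rule_format]] by blast
    then show ?thesis using that vector_derivative_at[OF d] by simp
  qed
  have TV: "?T \<subseteq> V" by (rule tangent_space_subset_subspace[OF V])
  have wV: "?w \<in> V"
    by (rule has_vector_derivative_mem_subspace[OF d V(1) \<epsilon>(1)])
      (use tan tangent_space_subset_subspace[OF V] in blast)
  have T: "subspace ?T" by (rule subspace_tangent_space[OF x])
  obtain a b where ab: "a \<in> span ?T" "\<And>w. w \<in> span ?T \<Longrightarrow> orthogonal b w" "?w = a + b"
    using orthogonal_subspace_decomp_exists[of ?T ?w] by metis
  have a: "a \<in> ?T" using ab(1) T by (simp add: span_eq_iff[THEN iffD2])
  have "b = ?w - a" using ab(3) by simp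
  then have "b \<in> V" using wV a TV V(1) by (auto intro: subspace_diff)
  then have "b \<in> normal_space V M (F x)"
    using ab(2) span_base by (auto simp: normal_space_def orthogonal_comp_def orthogonal_commute)
  then have "(a + b) \<bullet> b = 0" using orth ab(3) by metis
  moreover have "a \<bullet> b = 0" using ab(1,2) by (simp add: orthogonal_def inner_commute)
  ultimately have "b = 0" by (simp add: inner_add_left)
  then show ?thesis using ab(3) a by simp
qed

text \<open>The tangent spaces are parallel. Along the segment from \<open>x0\<close> to
  \<open>x\<close> the second derivatives of \<open>F\<close> are tangential, hence combinations of
  the \<open>DF c\<close> with \<open>c\<close> in a basis of \<open>E\<close>; so the functions
  \<open>DF b \<bullet> n\<close> solve a homogeneous linear system with initial value zero.\<close>

lemma orthogonal_DF_constant: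
  assumes V: "subspace V" "M \<subseteq> V" "totally_geodesic V M"
    and n: "\<And>e. e \<in> E \<Longrightarrow> DF x0 e \<bullet> n = 0" and x: "x \<in> ball x0 r \<inter> E" and e: "e \<in> E"
  shows "DF x e \<bullet> n = 0"
proof -
  obtain B where B: "B \<subseteq> E" "pairwise orthogonal B" "\<And>b. b \<in> B \<Longrightarrow> norm b = 1" "independent B" "span B = E"
    using orthonormal_basis_subspace[OF E] by metis
  have fin: "finite B" using B(4) by (rule independent_imp_finite)
  define v where "v = x - x0"
  have v: "v \<in> E" using x x0 E by (simp add: v_def subspace_diff)
  have c: "x0 + t *\<^sub>R v \<in> ball x0 r \<inter> E" if t: "t \<in> {0..1}" for t
  proof -
    have "norm (t *\<^sub>R v) \<le> norm v" using t by (simp add: mult_left_le_one_le)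
    also have "norm v < r" using x by (simp add: v_def dist_norm norm_minus_commute)
    finally show ?thesis using x0 v E by (simp add: dist_norm subspace_add subspace_scale)
  qed
  let ?c = "\<lambda>t::real. x0 + t *\<^sub>R v"
  let ?D2 = "\<lambda>b y. frechet_derivative (\<lambda>y. DF y b) (at y) v"
  \<comment> \<open>The Christoffel symbols contracted with \<open>v\<close>; \<open>DG\<close>
    recovers coordinates in \<open>E\<close> from a tangent vector.\<close>
  define a where "a b c t = DG (F (?c t)) (?D2 b (?c t)) \<bullet> c" for b c t
  have cont_a: "continuous_on {0..1} (a b c)" for b c
  proof -
    have cc: "continuous_on {0..1} ?c" by (intro continuous_intros)
    have "continuous_on (ball x0 r) (?D2 b)" using F[of "Suc (Suc 0)"] by simp
    then have D2c: "continuous_on {0..1} (\<lambda>t. ?D2 b (?c t))"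
      by (rule continuous_on_compose2[OF _ cc]) (use c in auto)
    have "continuous_on (ball x0 r) F" using F[of 0] by simp
    then have Fc: "continuous_on {0..1} (\<lambda>t. F (?c t))"
      by (rule continuous_on_compose2[OF _ cc]) (use c in auto)
    have "continuous_on N (\<lambda>y. DG y i)" for i using G[of "Suc 0"] by simp
    then have DGc: "continuous_on {0..1} (\<lambda>t. DG (F (?c t)) i)" for i
      by (rule continuous_on_compose2[OF _ Fc]) (use c F_mem in blast)
    \<comment> \<open>\<open>Ck_on\<close> gives continuity of \<open>DG y i\<close> in
      \<open>y\<close> for fixed \<open>i\<close> only; expansion in \<open>Basis\<close> deals with
      an argument that varies with \<open>t\<close>.\<close>
    have "DG (F (?c t)) u = (\<Sum>i\<in>Basis. (u \<bullet> i) *\<^sub>R DG (F (?c t)) i)" if "t \<in> {0..1}" for t u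
    proof -
      have lin: "linear (DG (F (?c t)))"
        using G_has_derivative F_mem[OF c[OF that]] has_derivative_linear by blast
      have "DG (F (?c t)) (\<Sum>i\<in>Basis. (u \<bullet> i) *\<^sub>R i) = (\<Sum>i\<in>Basis. (u \<bullet> i) *\<^sub>R DG (F (?c t)) i)"
        by (simp add: linear_sum[OF lin] linear_scale[OF lin])
      then show ?thesis by (simp only: euclidean_representation)
    qed
    then have "a b c t = (\<Sum>i\<in>Basis. (?D2 b (?c t) \<bullet> i) *\<^sub>R DG (F (?c t)) i) \<bullet> c" if "t \<in> {0..1}" for t
      unfolding a_def using that by simp
    then show ?thesis
      by (subst continuous_on_cong[OF refl]) (assumption, intro continuous_intros D2c DGc)
  qed
  have "bounded (\<Union>b\<in>B. \<Union>c\<in>B. a b c ` {0..1})"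
    by (intro bounded_UN fin ballI compact_imp_bounded compact_continuous_image cont_a compact_Icc)
  then obtain K where K: "\<And>y. y \<in> (\<Union>b\<in>B. \<Union>c\<in>B. a b c ` {0..1}) \<Longrightarrow> norm y \<le> K"
    unfolding bounded_iff by blast
  have zero: "DF (?c 1) b \<bullet> n = 0" if "b \<in> B" for b
  proof (rule linear_system_zero[OF fin, of "\<lambda>b t. DF (?c t) b \<bullet> n" a K])
    fix b t assume b: "b \<in> B" and t: "t \<in> {0..1::real}"
    have bE: "b \<in> E" using b B(1) by blast
    let ?w = "DG (F (?c t)) (?D2 b (?c t))"
    have D2: "?D2 b (?c t) \<in> tangent_space M (F (?c t))"
      by (rule second_derivative_mem_tangent_space[OF V c[OF t] v bE])
    note w = tangent_space_mem_DF[OF c[OF t] D2]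
    have lin: "linear (DF (?c t))" using linear_DF c[OF t] by blast
    have "(\<Sum>c\<in>B. (?w \<bullet> c) *\<^sub>R c) = ?w"
      by (rule orthonormal_basis_expand[OF B(2,3) _ fin]) (use w(1) B(5) in auto)
    then have "?D2 b (?c t) = DF (?c t) (\<Sum>c\<in>B. (?w \<bullet> c) *\<^sub>R c)" using w(2) by simp
    also have "\<dots> = (\<Sum>c\<in>B. a b c t *\<^sub>R DF (?c t) c)"
      by (simp add: linear_sum[OF lin] linear_scale[OF lin] a_def)
    finally have eq: "?D2 b (?c t) \<bullet> n = (\<Sum>c\<in>B. a b c t * (DF (?c t) c \<bullet> n))"
      by (simp add: inner_sum_left)
    have "((\<lambda>t. DF (?c t) b) has_vector_derivative ?D2 b (?c t)) (at t)"
      by (rule has_vector_derivative_along_line[OF DF_apply_has_derivative[OF IntD1[OF c[OF t]]]])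
    from bounded_linear.has_vector_derivative[OF bounded_linear_inner_left[of n] this]
    show "((\<lambda>t. DF (?c t) b \<bullet> n) has_real_derivative (\<Sum>c\<in>B. a b c t * (DF (?c t) c \<bullet> n))) (at t)"
      by (simp add: eq has_real_derivative_iff_has_vector_derivative)
  next
    fix b c t assume "b \<in> B" "c \<in> B" "t \<in> {0..1::real}"
    then have "a b c t \<in> (\<Union>b\<in>B. \<Union>c\<in>B. a b c ` {0..1})" by blast
    then show "\<bar>a b c t\<bar> \<le> K" using K by fastforce
  next
    show "DF (?c 0) b \<bullet> n = 0" if "b \<in> B" for b using n B(1) that by auto
  qed (rule that)
  have lin: "linear (\<lambda>e. DF x e \<bullet> n)"
    by (rule linear_compose[OF linear_DF bounded_linear.linear[OF bounded_linear_inner_left], unfolded comp_def])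
      (use x in simp)
  have "e \<in> span B" using e B(5) by simp
  then show ?thesis
    by (rule linear_eq_0_on_span[OF lin, rotated]) (use zero in \<open>simp add: v_def\<close>)
qed

text \<open>The component of \<open>F\<close> in a direction \<open>b\<close> normal to
  \<open>M\<close> at \<open>F x0\<close> is constant along segments from \<open>x0\<close>, since
  \<open>b\<close> stays orthogonal to the image of \<open>DF\<close>.\<close>

lemma image_mem_tangent_space:
  assumes V: "subspace V" "M \<subseteq> V" "totally_geodesic V M" and x: "x \<in> ball x0 r \<inter> E"
  shows "F x - F x0 \<in> tangent_space M (F x0)"
proof -
  let ?T = "tangent_space M (F x0)"
  have x0B: "x0 \<in> ball x0 r \<inter> E" using x0 r by simp
  obtain a b where ab: "a \<in> span ?T" "\<And>w. w \<in> span ?T \<Longrightarrow> orthogonal b w" "F x - F x0 = a + b"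
    using orthogonal_subspace_decomp_exists[of ?T "F x - F x0"] by metis
  have b: "DF x0 e \<bullet> b = 0" if "e \<in> E" for e
    using ab(2)[OF span_base[OF DF_mem_tangent_space[OF x0B that]]]
    by (simp add: orthogonal_def inner_commute)
  define v where "v = x - x0"
  have v: "v \<in> E" using x x0 E by (simp add: v_def subspace_diff)
  have c: "x0 + t *\<^sub>R v \<in> ball x0 r \<inter> E" if t: "0 \<le> t" "t \<le> 1" for t
  proof -
    have "norm (t *\<^sub>R v) \<le> norm v" using t by (simp add: mult_left_le_one_le)
    also have "norm v < r" using x by (simp add: v_def dist_norm norm_minus_commute)
    finally show ?thesis using x0 v E by (simp add: dist_norm subspace_add subspace_scale)
  qed
  have d: "((\<lambda>t. F (x0 + t *\<^sub>R v) \<bullet> b) has_real_derivative 0) (at t)" if t: "0 \<le> t" "t \<le> 1" for t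
  proof -
    have "((\<lambda>t. F (x0 + t *\<^sub>R v)) has_vector_derivative DF (x0 + t *\<^sub>R v) v) (at t)"
      by (rule has_vector_derivative_along_line[OF F_has_derivative[OF IntD1[OF c[OF t]]]])
    from bounded_linear.has_vector_derivative[OF bounded_linear_inner_left[of b] this]
    show ?thesis
      using orthogonal_DF_constant[OF V b c[OF t] v]
      by (simp add: has_real_derivative_iff_has_vector_derivative)
  qed
  have "continuous_on {0..1} (\<lambda>t. F (x0 + t *\<^sub>R v) \<bullet> b)"
    using d by (intro continuous_at_imp_continuous_on ballI DERIV_isCont) auto
  then have "F (x0 + 1 *\<^sub>R v) \<bullet> b = F (x0 + 0 *\<^sub>R v) \<bullet> b"
    by (intro DERIV_isconst_end[of 0 1 "\<lambda>t. F (x0 + t *\<^sub>R v) \<bullet> b"]) (use d in auto)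
  then have "(a + b) \<bullet> b = 0" unfolding ab(3)[symmetric] by (simp add: v_def inner_diff_left)
  moreover have "a \<bullet> b = 0" using ab(1,2) by (simp add: orthogonal_def inner_commute)
  ultimately have "b = 0" by (simp add: inner_add_left)
  then show ?thesis
    using ab subspace_tangent_space[OF x0B] by (simp add: span_eq_iff[THEN iffD2])
qed

text \<open>\<open>F - F x0\<close> maps an open part of \<open>E\<close> continuously and
  injectively into the tangent space \<open>?T\<close>, and \<open>dim ?T \<le> dim E\<close>; by
  invariance of domain the image is open in \<open>?T\<close>. It is also open in the translate of
  \<open>M\<close>, so both sets agree near \<open>F x0\<close>.\<close>

lemma locally_flat:
  assumes V: "subspace V" "M \<subseteq> V" "totally_geodesic V M"
  shows "\<exists>\<epsilon>>0. M \<inter> ball (F x0) \<epsilon> = {y. y - F x0 \<in> tangent_space M (F x0)} \<inter> ball (F x0) \<epsilon>"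
proof -
  let ?T = "tangent_space M (F x0)" and ?B = "ball x0 r \<inter> E" and ?f = "\<lambda>x. F x - F x0"
  have x0B: "x0 \<in> ?B" using x0 r by simp
  have f_T: "?f x \<in> ?T" if "x \<in> ?B" for x using image_mem_tangent_space[OF V that] .
  have "openin (top_of_set ?T) (?f ` ?B)"
  proof (rule invariance_of_domain_subspaces[OF _ E subspace_tangent_space[OF x0B]])
    show "openin (top_of_set E) ?B" by (simp add: openin_open_Int Int_commute)
    show "dim ?T \<le> dim E"
      unfolding tangent_space_eq[OF x0B] by (rule dim_image_le) (use linear_DF x0B in blast)
    have "continuous_on (ball x0 r) F" using F[of 0] by simp
    then show "continuous_on ?B ?f" by (intro continuous_intros) (auto intro: continuous_on_subset)
    show "?f \<in> ?B \<rightarrow> ?T" using f_T by blast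
    show "inj_on ?f ?B"
    proof (rule inj_onI)
      fix x y assume xy: "x \<in> ?B" "y \<in> ?B" and "?f x = ?f y"
      then have "G (F x) = G (F y)" by simp
      then show "x = y" by (simp only: G_F[OF xy(1)] G_F[OF xy(2)])
    qed
  qed
  then obtain Q' where Q': "open Q'" "?f ` ?B = ?T \<inter> Q'" by (auto simp: openin_open)
  obtain Q where Q: "open Q" "F ` ?B = M \<inter> Q" using openin_image by (auto simp: openin_open)
  have "F x0 \<in> Q" using Q(2) x0B by blast
  then obtain e1 where e1: "e1 > 0" "ball (F x0) e1 \<subseteq> Q" using Q(1) by (meson openE)
  have "?f x0 \<in> Q'" using Q'(2) x0B by blast
  then have "0 \<in> Q'" by simp
  then obtain e2 where e2: "e2 > 0" "ball 0 e2 \<subseteq> Q'" using Q'(1) by (meson openE)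
  have "M \<inter> ball (F x0) (min e1 e2) = {y. y - F x0 \<in> ?T} \<inter> ball (F x0) (min e1 e2)"
  proof (intro equalityI subsetI)
    fix y assume y: "y \<in> M \<inter> ball (F x0) (min e1 e2)"
    then have "y \<in> F ` ?B" using Q(2) e1(2) by auto
    then show "y \<in> {y. y - F x0 \<in> ?T} \<inter> ball (F x0) (min e1 e2)" using f_T y by auto
  next
    fix y assume y: "y \<in> {y. y - F x0 \<in> ?T} \<inter> ball (F x0) (min e1 e2)"
    then have "y - F x0 \<in> ball 0 e2" by (simp add: dist_norm norm_minus_commute)
    then have "y - F x0 \<in> ?f ` ?B" using Q'(2) e2(2) y by blast
    then have "y \<in> F ` ?B" by auto
    then show "y \<in> M \<inter> ball (F x0) (min e1 e2)" using Q(2) y by auto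
  qed
  then show ?thesis using e1(1) e2(1) by (intro exI[of _ "min e1 e2"]) simp
qed

end

lemma ex_local_parametrization:
  fixes M :: "'a::euclidean_space set"
  assumes "submanifold M" "p \<in> M"
  shows "\<exists>E F G x0 r N. local_parametrization M E F G x0 r N \<and> F x0 = p"
proof -
  obtain E W :: "'a set" and U f g where E: "subspace E" and W: "openin (top_of_set E) W"
    and U: "openin (top_of_set M) U" "p \<in> U" and fg: "diffeomorphism_on W U f g"
    using assms unfolding submanifold_def by blast
  have hom: "homeomorphism W U f g" and sf: "smooth_on W f" and sg: "smooth_on U g"
    using fg by (simp_all add: diffeomorphism_on_def)
  define x0 where "x0 = g p"
  have x0: "x0 \<in> W" "f x0 = p"
    using hom U(2) by (auto simp: homeomorphism_def x0_def)
  obtain Q F where Q: "open Q" "x0 \<in> Q" "\<And>k. Ck_on k Q F" "\<And>x. x \<in> Q \<inter> W \<Longrightarrow> F x = f x"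
    using sf x0(1) unfolding smooth_on_def by metis
  obtain N G where N: "open N" "p \<in> N" "\<And>k. Ck_on k N G" "\<And>y. y \<in> N \<inter> U \<Longrightarrow> G y = g y"
    using sg U(2) unfolding smooth_on_def by metis
  obtain W' where W': "open W'" "W = E \<inter> W'" using W by (auto simp: openin_open)
  have Fx0: "F x0 = p" using Q(2,4) x0 by simp
  have "continuous_on Q F" using Q(3)[of 0] by simp
  then have "open (Q \<inter> F -` N)" using Q(1) N(1) by (rule continuous_open_preimage)
  then have "open (Q \<inter> F -` N \<inter> W')" using W'(1) by blast
  moreover have "x0 \<in> Q \<inter> F -` N \<inter> W'" using Q(2) Fx0 N(2) x0(1) W'(2) by auto
  ultimately obtain r where r: "r > 0" "ball x0 r \<subseteq> Q \<inter> F -` N \<inter> W'" by (rule openE)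
  have BW: "ball x0 r \<inter> E \<subseteq> W" using r(2) W'(2) by auto
  have Ff: "F x = f x" if "x \<in> ball x0 r \<inter> E" for x
    using that r(2) BW Q(4) by blast
  have FU: "F x \<in> U \<inter> N" if "x \<in> ball x0 r \<inter> E" for x
  proof -
    have "f x \<in> U" using that BW hom by (auto simp: homeomorphism_def)
    moreover have "F x \<in> N" using that r(2) by auto
    ultimately show ?thesis using Ff[OF that] by simp
  qed
  have "local_parametrization M E F G x0 r N"
  proof
    show "Ck_on k (ball x0 r) F" for k using Q(3) r(2) by (blast intro: Ck_on_subset)
    show "x0 \<in> E" using x0(1) W'(2) by blast
    show "F x \<in> M \<inter> N" if "x \<in> ball x0 r \<inter> E" for x
      using FU[OF that] openin_imp_subset[OF U(1)] by blast
    show "G (F x) = x" if "x \<in> ball x0 r \<inter> E" for x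
    proof -
      have "G (F x) = g (f x)" using N(4) FU[OF that] Ff[OF that] by auto
      also have "\<dots> = x" using hom that BW by (auto simp: homeomorphism_def)
      finally show ?thesis .
    qed
    have "ball x0 r \<inter> E = W \<inter> ball x0 r" using BW W'(2) by blast
    then have "openin (top_of_set W) (ball x0 r \<inter> E)" by (simp add: openin_open_Int)
    then have "openin (top_of_set U) (f ` (ball x0 r \<inter> E))"
      by (rule homeomorphism_imp_open_map[OF hom])
    moreover have "f ` (ball x0 r \<inter> E) = F ` (ball x0 r \<inter> E)" using Ff by auto
    ultimately show "openin (top_of_set M) (F ` (ball x0 r \<inter> E))" using U(1) openin_trans by metis
  qed (use E r(1) N in auto)
  then show ?thesis using Fx0 by blast
qed

section \<open>From local flatness and completeness to linearity\<close>

lemma ex_small_scale: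
  fixes v :: "'a::real_normed_vector"
  assumes "d > 0" obtains s :: real where "s > 0" "norm (s *\<^sub>R v) < d"
proof
  have "d * norm v < d * (norm v + 1)" using assms by simp
  moreover have "norm v + 1 > 0" by (rule add_nonneg_pos) simp_all
  ultimately show "d / (norm v + 1) > 0" "norm ((d / (norm v + 1)) *\<^sub>R v) < d"
    using assms by (simp_all add: pos_divide_less_eq)
qed

text \<open>By local flatness \<open>M\<close> is open in its tangent space \<open>T\<close> at the origin. Following a ray of \<open>T\<close>,
  completeness prevents it from leaving \<open>M\<close>.\<close>

theorem subspace_if_totally_geodesic:
  fixes M V :: "'a::euclidean_space set"
  assumes V: "subspace V" "M \<subseteq> V" and con: "connected M" and complete: "complete_submanifold M"
    and tg: "totally_geodesic V M" and 0: "0 \<in> M"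
  shows "subspace M"
proof -
  let ?T = "tangent_space M"
  have local: "subspace (?T p) \<and> (\<exists>e>0. M \<inter> ball p e = {y. y - p \<in> ?T p} \<inter> ball p e)" if "p \<in> M" for p
  proof -
    obtain E F G x0 r N where lp: "local_parametrization M E F G x0 r N" and p: "F x0 = p"
      using ex_local_parametrization[OF _ \<open>p \<in> M\<close>] complete unfolding complete_submanifold_def by metis
    interpret local_parametrization M E F G x0 r N by (rule lp)
    show ?thesis
      using locally_flat[OF V tg] subspace_tangent_space[of x0] x0 r unfolding p by simp
  qed
  have sub: "subspace (?T p)" if "p \<in> M" for p using local[OF that] by blast
  \<comment> \<open>For small \<open>s\<close>, membership of \<open>q + s *\<^sub>R v\<close> in
    \<open>M\<close> is decided by the tangent space at \<open>q\<close> and also, because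
    \<open>q - p\<close> lies in it, by the one at \<open>p\<close>.\<close>
  have T_eq: "?T q = ?T p" if p: "p \<in> M" and e: "M \<inter> ball p e = {y. y - p \<in> ?T p} \<inter> ball p e"
    and q: "q \<in> M \<inter> ball p e" for p q e
  proof -
    obtain e' where e': "e' > 0" "M \<inter> ball q e' = {y. y - q \<in> ?T q} \<inter> ball q e'"
      using local q by blast
    have qp: "q - p \<in> ?T p" using e q by blast
    have "v \<in> ?T q \<longleftrightarrow> v \<in> ?T p" for v
    proof -
      have "min e' (e - dist p q) > 0" using e'(1) q by simp
      then obtain s where s: "s > 0" "norm (s *\<^sub>R v) < min e' (e - dist p q)" by (rule ex_small_scale)
      let ?y = "q + s *\<^sub>R v"
      have y1: "?y \<in> ball q e'" using s(2) by (simp add: dist_norm)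
      have "dist p ?y \<le> dist p q + dist q ?y" by (rule dist_triangle)
      then have y2: "?y \<in> ball p e" using s(2) by (simp add: dist_norm)
      have "?y \<in> M \<longleftrightarrow> ?y - q \<in> ?T q" using e'(2) y1 by blast
      then have "?y \<in> M \<longleftrightarrow> s *\<^sub>R v \<in> ?T q" by simp
      moreover have "?y \<in> M \<longleftrightarrow> ?y - p \<in> ?T p" using e y2 by blast
      moreover have "?y - p = (q - p) + s *\<^sub>R v" by simp
      moreover have "(q - p) + s *\<^sub>R v \<in> ?T p \<longleftrightarrow> s *\<^sub>R v \<in> ?T p"
        using subspace_add[OF sub[OF p] qp, of "s *\<^sub>R v"]
          subspace_diff[OF sub[OF p] _ qp, of "(q - p) + s *\<^sub>R v"] by auto
      moreover have "s *\<^sub>R v \<in> S \<longleftrightarrow> v \<in> S" if "subspace S" for S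
        using subspace_scale[OF that, of "s *\<^sub>R v" "1 / s"] subspace_scale[OF that, of v s] s(1) by auto
      ultimately show ?thesis using sub[OF p] sub[of q] q by auto
    qed
    then show ?thesis by blast
  qed
  \<comment> \<open>Having the same tangent space, with \<open>q - p\<close> in it, is an
    equivalence relation on \<open>M\<close> with open classes; connectedness leaves a single
    class.\<close>
  have T0: "?T 0 = ?T p \<and> p - 0 \<in> ?T 0" if "p \<in> M" for p
  proof (rule connected_equivalence_relation[OF con 0 that, of "\<lambda>p q. ?T p = ?T q \<and> q - p \<in> ?T p"])
    fix x y assume "?T x = ?T y \<and> y - x \<in> ?T x" "x \<in> M" "y \<in> M"
    then show "?T y = ?T x \<and> x - y \<in> ?T y" using subspace_neg[OF sub, of x "y - x"] by auto
  next
    fix x y z assume "?T x = ?T y \<and> y - x \<in> ?T x" "?T y = ?T z \<and> z - y \<in> ?T y" "x \<in> M"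
    then show "?T x = ?T z \<and> z - x \<in> ?T x" using subspace_add[OF sub, of x "y - x" "z - y"] by auto
  next
    fix p assume p: "p \<in> M"
    then obtain e where e: "e > 0" "M \<inter> ball p e = {y. y - p \<in> ?T p} \<inter> ball p e" using local by blast
    have "?T p = ?T q \<and> q - p \<in> ?T p" if "q \<in> M \<inter> ball p e" for q
      using T_eq[OF p e(2) that] e(2) that by blast
    moreover have "openin (top_of_set M) (M \<inter> ball p e)" by (simp add: openin_open_Int)
    moreover have "p \<in> M \<inter> ball p e" using p e(1) by simp
    ultimately show "\<exists>U. openin (top_of_set M) U \<and> p \<in> U \<and> (\<forall>q\<in>U. ?T p = ?T q \<and> q - p \<in> ?T p)"
      by blast
  qed
  define T where "T = ?T 0"
  have T: "subspace T" using sub[OF 0] by (simp add: T_def)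
  have MT: "M \<subseteq> T" using T0 by (auto simp: T_def)
  have M_open: "\<exists>e>0. M \<inter> ball p e = T \<inter> ball p e" if p: "p \<in> M" for p
  proof -
    obtain e where e: "e > 0" "M \<inter> ball p e = {y. y - p \<in> T} \<inter> ball p e"
      using local[OF p] T0[OF p] unfolding T_def by metis
    have "y - p \<in> T \<longleftrightarrow> y \<in> T" for y
      using subspace_add[OF T, of "y - p" p] subspace_diff[OF T, of y p] MT p by auto
    then show ?thesis using e by auto
  qed
  have ne: "path_lengths M p q \<noteq> {}" if "p \<in> M" "q \<in> M" for p q
  proof (rule connected_equivalence_relation[OF con that, of "\<lambda>p q. path_lengths M p q \<noteq> {}"])
    show "path_lengths M x y \<noteq> {} \<Longrightarrow> path_lengths M y x \<noteq> {}" for x y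
      by (simp add: path_lengths_commute)
    show "path_lengths M x y \<noteq> {} \<Longrightarrow> path_lengths M y z \<noteq> {} \<Longrightarrow> path_lengths M x z \<noteq> {}" for x y z
      using path_lengths_add by blast
    fix p assume p: "p \<in> M"
    then obtain e where e: "e > 0" "M \<inter> ball p e = T \<inter> ball p e" using M_open by blast
    have "path_lengths M p q \<noteq> {}" if q: "q \<in> M \<inter> ball p e" for q
    proof -
      have "closed_segment p q \<subseteq> T \<inter> ball p e"
        using p q e MT
        by (intro closed_segment_subset convex_Int subspace_imp_convex T convex_ball) auto
      then have "closed_segment p q \<subseteq> M" using e(2) by blast
      then show ?thesis using path_lengths_segment by blast
    qed
    moreover have "openin (top_of_set M) (M \<inter> ball p e)" by (simp add: openin_open_Int)
    ultimately show "\<exists>U. openin (top_of_set M) U \<and> p \<in> U \<and> (\<forall>q\<in>U. path_lengths M p q \<noteq> {})"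
      using p e(1) by (intro exI[of _ "M \<inter> ball p e"]) auto
  qed
  interpret Metric_space M "riemannian_dist M"
    by (rule Metric_space_riemannian_dist[OF ne])
  have "x \<in> M" if x: "x \<in> T" for x
  proof -
    define S where "S = {t \<in> {0..1::real}. \<forall>s\<in>{0..t}. s *\<^sub>R x \<in> M}"
    define \<tau> where "\<tau> = Sup S"
    have S0: "0 \<in> S" using 0 by (simp add: S_def)
    have bdd: "bdd_above S" by (rule bdd_aboveI[of _ 1]) (simp add: S_def)
    have \<tau>: "0 \<le> \<tau>" "\<tau> \<le> 1"
      unfolding \<tau>_def using cSup_upper[OF S0 bdd] S0 by (auto intro!: cSup_least simp: S_def)
    \<comment> \<open>\<open>s = 0\<close> is listed separately because no \<open>s \<ge> 0\<close>
      is below \<open>\<tau>\<close> if \<open>\<tau> = 0\<close>.\<close>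
    have below: "s *\<^sub>R x \<in> M" if "0 \<le> s" "s < \<tau> \<or> s = 0" for s
    proof (cases "s = 0")
      case False
      then have "s < Sup S" "S \<noteq> {}" using that S0 by (auto simp: \<tau>_def)
      then obtain t where "t \<in> S" "s < t" by (rule less_cSupE)
      then show ?thesis using that by (simp add: S_def)
    qed (use 0 in simp)
    \<comment> \<open>Starts at \<open>0\<close> and tends to \<open>\<tau>\<close> from strictly
      below, or is constantly \<open>0\<close> if \<open>\<tau> = 0\<close>.\<close>
    define t where "t n = \<tau> * (1 - inverse (real (Suc n)))" for n
    have t: "0 \<le> t n \<and> (t n < \<tau> \<or> \<tau> = 0)" for n
    proof -
      have "0 < inverse (real (Suc n))" "inverse (real (Suc n)) \<le> 1" by (simp_all add: inverse_le_1_iff)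
      then show ?thesis using \<tau>(1) unfolding t_def by (cases "\<tau> = 0") simp_all
    qed
    have lim: "(\<lambda>n. t n *\<^sub>R x) \<longlonglongrightarrow> \<tau> *\<^sub>R x"
    proof -
      have "(\<lambda>n. (\<tau> * (1 - inverse (real (Suc n)))) *\<^sub>R x) \<longlonglongrightarrow> (\<tau> * (1 - 0)) *\<^sub>R x"
        by (intro tendsto_intros LIMSEQ_inverse_real_of_nat)
      then show ?thesis by (simp add: t_def[abs_def])
    qed
    have tM: "t n *\<^sub>R x \<in> M" for n
      using t[of n] by (intro below) (auto simp: t_def)
    have seg: "closed_segment (t n *\<^sub>R x) (t m *\<^sub>R x) \<subseteq> M" for n m
    proof
      fix y assume "y \<in> closed_segment (t n *\<^sub>R x) (t m *\<^sub>R x)"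
      then obtain u where u: "0 \<le> u" "u \<le> 1" "y = (1 - u) *\<^sub>R t n *\<^sub>R x + u *\<^sub>R t m *\<^sub>R x"
        by (auto simp: in_segment)
      have y: "y = ((1 - u) * t n + u * t m) *\<^sub>R x" using u(3) by (simp add: scaleR_add_left)
      have "(1 - u) * t n + u * t m < \<tau>" if "\<tau> \<noteq> 0"
        using t[of n] t[of m] that u(1,2) by (intro convex_bound_lt) auto
      moreover have "t n = 0" "t m = 0" if "\<tau> = 0" using that by (simp_all add: t_def)
      ultimately show "y \<in> M"
        unfolding y using t[of n] t[of m] u(1,2) by (intro below) (auto simp del: less_iff_diff_less_0)
    qed
    \<comment> \<open>The segments between these points lie in \<open>M\<close>, so their Riemannian
      distance is at most the Euclidean one.\<close>
    have "MCauchy (\<lambda>n. t n *\<^sub>R x)"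
      unfolding MCauchy_def
    proof (intro conjI allI impI)
      show "range (\<lambda>n. t n *\<^sub>R x) \<subseteq> M" using tM by blast
      fix \<epsilon> :: real assume "\<epsilon> > 0"
      moreover have "Cauchy (\<lambda>n. t n *\<^sub>R x)" using lim by (intro convergent_Cauchy convergentI)
      ultimately obtain N where N: "\<And>m n. m \<ge> N \<Longrightarrow> n \<ge> N \<Longrightarrow> dist (t m *\<^sub>R x) (t n *\<^sub>R x) < \<epsilon>"
        unfolding Cauchy_def by blast
      then show "\<exists>N. \<forall>n n'. N \<le> n \<longrightarrow> N \<le> n' \<longrightarrow> riemannian_dist M (t n *\<^sub>R x) (t n' *\<^sub>R x) < \<epsilon>"
        using riemannian_dist_le_dist[OF tM tM seg] by (meson order_le_less_trans)
    qed
    then obtain l where "limitin mtopology (\<lambda>n. t n *\<^sub>R x) l sequentially"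
      using complete unfolding complete_submanifold_def mcomplete_def by blast
    then have l: "l \<in> M" "\<And>\<epsilon>. \<epsilon> > 0 \<Longrightarrow> \<exists>N. \<forall>n\<ge>N. riemannian_dist M (t n *\<^sub>R x) l < \<epsilon>"
      by (simp_all add: limit_metric_sequentially tM)
    have "(\<lambda>n. t n *\<^sub>R x) \<longlonglongrightarrow> l"
      unfolding lim_sequentially
      using l(2) dist_le_riemannian_dist[OF tM l(1) ne[OF tM l(1)]] by (meson order_le_less_trans)
    then have \<tau>M: "\<tau> *\<^sub>R x \<in> M" using LIMSEQ_unique[OF lim] l(1) by simp
    have "\<tau> = 1"
    proof (rule ccontr)
      assume "\<tau> \<noteq> 1"
      then have \<tau>1: "\<tau> < 1" using \<tau>(2) by simp
      obtain e where e: "e > 0" "M \<inter> ball (\<tau> *\<^sub>R x) e = T \<inter> ball (\<tau> *\<^sub>R x) e"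
        using M_open[OF \<tau>M] by blast
      obtain s where s: "s > 0" "norm (s *\<^sub>R x) < e" using ex_small_scale[OF e(1)] by blast
      define \<eta> where "\<eta> = min s (1 - \<tau>)"
      have \<eta>: "0 < \<eta>" "\<tau> + \<eta> \<le> 1" "\<eta> \<le> s" using s(1) \<tau>1 by (auto simp: \<eta>_def)
      have "u *\<^sub>R x \<in> M" if u: "0 \<le> u" "u \<le> \<tau> + \<eta>" for u
      proof (cases "u < \<tau>")
        case True
        then show ?thesis using below u(1) by blast
      next
        case False
        have "dist (\<tau> *\<^sub>R x) (u *\<^sub>R x) = (u - \<tau>) * norm x"
          using False by (simp add: dist_norm flip: scaleR_diff_left)
        also have "\<dots> \<le> s * norm x" using u(2) \<eta>(3) by (intro mult_right_mono) auto
        also have "\<dots> < e" using s by simp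
        finally have "u *\<^sub>R x \<in> T \<inter> ball (\<tau> *\<^sub>R x) e" using x T by (simp add: subspace_scale)
        then show ?thesis using e(2) by blast
      qed
      then have "\<tau> + \<eta> \<in> S" using \<tau>(1) \<eta>(1,2) by (simp add: S_def)
      then have "\<tau> + \<eta> \<le> \<tau>" unfolding \<tau>_def using bdd by (rule cSup_upper)
      then show False using \<eta>(1) by simp
    qed
    then show ?thesis using \<tau>M by simp
  qed
  then have "M = T" using MT by blast
  then show ?thesis using T by simp
qed

section \<open>The Banach algebra of endomorphisms\<close>

text \<open>A copy of the type of bounded linear endomorphisms, made an instance of the class of unital
  Banach algebras, for which the exponential is available.\<close>

typedef (overloaded) 'v endo = "UNIV :: ('v::euclidean_space \<Rightarrow>\<^sub>L 'v) set" by simp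

setup_lifting type_definition_endo

instantiation endo :: (euclidean_space) real_vector
begin
lift_definition zero_endo :: "'a endo" is 0 .
lift_definition plus_endo :: "'a endo \<Rightarrow> 'a endo \<Rightarrow> 'a endo" is "(+)" .
lift_definition minus_endo :: "'a endo \<Rightarrow> 'a endo \<Rightarrow> 'a endo" is "(-)" .
lift_definition uminus_endo :: "'a endo \<Rightarrow> 'a endo" is uminus .
lift_definition scaleR_endo :: "real \<Rightarrow> 'a endo \<Rightarrow> 'a endo" is scaleR .
instance by standard (transfer, simp add: algebra_simps)+
end

instantiation endo :: (euclidean_space) "{real_normed_vector, ring_1, real_algebra_1}"
begin
lift_definition norm_endo :: "'a endo \<Rightarrow> real" is norm .
lift_definition times_endo :: "'a endo \<Rightarrow> 'a endo \<Rightarrow> 'a endo" is "(o\<^sub>L)" .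
lift_definition one_endo :: "'a endo" is id_blinfun .
definition dist_endo :: "'a endo \<Rightarrow> 'a endo \<Rightarrow> real" where "dist_endo a b = norm (a - b)"
definition uniformity_endo :: "('a endo \<times> 'a endo) filter"
  where "uniformity_endo = (INF e\<in>{0 <..}. principal {(x, y). dist x y < e})"
definition open_endo :: "'a endo set \<Rightarrow> bool"
  where "open_endo S = (\<forall>x\<in>S. \<forall>\<^sub>F (x', y) in uniformity. x' = x \<longrightarrow> y \<in> S)"
definition sgn_endo :: "'a endo \<Rightarrow> 'a endo" where "sgn_endo x = scaleR (inverse (norm x)) x"
instance
proof
  show "(0::'a endo) \<noteq> 1"
  proof (transfer, rule notI)
    assume "(0::'a \<Rightarrow>\<^sub>L 'a) = id_blinfun"
    then have "norm (id_blinfun :: 'a \<Rightarrow>\<^sub>L 'a) = 0" by (metis norm_zero)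
    then show False by (simp add: norm_blinfun_id)
  qed
qed (unfold dist_endo_def uniformity_endo_def open_endo_def sgn_endo_def, rule refl | transfer,
    auto simp: blinfun.bilinear_simps norm_triangle_ineq intro!: blinfun_eqI)+
end

instance endo :: (euclidean_space) real_normed_algebra_1
proof
  show "norm (x * y) \<le> norm x * norm y" for x y :: "'a endo"
    by transfer (rule norm_blinfun_compose)
  show "norm (1::'a endo) = 1"
    by transfer (rule norm_blinfun_id)
qed

lift_definition endo_apply :: "'v::euclidean_space endo \<Rightarrow> 'v \<Rightarrow> 'v" (infixr \<open>\<star>\<close> 75)
  is blinfun_apply .

lift_definition Endo :: "('v::euclidean_space \<Rightarrow> 'v) \<Rightarrow> 'v endo" is Blinfun .

lemma Endo_apply: "linear f \<Longrightarrow> Endo f \<star> x = f x"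
  by transfer (simp add: bounded_linear_Blinfun_apply linear_conv_bounded_linear)

lemma endo_eqI: "(\<And>x. A \<star> x = B \<star> x) \<Longrightarrow> A = B"
  by transfer (rule blinfun_eqI)

lemma bounded_bilinear_endo_apply: "bounded_bilinear (\<star>)"
proof
  show "\<exists>K. \<forall>A (x::'a). norm (A \<star> x) \<le> norm A * norm x * K"
    by (rule exI[of _ 1], transfer) (simp add: norm_blinfun)
qed (transfer, simp add: blinfun.bilinear_simps)+

interpretation endo: bounded_bilinear "(\<star>)"
  by (rule bounded_bilinear_endo_apply)

lemma endo_mult_apply [simp]: "(A * B) \<star> x = A \<star> B \<star> x"
  by transfer simp

lemma endo_one_apply [simp]: "1 \<star> x = x"
  by transfer simp

lemma linear_endo [simp]: "linear ((\<star>) A)"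
  by (rule bounded_linear.linear[OF endo.bounded_linear_right])

lemma norm_endo_bound: "0 \<le> b \<Longrightarrow> (\<And>x. norm (A \<star> x) \<le> b * norm x) \<Longrightarrow> norm A \<le> b"
  by transfer (rule norm_blinfun_bound)

lemma norm_endo_euclidean_le: "norm (A::'v::euclidean_space endo) \<le> (\<Sum>b\<in>Basis. norm (A \<star> b))"
  by transfer (rule norm_blinfun_euclidean_le)

lemma dist_endo_Rep: "dist (Rep_endo a) (Rep_endo b) = dist a b"
  unfolding dist_endo_def by transfer (simp add: dist_norm)

instance endo :: (euclidean_space) heine_borel
proof
  fix f :: "nat \<Rightarrow> 'a endo"
  assume "bounded (range f)"
  then obtain x e where "\<And>n. dist x (f n) \<le> e"
    by (auto simp: bounded_def)
  then have "bounded (range (\<lambda>n. Rep_endo (f n)))"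
    unfolding bounded_def by (metis (no_types, lifting) dist_endo_Rep imageE)
  then obtain l r where r: "strict_mono r" and l: "((\<lambda>n. Rep_endo (f n)) \<circ> r) \<longlonglongrightarrow> l"
    using bounded_imp_convergent_subsequence by blast
  have "(f \<circ> r) \<longlonglongrightarrow> Abs_endo l"
    using l unfolding lim_sequentially comp_def
    by (metis Abs_endo_inverse UNIV_I dist_endo_Rep)
  then show "\<exists>l r. strict_mono r \<and> (f \<circ> r) \<longlonglongrightarrow> l"
    using r by blast
qed

instance endo :: (euclidean_space) banach ..

section \<open>Compact groups of linear isometries and their Lie algebras\<close>

lemma has_vector_derivative_sequentially:
  fixes c :: "real \<Rightarrow> 'a::real_normed_vector"
  assumes c: "(c has_vector_derivative v) (at 0)" and t: "t \<longlonglongrightarrow> 0" "\<And>n. t n \<noteq> 0"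
  shows "(\<lambda>n. (1 / t n) *\<^sub>R (c (t n) - c 0)) \<longlonglongrightarrow> v"
proof -
  have "((\<lambda>h. norm (c h - c 0 - h *\<^sub>R v) / norm h) \<longlongrightarrow> 0) (at 0)"
    using c by (simp add: has_vector_derivative_def has_derivative_at)
  moreover have "filterlim t (at 0) sequentially"
    using t by (simp add: filterlim_at)
  ultimately have "(\<lambda>n. norm (c (t n) - c 0 - t n *\<^sub>R v) / norm (t n)) \<longlonglongrightarrow> 0"
    by (rule filterlim_compose)
  moreover have "norm (c (t n) - c 0 - t n *\<^sub>R v) / norm (t n)
      = norm ((1 / t n) *\<^sub>R (c (t n) - c 0) - v)" for n
  proof -
    have "(1 / t n) *\<^sub>R (c (t n) - c 0) - v = (1 / t n) *\<^sub>R (c (t n) - c 0 - t n *\<^sub>R v)"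
      using t(2)[of n] by (simp add: scaleR_diff_right)
    then show ?thesis by simp
  qed
  ultimately have "(\<lambda>n. norm ((1 / t n) *\<^sub>R (c (t n) - c 0) - v)) \<longlonglongrightarrow> 0"
    by simp
  then show ?thesis
    by (simp only: tendsto_norm_zero_iff LIM_zero_iff)
qed

lemma exp_scaleR_power:
  fixes x :: "'a::{real_normed_algebra_1,banach}"
  shows "exp (t *\<^sub>R x) ^ n = exp ((of_nat n * t) *\<^sub>R x)"
proof (induction n)
  case (Suc n)
  have "exp (t *\<^sub>R x + (of_nat n * t) *\<^sub>R x) = exp (t *\<^sub>R x) * exp ((of_nat n * t) *\<^sub>R x)"
    by (rule exp_add_commuting) simp
  moreover have "t *\<^sub>R x + (of_nat n * t) *\<^sub>R x = (of_nat (Suc n) * t) *\<^sub>R x"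
    by (simp add: algebra_simps)
  ultimately show ?case
    using Suc by simp
qed simp

lemma exp_scaleR_minus:
  fixes x :: "'a::{real_normed_algebra_1,banach}"
  shows "exp (t *\<^sub>R x) * exp ((- t) *\<^sub>R x) = 1"
  using exp_minus_inverse[of "t *\<^sub>R x"] by simp

text \<open>Telescoping. Only \<open>x\<close> is a contraction; for \<open>y\<close> it suffices to
  bound the powers that actually occur.\<close>

lemma norm_power_diff_le:
  fixes x y :: "'a::real_normed_algebra_1"
  assumes "norm x \<le> 1" and "\<And>j. j < n \<Longrightarrow> norm (y ^ j) \<le> K"
  shows "norm (x ^ n - y ^ n) \<le> of_nat n * K * norm (x - y)"
  using assms(2)
proof (induction n)
  case (Suc n)
  have "norm (x ^ Suc n - y ^ Suc n) = norm (x * (x ^ n - y ^ n) + (x - y) * y ^ n)"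
    by (simp add: algebra_simps)
  also have "\<dots> \<le> norm x * norm (x ^ n - y ^ n) + norm (x - y) * norm (y ^ n)"
    by (intro norm_triangle_le add_mono norm_mult_ineq)
  also have "\<dots> \<le> 1 * norm (x ^ n - y ^ n) + norm (x - y) * K"
    using assms(1) Suc.prems by (intro add_mono mult_mono) auto
  also have "\<dots> \<le> of_nat n * K * norm (x - y) + norm (x - y) * K"
    using Suc by auto
  finally show ?case by (simp add: algebra_simps)
qed simp

lemma exp_scaleR_has_vector_derivative_0:
  fixes X :: "'a::{real_normed_algebra_1,banach}"
  shows "((\<lambda>t. exp (t *\<^sub>R X)) has_vector_derivative X) (at 0)"
  using exp_scaleR_has_vector_derivative_right[of X 0 UNIV] by simp

lemma isCont_exp_scaleR:
  fixes X :: "'a::{real_normed_algebra_1,banach}"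
  shows "isCont (\<lambda>t. exp (t *\<^sub>R X)) s"
  using exp_scaleR_has_vector_derivative_right[of X s UNIV]
  by (rule has_vector_derivative_continuous)

text \<open>Abstracts the image of the representation, since orbits, normal spaces and orbit types
  can be read off from it. A compact group of matrices has a Lie algebra by the argument of Cartan's
  closed subgroup theorem.\<close>

locale compact_isometry_group =
  fixes H :: "'v::euclidean_space endo set"
  assumes one_mem: "1 \<in> H"
    and mult_mem: "A \<in> H \<Longrightarrow> B \<in> H \<Longrightarrow> A * B \<in> H"
    and ex_inverse: "A \<in> H \<Longrightarrow> \<exists>B\<in>H. A * B = 1 \<and> B * A = 1"
    and norm_apply: "A \<in> H \<Longrightarrow> norm (A \<star> x) = norm x"
    and compact_H: "compact H"
begin

lemma inner_apply: "A \<in> H \<Longrightarrow> (A \<star> x) \<bullet> (A \<star> y) = x \<bullet> y"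
  using norm_apply[of A "x + y"] norm_apply[of A x] norm_apply[of A y]
  by (simp add: dot_norm endo.add_right)

lemma norm_mem: "A \<in> H \<Longrightarrow> norm A \<le> 1"
  by (rule norm_endo_bound) (simp_all add: norm_apply)

lemma power_mem: "A \<in> H \<Longrightarrow> A ^ n \<in> H"
  by (induction n) (simp_all add: one_mem mult_mem)

lemma closed_H: "closed H"
  using compact_H by (rule compact_imp_closed)

lemma inj_apply: "A \<in> H \<Longrightarrow> inj ((\<star>) A)"
proof (rule injI)
  fix x y assume "A \<in> H" and eq: "A \<star> x = A \<star> y"
  then obtain B where "B * A = 1" using ex_inverse by blast
  then have "B \<star> A \<star> z = z" for z by (simp flip: endo_mult_apply)
  then show "x = y" using eq by metis
qed

definition lie_algebra :: "'v endo set" where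
  "lie_algebra = {X. \<forall>t. exp (t *\<^sub>R X) \<in> H}"

lemma exp_mem: "X \<in> lie_algebra \<Longrightarrow> exp (t *\<^sub>R X) \<in> H"
  by (simp add: lie_algebra_def)

text \<open>\<open>exp (s X)\<close> is the limit of the powers \<open>h n ^ \<lfloor>s / t n\<rfloor>\<close>.\<close>

lemma lie_algebra_limit:
  assumes h: "\<And>n. h n \<in> H" and t: "\<And>n::nat. t n > 0" "t \<longlonglongrightarrow> 0"
    and lim: "(\<lambda>n. (1 / t n) *\<^sub>R (h n - 1)) \<longlonglongrightarrow> X"
  shows "X \<in> lie_algebra"
proof -
  have nonneg: "exp (s *\<^sub>R X) \<in> H" if s: "s \<ge> 0" for s :: real
  proof -
    define m where "m n = nat \<lfloor>s / t n\<rfloor>" for n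
    \<comment> \<open>Bounds the powers \<open>exp (t n *\<^sub>R X) ^ j\<close> with
      \<open>j < m n\<close>, for which \<open>j * t n \<le> s\<close>.\<close>
    define K where "K = exp (s * norm X)"
    have m_eq: "real (m n) = \<lfloor>s / t n\<rfloor>" for n
      using s t(1)[of n] by (simp add: m_def)
    have m_le: "real (m n) * t n \<le> s" for n
    proof -
      have "real (m n) \<le> s / t n" unfolding m_eq by simp
      then show ?thesis using t(1)[of n] by (simp add: field_simps)
    qed
    have m_ge: "s - t n \<le> real (m n) * t n" for n
    proof -
      have "s / t n - 1 \<le> real (m n)" unfolding m_eq by linarith
      then show ?thesis using t(1)[of n] by (simp add: field_simps)
    qed
    have mt: "(\<lambda>n. real (m n) * t n) \<longlonglongrightarrow> s"
    proof (rule tendsto_sandwich)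
      show "(\<lambda>n. s - t n) \<longlonglongrightarrow> s"
        using tendsto_diff[OF tendsto_const t(2), of s] by simp
    qed (auto simp: m_le m_ge)
    then have "(\<lambda>n. exp ((real (m n) * t n) *\<^sub>R X)) \<longlonglongrightarrow> exp (s *\<^sub>R X)"
      by (rule isCont_tendsto_compose[OF isCont_exp_scaleR])
    moreover
    have d: "(\<lambda>n. (1 / t n) *\<^sub>R (exp (t n *\<^sub>R X) - 1)) \<longlonglongrightarrow> X"
      using has_vector_derivative_sequentially[OF exp_scaleR_has_vector_derivative_0 t(2)] t(1)
      by (simp add: less_imp_neq[symmetric])
    have "(\<lambda>n. s * K * norm ((1 / t n) *\<^sub>R (h n - 1) - (1 / t n) *\<^sub>R (exp (t n *\<^sub>R X) - 1)))
        \<longlonglongrightarrow> s * K * norm (X - X)"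
      by (intro tendsto_intros lim d)
    then have bnd0: "(\<lambda>n. s * K * norm ((1 / t n) *\<^sub>R (h n - 1) - (1 / t n) *\<^sub>R (exp (t n *\<^sub>R X) - 1)))
        \<longlonglongrightarrow> 0" by simp
    have "(\<lambda>n. h n ^ m n - exp ((real (m n) * t n) *\<^sub>R X)) \<longlonglongrightarrow> 0"
    proof (rule Lim_null_comparison[OF always_eventually bnd0], rule allI)
      fix n
      have pw: "norm (exp (t n *\<^sub>R X) ^ j) \<le> K" if "j < m n" for j
      proof -
        have "real j * t n \<le> real (m n) * t n"
          using that t(1)[of n] by (intro mult_right_mono) auto
        then have "real j * t n * norm X \<le> s * norm X"
          using m_le[of n] by (intro mult_right_mono) auto
        moreover have "norm ((real j * t n) *\<^sub>R X) = real j * t n * norm X"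
          using t(1)[of n] by (simp add: abs_mult)
        ultimately have "exp (norm ((real j * t n) *\<^sub>R X)) \<le> K"
          unfolding K_def using t(1)[of n] by (simp only: exp_le_cancel_iff)
        then show ?thesis
          unfolding exp_scaleR_power using norm_exp[of "(real j * t n) *\<^sub>R X"] by linarith
      qed
      \<comment> \<open>There are at most \<open>s / t n\<close> factors, each with an error of
        smaller order than \<open>t n\<close>, so the total error tends to \<open>0\<close>.\<close>
      have "norm (h n ^ m n - exp ((real (m n) * t n) *\<^sub>R X))
          \<le> real (m n) * K * norm (h n - exp (t n *\<^sub>R X))"
        unfolding exp_scaleR_power[symmetric]
        by (rule norm_power_diff_le[OF norm_mem[OF h] pw])
      also have "\<dots> \<le> (s / t n) * K * norm (h n - exp (t n *\<^sub>R X))"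
        using m_le[of n] t(1)[of n] unfolding K_def
        by (intro mult_right_mono) (auto simp: field_simps)
      also have "\<dots> = s * K * ((1 / t n) * norm (h n - exp (t n *\<^sub>R X)))"
        by simp
      also have "(1 / t n) * norm (h n - exp (t n *\<^sub>R X))
          = norm ((1 / t n) *\<^sub>R ((h n - 1) - (exp (t n *\<^sub>R X) - 1)))"
        using t(1)[of n] by simp
      finally show "norm (h n ^ m n - exp ((real (m n) * t n) *\<^sub>R X))
          \<le> s * K * norm ((1 / t n) *\<^sub>R (h n - 1) - (1 / t n) *\<^sub>R (exp (t n *\<^sub>R X) - 1))"
        by (simp only: scaleR_diff_right)
    qed
    ultimately have "(\<lambda>n. h n ^ m n - exp ((real (m n) * t n) *\<^sub>R X)
        + exp ((real (m n) * t n) *\<^sub>R X)) \<longlonglongrightarrow> 0 + exp (s *\<^sub>R X)"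
      by (intro tendsto_add)
    then have "(\<lambda>n. h n ^ m n) \<longlonglongrightarrow> exp (s *\<^sub>R X)" by simp
    then show ?thesis
      by (rule closed_sequentially[OF closed_H, rotated]) (simp add: power_mem h)
  qed
  have "exp (s *\<^sub>R X) \<in> H" for s
  proof (cases "s \<ge> 0")
    case False
    then have "exp ((- s) *\<^sub>R X) \<in> H" by (intro nonneg) simp
    then obtain B where B: "B \<in> H" "B * exp ((- s) *\<^sub>R X) = 1" "exp ((- s) *\<^sub>R X) * B = 1"
      using ex_inverse by blast
    have "exp (s *\<^sub>R X) * (exp ((- s) *\<^sub>R X) * B) = B"
      using exp_scaleR_minus[of s X] by (simp add: mult.assoc[symmetric])
    then show ?thesis using B by simp
  qed (rule nonneg)
  then show ?thesis by (simp add: lie_algebra_def)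
qed

lemma lie_algebra_curve:
  assumes c: "\<And>t. c t \<in> H" "c 0 = 1" "(c has_vector_derivative X) (at 0)"
  shows "X \<in> lie_algebra"
proof (rule lie_algebra_limit)
  let ?t = "\<lambda>n. inverse (real (Suc n))"
  have "(\<lambda>n. (1 / ?t n) *\<^sub>R (c (?t n) - c 0)) \<longlonglongrightarrow> X"
    by (rule has_vector_derivative_sequentially[OF c(3) LIMSEQ_inverse_real_of_nat]) simp
  then show "(\<lambda>n. (1 / ?t n) *\<^sub>R (c (?t n) - 1)) \<longlonglongrightarrow> X"
    by (simp only: c(2))
  show "?t \<longlonglongrightarrow> 0" by (rule LIMSEQ_inverse_real_of_nat)
  show "?t n > 0" for n by simp
  show "c (?t n) \<in> H" for n by (rule c(1))
qed

text \<open>For sums: \<open>X + Y\<close> is the velocity at \<open>0\<close> of the curve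
  \<open>exp (t *\<^sub>R X) * exp (t *\<^sub>R Y)\<close> in \<open>H\<close>, which need not be a
  one-parameter group.\<close>

lemma subspace_lie_algebra: "subspace lie_algebra"
  unfolding subspace_def
proof (intro conjI ballI allI)
  show "0 \<in> lie_algebra" by (simp add: lie_algebra_def one_mem)
next
  fix X Y assume X: "X \<in> lie_algebra" and Y: "Y \<in> lie_algebra"
  have "((\<lambda>t. exp (t *\<^sub>R X) * exp (t *\<^sub>R Y)) has_vector_derivative
      exp (0 *\<^sub>R X) * Y + X * exp (0 *\<^sub>R Y)) (at 0)"
    by (rule bounded_bilinear.has_vector_derivative[OF bounded_bilinear_mult])
      (rule exp_scaleR_has_vector_derivative_0)+
  then have "((\<lambda>t. exp (t *\<^sub>R X) * exp (t *\<^sub>R Y)) has_vector_derivative X + Y) (at 0)"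
    by (simp add: add.commute)
  then show "X + Y \<in> lie_algebra"
    by (rule lie_algebra_curve[rotated 2]) (simp_all add: X Y exp_mem mult_mem)
next
  fix c :: real and X assume "X \<in> lie_algebra"
  then show "c *\<^sub>R X \<in> lie_algebra" by (simp add: lie_algebra_def)
qed

lemma lie_algebra_conjugate:
  assumes X: "X \<in> lie_algebra" and A: "A \<in> H" "B \<in> H" "A * B = 1"
  shows "A * X * B \<in> lie_algebra"
proof -
  have "((\<lambda>t. exp (t *\<^sub>R X)) has_vector_derivative X) (at 0)"
    by (rule exp_scaleR_has_vector_derivative_0)
  then have "((\<lambda>t. A * exp (t *\<^sub>R X)) has_vector_derivative A * X) (at 0)"
    by (rule bounded_linear.has_vector_derivative[OF bounded_linear_mult_right])
  then have d: "((\<lambda>t. A * exp (t *\<^sub>R X) * B) has_vector_derivative A * X * B) (at 0)"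
    by (rule bounded_linear.has_vector_derivative[OF bounded_linear_mult_left])
  have "A * exp (t *\<^sub>R X) * B \<in> H" for t
    using exp_mem[OF X] A(1,2) mult_mem by blast
  then show ?thesis
    by (rule lie_algebra_curve[OF _ _ d]) (simp add: A(3))
qed

end

text \<open>The derivative in direction \<open>v\<close> has the same form with
  \<open>X \<star> (v *\<^sub>R x)\<close> in place of \<open>x\<close>; therefore the induction is
  over all \<open>x\<close>.\<close>

lemma Ck_on_exp_scaleR: "Ck_on k U (\<lambda>t. exp (t *\<^sub>R X) \<star> x)"
proof (induction k arbitrary: x)
  case 0
  have "isCont (\<lambda>t. exp (t *\<^sub>R X) \<star> x) s" for s
    by (rule bounded_linear.isCont[OF endo.bounded_linear_left isCont_exp_scaleR])
  then show ?case by (simp add: continuous_at_imp_continuous_on)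
next
  case (Suc k)
  have d: "((\<lambda>t. exp (t *\<^sub>R X) \<star> x) has_derivative (\<lambda>h. h *\<^sub>R (exp (s *\<^sub>R X) \<star> X \<star> x))) (at s)" for s
    using bounded_linear.has_vector_derivative[OF endo.bounded_linear_left[of x]
        exp_scaleR_has_vector_derivative_right[of X s UNIV]]
    by (simp add: has_vector_derivative_def)
  have "frechet_derivative (\<lambda>t. exp (t *\<^sub>R X) \<star> x) (at s) v = exp (s *\<^sub>R X) \<star> X \<star> (v *\<^sub>R x)" for s v
    by (simp add: frechet_derivative_at[OF d, symmetric] endo.scaleR_right)
  moreover have "(\<lambda>t. exp (t *\<^sub>R X) \<star> x) differentiable at s" for s
    using d differentiable_def by blast
  ultimately show ?case
    using Suc.IH by simp
qed

section \<open>Tangent and normal spaces of orbits\<close>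

context compact_isometry_group
begin

definition orb :: "'v \<Rightarrow> 'v set" where "orb p = (\<lambda>A. A \<star> p) ` H"

lemma orbI: "A \<in> H \<Longrightarrow> A \<star> p \<in> orb p"
  by (simp add: orb_def)

lemma exp_fixes_if_lie_algebra_zero:
  assumes "X \<star> p = 0"
  shows "exp (t *\<^sub>R X) \<star> p = p"
proof -
  have "((\<lambda>t. exp (t *\<^sub>R X) \<star> p) has_vector_derivative 0) (at t within UNIV)" for t
    using bounded_linear.has_vector_derivative[OF endo.bounded_linear_left[of p]
        exp_scaleR_has_vector_derivative_right[of X t UNIV]]
    by (simp add: assms endo.zero_right)
  then have "\<exists>c. \<forall>t\<in>UNIV. exp (t *\<^sub>R X) \<star> p = c"
    by (intro has_derivative_zero_constant)
      (simp_all add: has_vector_derivative_def)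
  then have "exp (t *\<^sub>R X) \<star> p = exp (0 *\<^sub>R X) \<star> p" by (metis UNIV_I)
  then show ?thesis by simp
qed

text \<open>Choose \<open>B\<close> closest to \<open>1\<close> among the elements that agree with \<open>A\<close> at \<open>p\<close>. If there were no
  bound, the rescaled differences \<open>B - 1\<close> would converge to a unit vector \<open>X\<close> of the Lie algebra
  with \<open>X p = 0\<close>, and multiplying \<open>B\<close> by \<open>exp (- s X)\<close> would bring it closer to \<open>1\<close>.\<close>

lemma orbit_representative_bound:
  "\<exists>C>0. \<forall>A\<in>H. \<exists>B\<in>H. B \<star> p = A \<star> p \<and> norm (B - 1) \<le> C * norm (A \<star> p - p)"
proof (rule ccontr)
  assume neg: "\<not> ?thesis"
  have "\<exists>A\<in>H. (\<forall>B\<in>H. B \<star> p = A \<star> p \<longrightarrow> norm (A - 1) \<le> norm (B - 1)) \<and>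
      norm (A - 1) > real (Suc n) * norm (A \<star> p - p)" for n
  proof -
    have "\<exists>A\<in>H. \<forall>B\<in>H. B \<star> p = A \<star> p \<longrightarrow> norm (B - 1) > real (Suc n) * norm (A \<star> p - p)"
      using neg by (metis not_le of_nat_0_less_iff zero_less_Suc)
    then obtain A0 where A0: "A0 \<in> H"
      "\<And>B. B \<in> H \<Longrightarrow> B \<star> p = A0 \<star> p \<Longrightarrow> norm (B - 1) > real (Suc n) * norm (A0 \<star> p - p)"
      by blast
    let ?F = "{B \<in> H. B \<star> p = A0 \<star> p}"
    have "?F = H \<inter> (\<lambda>B. B \<star> p) -` {A0 \<star> p}" by auto
    moreover have "closed ((\<lambda>B. B \<star> p) -` {A0 \<star> p})"
      by (intro continuous_closed_vimage linear_continuous_at endo.bounded_linear_left) auto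
    ultimately have "compact ?F" using compact_Int_closed[OF compact_H] by auto
    moreover have "?F \<noteq> {}" using A0(1) by auto
    moreover have "continuous_on ?F (\<lambda>B. norm (B - 1))" by (intro continuous_intros)
    ultimately obtain A where "A \<in> ?F" "\<And>B. B \<in> ?F \<Longrightarrow> norm (A - 1) \<le> norm (B - 1)"
      using continuous_attains_inf[of ?F "\<lambda>B. norm (B - 1)"] by blast
    then show ?thesis
      using A0(2) by (intro bexI[of _ A]) auto
  qed
  then obtain h where h: "\<And>n. h n \<in> H"
      "\<And>n B. B \<in> H \<Longrightarrow> B \<star> p = h n \<star> p \<Longrightarrow> norm (h n - 1) \<le> norm (B - 1)"
      "\<And>n. norm (h n - 1) > real (Suc n) * norm (h n \<star> p - p)"
    by metis
  define s where "s n = norm (h n - 1)" for n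
  have s_pos: "s n > 0" for n
    using h(3)[of n] unfolding s_def by (meson le_less_trans norm_ge_zero mult_nonneg_nonneg of_nat_0_le_iff)
  have hp: "norm ((1 / s n) *\<^sub>R (h n \<star> p - p)) \<le> inverse (real (Suc n))" for n
  proof -
    have "norm ((1 / s n) *\<^sub>R (h n \<star> p - p)) = norm (h n \<star> p - p) / s n"
      using s_pos[of n] by simp
    also have "\<dots> \<le> inverse (real (Suc n))"
      using h(3)[of n] s_pos[of n] unfolding s_def[symmetric] by (simp add: field_simps)
    finally show ?thesis .
  qed
  have hp0: "(\<lambda>n. (1 / s n) *\<^sub>R (h n \<star> p - p)) \<longlonglongrightarrow> 0"
    by (rule Lim_null_comparison[OF always_eventually LIMSEQ_inverse_real_of_nat]) (use hp in blast)
  have s_le: "s n \<le> 2" for n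
    unfolding s_def using norm_triangle_ineq4[of "h n" 1] norm_mem[OF h(1)[of n]] by simp
  obtain g r where g: "g \<in> H" and r: "strict_mono r" and lim: "(h \<circ> r) \<longlonglongrightarrow> g"
    using compact_H h(1) unfolding compact_def by metis
  have lim_p: "(\<lambda>n. h (r n) \<star> p) \<longlonglongrightarrow> g \<star> p"
    using bounded_linear.tendsto[OF endo.bounded_linear_left lim] by (simp add: comp_def)
  have gp: "g \<star> p = p"
  proof -
    have "((\<lambda>n. (1 / s n) *\<^sub>R (h n \<star> p - p)) \<circ> r) \<longlonglongrightarrow> 0"
      by (rule LIMSEQ_subseq_LIMSEQ[OF hp0 r])
    then have "(\<lambda>n. 2 * norm (((\<lambda>n. (1 / s n) *\<^sub>R (h n \<star> p - p)) \<circ> r) n)) \<longlonglongrightarrow> 2 * norm (0::'v)"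
      by (intro tendsto_intros)
    then have z: "(\<lambda>n. 2 * norm (((\<lambda>n. (1 / s n) *\<^sub>R (h n \<star> p - p)) \<circ> r) n)) \<longlonglongrightarrow> 0" by simp
    have "(\<lambda>n. h (r n) \<star> p - p) \<longlonglongrightarrow> 0"
    proof (rule Lim_null_comparison[OF always_eventually z], rule allI)
      fix n
      have "norm (h (r n) \<star> p - p) = s (r n) * norm ((1 / s (r n)) *\<^sub>R (h (r n) \<star> p - p))"
        using s_pos[of "r n"] by simp
      also have "\<dots> \<le> 2 * norm ((1 / s (r n)) *\<^sub>R (h (r n) \<star> p - p))"
        using s_le by (intro mult_right_mono) auto
      finally show "norm (h (r n) \<star> p - p) \<le> 2 * norm (((\<lambda>n. (1 / s n) *\<^sub>R (h n \<star> p - p)) \<circ> r) n)"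
        by simp
    qed
    then have "(\<lambda>n. h (r n) \<star> p) \<longlonglongrightarrow> p" by (rule LIM_zero_cancel)
    then show ?thesis using lim_p LIMSEQ_unique by blast
  qed
  \<comment> \<open>Since \<open>g\<close> fixes \<open>p\<close>, the element
    \<open>h (r n) * g'\<close> agrees with \<open>h (r n)\<close> at \<open>p\<close>. By
    minimality its distance from \<open>1\<close>, which tends to \<open>0\<close>, bounds
    \<open>s (r n)\<close>.\<close>
  obtain g' where g': "g' \<in> H" "g * g' = 1" "g' * g = 1" using ex_inverse[OF g] by blast
  have g'p: "g' \<star> p = p" using g'(3) gp by (metis endo_mult_apply endo_one_apply)
  have "(\<lambda>n. norm ((h \<circ> r) n * g' - 1)) \<longlonglongrightarrow> norm (g * g' - 1)"
    by (intro tendsto_intros lim)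
  then have z: "(\<lambda>n. norm (h (r n) * g' - 1)) \<longlonglongrightarrow> 0" by (simp add: g'(2) comp_def)
  have sr0: "(\<lambda>n. s (r n)) \<longlonglongrightarrow> 0"
  proof (rule Lim_null_comparison[OF always_eventually z], rule allI)
    fix n
    have "h (r n) * g' \<in> H" "(h (r n) * g') \<star> p = h (r n) \<star> p"
      using h(1) g'(1) g'p by (simp_all add: mult_mem)
    then show "norm (s (r n)) \<le> norm (h (r n) * g' - 1)"
      using h(2) s_pos[of "r n"] unfolding s_def by simp
  qed
  define u where "u n = (1 / s (r n)) *\<^sub>R (h (r n) - 1)" for n
  have u1: "norm (u n) = 1" for n
    using s_pos[of "r n"] by (simp add: u_def s_def)
  have "compact (sphere (0::'v endo) 1)"
    by simp
  moreover have "u n \<in> sphere 0 1" for n using u1 by simp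
  ultimately obtain X q where q: "strict_mono q" and X: "X \<in> sphere 0 1" "(u \<circ> q) \<longlonglongrightarrow> X"
    unfolding compact_def by metis
  have srq: "(\<lambda>n. s (r (q n))) \<longlonglongrightarrow> 0"
    using LIMSEQ_subseq_LIMSEQ[OF sr0 q] by (simp add: comp_def)
  have X_lie: "X \<in> lie_algebra"
    by (rule lie_algebra_limit[of "\<lambda>n. h (r (q n))" "\<lambda>n. s (r (q n))"])
      (use h(1) s_pos srq X(2) in \<open>simp_all add: u_def comp_def\<close>)
  have Xp: "X \<star> p = 0"
  proof -
    have "(\<lambda>n. (u \<circ> q) n \<star> p) \<longlonglongrightarrow> X \<star> p"
      by (rule bounded_linear.tendsto[OF endo.bounded_linear_left X(2)])
    moreover have "(u \<circ> q) n \<star> p = ((\<lambda>n. (1 / s n) *\<^sub>R (h n \<star> p - p)) \<circ> (r \<circ> q)) n" for n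
      by (simp add: u_def endo.scaleR_left endo.diff_left)
    moreover have "((\<lambda>n. (1 / s n) *\<^sub>R (h n \<star> p - p)) \<circ> (r \<circ> q)) \<longlonglongrightarrow> 0"
      by (rule LIMSEQ_subseq_LIMSEQ[OF hp0 strict_mono_o[OF r q]])
    ultimately show ?thesis
      by (simp only: LIMSEQ_unique)
  qed
  have fix_p: "exp (t *\<^sub>R X) \<star> p = p" for t
    by (rule exp_fixes_if_lie_algebra_zero[OF Xp])
  let ?s = "\<lambda>n. s (r (q n))" and ?h = "\<lambda>n. h (r (q n))"
  have ge1: "1 \<le> norm ((1 / ?s n) *\<^sub>R (?h n * exp ((- ?s n) *\<^sub>R X) - 1))" for n
  proof -
    have "?h n * exp ((- ?s n) *\<^sub>R X) \<in> H" by (intro mult_mem h exp_mem X_lie)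
    moreover have "(?h n * exp ((- ?s n) *\<^sub>R X)) \<star> p = ?h n \<star> p" by (simp only: endo_mult_apply fix_p)
    ultimately have "?s n \<le> norm (?h n * exp ((- ?s n) *\<^sub>R X) - 1)"
      using h(2) unfolding s_def by blast
    then show ?thesis unfolding norm_scaleR using s_pos[of "r (q n)"] by (simp add: le_divide_eq)
  qed
  have e: "(\<lambda>n. (1 / (- ?s n)) *\<^sub>R (exp ((- ?s n) *\<^sub>R X) - exp (0 *\<^sub>R X))) \<longlonglongrightarrow> X"
    by (rule has_vector_derivative_sequentially[OF exp_scaleR_has_vector_derivative_0])
      (use tendsto_minus[OF srq] s_pos less_imp_neq in \<open>auto simp: less_imp_neq[symmetric]\<close>)
  have e0: "(\<lambda>n. exp ((- ?s n) *\<^sub>R X)) \<longlonglongrightarrow> exp (0 *\<^sub>R X)"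
    by (rule isCont_tendsto_compose[OF isCont_exp_scaleR]) (use tendsto_minus[OF srq] in simp)
  \<comment> \<open>Writing \<open>h * e - 1\<close> as \<open>(h - 1) * e + (e - 1)\<close> with
    \<open>e = exp (- s X)\<close> and dividing by \<open>s\<close>, the two terms tend to
    \<open>X\<close> and \<open>- X\<close>, against the lower bound \<open>1\<close>.\<close>
  have "(\<lambda>n. (u \<circ> q) n * exp ((- ?s n) *\<^sub>R X)
      - (1 / (- ?s n)) *\<^sub>R (exp ((- ?s n) *\<^sub>R X) - exp (0 *\<^sub>R X))) \<longlonglongrightarrow> X * exp (0 *\<^sub>R X) - X"
    by (intro tendsto_diff tendsto_mult X(2) e e0)
  moreover have "(u \<circ> q) n * exp ((- ?s n) *\<^sub>R X)
      - (1 / (- ?s n)) *\<^sub>R (exp ((- ?s n) *\<^sub>R X) - exp (0 *\<^sub>R X))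
      = (1 / ?s n) *\<^sub>R (?h n * exp ((- ?s n) *\<^sub>R X) - 1)" for n
    by (simp add: u_def algebra_simps)
  ultimately have "(\<lambda>n. norm ((1 / ?s n) *\<^sub>R (?h n * exp ((- ?s n) *\<^sub>R X) - 1))) \<longlonglongrightarrow> norm (X * exp (0 *\<^sub>R X) - X)"
    by (intro tendsto_norm) simp
  then have "1 \<le> norm (X * exp (0 *\<^sub>R X) - X)"
    by (rule LIMSEQ_le_const) (use ge1 in blast)
  then show False by simp
qed

text \<open>The hard inclusion starts from a curve in the orbit without a lift to \<open>H\<close>.
  The preceding bound gives lifts \<open>h n\<close> of the points \<open>\<gamma> (t n)\<close> for
  which \<open>(h n - 1) / t n\<close> is bounded; a limit point lies in the Lie algebra and takes
  \<open>p\<close> to the velocity.\<close>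

lemma tangent_space_orb: "tangent_space (orb p) p = (\<lambda>X. X \<star> p) ` lie_algebra"
proof (intro equalityI subsetI)
  fix v assume "v \<in> (\<lambda>X. X \<star> p) ` lie_algebra"
  then obtain X where X: "X \<in> lie_algebra" "v = X \<star> p" by blast
  have "((\<lambda>t. exp (t *\<^sub>R X) \<star> p) has_vector_derivative v) (at 0)"
    using bounded_linear.has_vector_derivative[OF endo.bounded_linear_left[of p]
        exp_scaleR_has_vector_derivative_0[of X]] X(2) by simp
  moreover have "smooth_on {-1<..<1} (\<lambda>t. exp (t *\<^sub>R X) \<star> p)"
    unfolding smooth_on_def using Ck_on_exp_scaleR by (intro ballI exI[of _ UNIV]) blast
  ultimately show "v \<in> tangent_space (orb p) p"
    unfolding tangent_space_def
    by (intro CollectI exI[of _ "\<lambda>t. exp (t *\<^sub>R X) \<star> p"] exI[of _ 1])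
      (auto intro!: orbI exp_mem X)
next
  fix v assume "v \<in> tangent_space (orb p) p"
  then obtain \<gamma> e where \<gamma>: "e > 0" "\<gamma> ` {-e<..<e} \<subseteq> orb p" "\<gamma> 0 = p"
    "(\<gamma> has_vector_derivative v) (at 0)"
    unfolding tangent_space_def by blast
  \<comment> \<open>The second \<open>Suc\<close> keeps \<open>t 0\<close> strictly below
    \<open>e\<close>.\<close>
  define t where "t n = e * inverse (real (Suc (Suc n)))" for n
  have t_pos: "t n > 0" for n using \<gamma>(1) by (simp add: t_def)
  have t_lt: "t n < e" for n
  proof -
    have "inverse (real (Suc (Suc n))) < 1" by (simp add: field_simps)
    then show ?thesis unfolding t_def using \<gamma>(1) mult_strict_left_mono by fastforce
  qed
  have t0: "t \<longlonglongrightarrow> 0"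
    using tendsto_mult[OF tendsto_const[of e] LIMSEQ_Suc[OF LIMSEQ_inverse_real_of_nat]]
    by (simp add: t_def[abs_def])
  obtain C where C: "C > 0" "\<And>A. A \<in> H \<Longrightarrow> \<exists>B\<in>H. B \<star> p = A \<star> p \<and> norm (B - 1) \<le> C * norm (A \<star> p - p)"
    using orbit_representative_bound by blast
  have "\<exists>B\<in>H. B \<star> p = \<gamma> (t n) \<and> norm (B - 1) \<le> C * norm (\<gamma> (t n) - p)" for n
  proof -
    have "- e < t n" using t_pos[of n] \<gamma>(1) by linarith
    then have "\<gamma> (t n) \<in> orb p" using \<gamma>(2) t_lt[of n] by auto
    then show ?thesis using C(2) unfolding orb_def by fastforce
  qed
  then obtain h where h: "\<And>n. h n \<in> H" "\<And>n. h n \<star> p = \<gamma> (t n)" "\<And>n. norm (h n - 1) \<le> C * norm (\<gamma> (t n) - p)"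
    by metis
  have lim: "(\<lambda>n. (1 / t n) *\<^sub>R (\<gamma> (t n) - p)) \<longlonglongrightarrow> v"
    using has_vector_derivative_sequentially[OF \<gamma>(4) t0] t_pos unfolding \<gamma>(3)
    by (metis less_irrefl)
  then have "Bseq (\<lambda>n. (1 / t n) *\<^sub>R (\<gamma> (t n) - p))"
    by (intro convergent_imp_Bseq convergentI)
  then obtain K where K: "\<And>n. norm ((1 / t n) *\<^sub>R (\<gamma> (t n) - p)) \<le> K"
    unfolding Bseq_def by blast
  have "norm ((1 / t n) *\<^sub>R (h n - 1)) \<le> C * K" for n
  proof -
    have "norm ((1 / t n) *\<^sub>R (h n - 1)) \<le> (1 / t n) * (C * norm (\<gamma> (t n) - p))"
      using h(3)[of n] t_pos[of n] by (simp add: divide_right_mono)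
    also have "\<dots> = C * norm ((1 / t n) *\<^sub>R (\<gamma> (t n) - p))"
      using t_pos[of n] by simp
    also have "\<dots> \<le> C * K" using K C(1) by (intro mult_left_mono) auto
    finally show ?thesis .
  qed
  then have "bounded (range (\<lambda>n. (1 / t n) *\<^sub>R (h n - 1)))"
    unfolding bounded_iff by blast
  then obtain X r where r: "strict_mono r" and X: "((\<lambda>n. (1 / t n) *\<^sub>R (h n - 1)) \<circ> r) \<longlonglongrightarrow> X"
    using bounded_imp_convergent_subsequence by blast
  have "X \<in> lie_algebra"
    by (rule lie_algebra_limit[of "\<lambda>n. h (r n)" "\<lambda>n. t (r n)"])
      (use h(1) t_pos X LIMSEQ_subseq_LIMSEQ[OF t0 r] in \<open>simp_all add: comp_def\<close>)
  moreover have "X \<star> p = v"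
  proof -
    have "(\<lambda>n. ((\<lambda>n. (1 / t n) *\<^sub>R (h n - 1)) \<circ> r) n \<star> p) \<longlonglongrightarrow> X \<star> p"
      by (rule bounded_linear.tendsto[OF endo.bounded_linear_left X])
    moreover have "((\<lambda>n. (1 / t n) *\<^sub>R (h n - 1)) \<circ> r) n \<star> p
        = ((\<lambda>n. (1 / t n) *\<^sub>R (\<gamma> (t n) - p)) \<circ> r) n" for n
      by (simp add: endo.scaleR_left endo.diff_left h(2))
    ultimately have "((\<lambda>n. (1 / t n) *\<^sub>R (\<gamma> (t n) - p)) \<circ> r) \<longlonglongrightarrow> X \<star> p"
      by (simp add: comp_def)
    then show ?thesis
      using LIMSEQ_subseq_LIMSEQ[OF lim r] by (rule LIMSEQ_unique)
  qed
  ultimately show "v \<in> (\<lambda>X. X \<star> p) ` lie_algebra" by blast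
qed

abbreviation nrm :: "'v set \<Rightarrow> 'v \<Rightarrow> 'v set" where
  "nrm V p \<equiv> normal_space V (orb p) p"

lemma mem_nrm_iff: "v \<in> nrm V p \<longleftrightarrow> v \<in> V \<and> (\<forall>X\<in>lie_algebra. v \<bullet> (X \<star> p) = 0)"
  by (auto simp: normal_space_def tangent_space_orb orthogonal_comp_def orthogonal_def inner_commute)

end

section \<open>Regular points\<close>

text \<open>Lift a basis of the \<open>g\<close>-image to \<open>L\<close>; by \<open>ker\<close> a
  linear relation among the \<open>f\<close>-images of the lifts descends to that basis. The domain
  is only a real vector space so that \<open>L\<close> can be the Lie algebra.\<close>

lemma dim_image_le_dim_image:
  fixes f :: "'a::real_vector \<Rightarrow> 'b::euclidean_space" and g :: "'a \<Rightarrow> 'c::euclidean_space"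
  assumes "linear f" "linear g" "subspace L" and ker: "\<And>x. x \<in> L \<Longrightarrow> f x = 0 \<Longrightarrow> g x = 0"
  shows "dim (g ` L) \<le> dim (f ` L)"
proof -
  obtain B where B: "B \<subseteq> g ` L" "independent B" "dim (g ` L) = card B"
    using basis_exists[of "g ` L"] by metis
  obtain s where s: "\<And>b. b \<in> B \<Longrightarrow> s b \<in> L" "\<And>b. b \<in> B \<Longrightarrow> g (s b) = b"
    using B(1) by (metis image_iff subsetD)
  have fin: "finite B" using B(2) by (rule independent_imp_finite)
  have "inj_on (\<lambda>b. f (s b)) B \<and> independent ((\<lambda>b. f (s b)) ` B)"
  proof -
    have zero: "\<forall>b\<in>B. c b = 0" if c: "(\<Sum>b\<in>B. c b *\<^sub>R f (s b)) = 0" for c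
    proof -
      let ?x = "\<Sum>b\<in>B. c b *\<^sub>R s b"
      have "f ?x = 0" using c assms(1) by (simp add: linear_sum linear_scale)
      moreover have "?x \<in> L" using s(1) assms(3) by (intro subspace_sum subspace_scale)
      ultimately have "g ?x = 0" using ker by blast
      then have "(\<Sum>b\<in>B. c b *\<^sub>R b) = 0" using assms(2) s(2) by (simp add: linear_sum linear_scale)
      then show ?thesis using independentD[OF B(2) fin subset_refl] by blast
    qed
    have inj: "inj_on (\<lambda>b. f (s b)) B"
    proof (rule inj_onI, rule ccontr)
      fix a b assume ab: "a \<in> B" "b \<in> B" "f (s a) = f (s b)" "a \<noteq> b"
      let ?c = "\<lambda>x. if x = a then 1 else if x = b then -1 else (0::real)"
      have "(\<Sum>x\<in>B. ?c x *\<^sub>R f (s x)) = (\<Sum>x\<in>{a, b}. ?c x *\<^sub>R f (s x))"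
        using fin ab by (intro sum.mono_neutral_right) auto
      also have "\<dots> = 0" using ab by simp
      finally show False using zero[of ?c] ab by auto
    qed
    moreover have "independent ((\<lambda>b. f (s b)) ` B)"
    proof (rule independent_if_scalars_zero)
      fix c x assume c: "(\<Sum>x\<in>(\<lambda>b. f (s b)) ` B. c x *\<^sub>R x) = 0" and x: "x \<in> (\<lambda>b. f (s b)) ` B"
      then show "c x = 0" using zero[of "\<lambda>b. c (f (s b))"] by (auto simp: sum.reindex[OF inj])
    qed (use fin in simp)
    ultimately show ?thesis by blast
  qed
  moreover have "(\<lambda>b. f (s b)) ` B \<subseteq> f ` L" using s(1) by auto
  ultimately have "card B \<le> dim (f ` L)"
    using independent_card_le_dim[of "(\<lambda>b. f (s b)) ` B" "f ` L"] by (simp add: card_image)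
  then show ?thesis using B(3) by simp
qed

text \<open>\<open>S\<close> and the orthogonal complement of \<open>T\<close> have dimensions
  adding up to more than that of the whole space, so they meet nontrivially.\<close>

lemma exists_orthogonal_if_dim_less:
  fixes S T :: "'a::euclidean_space set"
  assumes S: "subspace S" and T: "subspace T" and "dim T < dim S"
  shows "\<exists>w\<in>S. w \<noteq> 0 \<and> (\<forall>y\<in>T. w \<bullet> y = 0)"
proof -
  let ?P = "{y \<in> UNIV. \<forall>x\<in>T. orthogonal x y}"
  have P: "subspace ?P" by (simp add: subspace_orthogonal_to_vectors)
  have "dim ?P + dim T = DIM('a)"
    using dim_subspace_orthogonal_to_vectors[OF T subspace_UNIV] by simp
  moreover have "dim {x + y |x y. x \<in> S \<and> y \<in> ?P} + dim (S \<inter> ?P) = dim S + dim ?P"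
    by (rule dim_sums_Int[OF S P])
  moreover have "dim {x + y |x y. x \<in> S \<and> y \<in> ?P} \<le> DIM('a)" by (rule dim_subset_UNIV)
  ultimately have "dim (S \<inter> ?P) \<noteq> 0" using assms(3) by linarith
  then obtain w where "w \<in> S \<inter> ?P" "w \<noteq> 0" by (auto simp: dim_eq_0)
  then show ?thesis by (auto simp: orthogonal_def inner_commute)
qed

section \<open>Orbit types and fixed spaces of isotropy groups\<close>

context compact_isometry_group
begin

definition invariant :: "'v set \<Rightarrow> bool" where
  "invariant V \<longleftrightarrow> subspace V \<and> (\<forall>A\<in>H. \<forall>x\<in>V. A \<star> x \<in> V)"

text \<open>Maximal orbit type: every orbit contains a point \<open>B \<star> q\<close> whose
  isotropy group contains that of \<open>p\<close>.\<close>

definition regular :: "'v set \<Rightarrow> 'v \<Rightarrow> bool" where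
  "regular V p \<longleftrightarrow> p \<in> V \<and> (\<forall>q\<in>V. \<exists>B\<in>H. \<forall>A\<in>H. A \<star> p = p \<longrightarrow> A \<star> B \<star> q = B \<star> q)"

text \<open>The dimension of this space replaces the comparison of orbit types by a comparison of
  integers.\<close>

definition fixed :: "'v set \<Rightarrow> 'v \<Rightarrow> 'v set" where
  "fixed V p = {v \<in> V. \<forall>A\<in>H. A \<star> p = p \<longrightarrow> A \<star> v = v}"

lemma invariant_subspace: "invariant V \<Longrightarrow> subspace V"
  by (simp add: invariant_def)

lemma invariant_apply: "invariant V \<Longrightarrow> A \<in> H \<Longrightarrow> x \<in> V \<Longrightarrow> A \<star> x \<in> V"
  by (simp add: invariant_def)

lemma regular_mem: "regular V p \<Longrightarrow> p \<in> V"
  by (simp add: regular_def)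

lemma obtain_inverse:
  assumes "A \<in> H"
  obtains B where "B \<in> H" "A * B = 1" "B * A = 1" "\<And>x. A \<star> B \<star> x = x" "\<And>x. B \<star> A \<star> x = x"
proof -
  obtain B where B: "B \<in> H" "A * B = 1" "B * A = 1" using ex_inverse[OF assms] by blast
  have "A \<star> B \<star> x = x" "B \<star> A \<star> x = x" for x
    using B(2,3) by (simp_all flip: endo_mult_apply)
  then show ?thesis using that B by blast
qed

lemma closed_stabilizer: "closed {A. A \<star> r = r}"
proof -
  have "{A. A \<star> r = r} = (\<lambda>A. A \<star> r) -` {r}" by auto
  then show ?thesis
    by (simp add: continuous_closed_vimage linear_continuous_at endo.bounded_linear_left)
qed

text \<open>The closed set \<open>K\<close> is either everything or an isotropy group, so that one
  can also minimize over the orbit of an isotropy subgroup.\<close>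

lemma closest_point_in_orbit:
  assumes "closed K" "1 \<in> K"
  shows "\<exists>B\<in>H \<inter> K. \<forall>A\<in>H \<inter> K. norm (x - B \<star> y) \<le> norm (x - A \<star> y)"
proof (rule continuous_attains_inf)
  show "compact (H \<inter> K)" using compact_H assms(1) by (rule compact_Int_closed)
  show "H \<inter> K \<noteq> {}" using one_mem assms(2) by blast
  show "continuous_on (H \<inter> K) (\<lambda>A. norm (x - A \<star> y))"
    by (intro continuous_intros linear_continuous_on endo.bounded_linear_left)
qed

lemma norm_diff_le_imp_inner_le:
  assumes "A \<in> H" "norm (x - y) \<le> norm (x - A \<star> y)"
  shows "x \<bullet> (A \<star> y) \<le> x \<bullet> y"
proof -
  have "(norm (x - y))\<^sup>2 \<le> (norm (x - A \<star> y))\<^sup>2"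
    using assms(2) by (intro power_mono) auto
  then show ?thesis
    using inner_apply[OF assms(1), of y y]
    by (simp add: power2_norm_eq_inner inner_diff_left inner_diff_right inner_commute)
qed

text \<open>Kleiner's lemma.\<close>

lemma fixes_start_of_minimal_segment:
  assumes A: "A \<in> H" and min: "norm (x - y) \<le> norm (x - A \<star> y)"
    and t: "0 \<le> t" "t < 1" and fx: "A \<star> ((1 - t) *\<^sub>R x + t *\<^sub>R y) = (1 - t) *\<^sub>R x + t *\<^sub>R y"
  shows "A \<star> x = x"
proof -
  have "x \<bullet> (A \<star> y) \<le> x \<bullet> y" using A min by (rule norm_diff_le_imp_inner_le)
  then have "t * (x \<bullet> (A \<star> y)) \<le> t * (x \<bullet> y)" using t(1) by (rule mult_left_mono)
  moreover have "(1 - t) * (x \<bullet> (A \<star> x)) + t * (x \<bullet> (A \<star> y)) = (1 - t) * (x \<bullet> x) + t * (x \<bullet> y)"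
    using arg_cong[OF fx, of "\<lambda>z. x \<bullet> z"]
    by (simp add: endo.add_right endo.scaleR_right inner_add_right)
  ultimately have "(1 - t) * (x \<bullet> x) \<le> (1 - t) * (x \<bullet> (A \<star> x))" by linarith
  then have "x \<bullet> x \<le> x \<bullet> (A \<star> x)" using t(2) by simp
  then have "(A \<star> x - x) \<bullet> (A \<star> x - x) \<le> 0"
    using inner_apply[OF A, of x x] by (simp add: inner_diff_left inner_diff_right inner_commute)
  then show ?thesis by (metis eq_iff_diff_eq_0 inner_eq_zero_iff inner_ge_zero order_antisym)
qed

lemma subspace_fixed: "invariant V \<Longrightarrow> subspace (fixed V p)"
  unfolding subspace_def fixed_def invariant_def
  by (auto simp: endo.zero_right endo.add_right endo.scaleR_right)

text \<open>Conjugation by \<open>B\<close> takes the isotropy group of \<open>p\<close> into that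
  of \<open>q\<close>, so \<open>B\<close> maps the vectors fixed by the latter to vectors fixed by
  the former.\<close>

lemma dim_fixed_le:
  assumes V: "invariant V" and B: "B \<in> H" and stab: "\<And>A. A \<in> H \<Longrightarrow> A \<star> p = p \<Longrightarrow> A \<star> B \<star> q = B \<star> q"
  shows "dim (fixed V q) \<le> dim (fixed V p)"
proof -
  obtain C where C: "C \<in> H" "\<And>x. B \<star> C \<star> x = x" "\<And>x. C \<star> B \<star> x = x"
    using obtain_inverse[OF B] by metis
  have "(\<star>) B ` fixed V q \<subseteq> fixed V p"
  proof clarify
    fix v assume v: "v \<in> fixed V q"
    have "A \<star> B \<star> v = B \<star> v" if A: "A \<in> H" "A \<star> p = p" for A
    proof -
      have "(C * A * B) \<star> q = q" using stab[OF A] C(3) by simp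
      moreover have "C * A * B \<in> H" by (intro mult_mem A B C)
      ultimately have "(C * A * B) \<star> v = v" using v by (simp only: fixed_def mem_Collect_eq)
      then have "B \<star> C \<star> A \<star> B \<star> v = B \<star> v" by simp
      then show ?thesis using C(2) by simp
    qed
    then show "B \<star> v \<in> fixed V p"
      using v V B by (auto simp: fixed_def invariant_def)
  qed
  moreover have "dim ((\<star>) B ` fixed V q) = dim (fixed V q)"
    by (rule dim_image_eq) (use inj_apply[OF B] in \<open>auto intro: inj_on_subset\<close>)
  ultimately show ?thesis using dim_subset by metis
qed

text \<open>With \<open>B \<star> q\<close> closest to \<open>p\<close>, Kleiner's lemma puts the
  isotropy group of the midpoint \<open>z\<close> into that of \<open>p\<close>. By maximality both
  fixed spaces coincide, so the isotropy group of \<open>p\<close> fixes \<open>z\<close> and with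
  it \<open>B \<star> q\<close>, a combination of \<open>p\<close> and \<open>z\<close>.\<close>

lemma regular_if_dim_fixed_max:
  assumes V: "invariant V" and p: "p \<in> V" and max: "\<And>q. q \<in> V \<Longrightarrow> dim (fixed V q) \<le> dim (fixed V p)"
  shows "regular V p"
  unfolding regular_def
proof (intro conjI ballI)
  fix q assume q: "q \<in> V"
  obtain B where B: "B \<in> H" "\<And>A. A \<in> H \<Longrightarrow> norm (p - B \<star> q) \<le> norm (p - A \<star> q)"
    using closest_point_in_orbit[of UNIV p q] by auto
  define z where "z = (1 - 1/2) *\<^sub>R p + (1/2 :: real) *\<^sub>R (B \<star> q)"
  have Bq: "B \<star> q \<in> V" using V B(1) q by (rule invariant_apply)
  have z: "z \<in> V"
    unfolding z_def using invariant_subspace[OF V] p Bq by (intro subspace_add subspace_scale)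
  have stab: "A \<star> p = p" if A: "A \<in> H" "A \<star> z = z" for A
  proof (rule fixes_start_of_minimal_segment[where t = "1/2"])
    show "norm (p - B \<star> q) \<le> norm (p - A \<star> B \<star> q)"
      using B(2)[OF mult_mem[OF A(1) B(1)]] by simp
  qed (use A in \<open>auto simp: z_def\<close>)
  then have sub: "fixed V p \<subseteq> fixed V z" by (auto simp: fixed_def)
  have "fixed V p = fixed V z"
    by (rule subspace_dim_equal) (use sub max[OF z] subspace_fixed[OF V] in auto)
  then have "z \<in> fixed V p" using z by (auto simp: fixed_def)
  then have "A \<star> B \<star> q = B \<star> q" if "A \<in> H" "A \<star> p = p" for A
    using that by (auto simp: fixed_def z_def endo.add_right endo.scaleR_right)
  then show "\<exists>B\<in>H. \<forall>A\<in>H. A \<star> p = p \<longrightarrow> A \<star> B \<star> q = B \<star> q"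
    using B(1) by blast
qed (rule p)

lemma regular_iff_dim_fixed_max:
  assumes V: "invariant V"
  shows "regular V p \<longleftrightarrow> p \<in> V \<and> (\<forall>q\<in>V. dim (fixed V q) \<le> dim (fixed V p))"
  using dim_fixed_le[OF V] regular_if_dim_fixed_max[OF V] unfolding regular_def by metis

lemma regular_exists:
  assumes "invariant V" shows "\<exists>p. regular V p"
proof -
  have "0 \<in> V" using assms by (simp add: invariant_def subspace_0)
  then obtain p where "p \<in> V" "\<And>q. q \<in> V \<Longrightarrow> dim (fixed V q) \<le> dim (fixed V p)"
    using ex_has_greatest_nat[of "\<lambda>x. x \<in> V" 0 "\<lambda>q. dim (fixed V q)" "Suc DIM('v)"]
      dim_subset_UNIV by (metis le_imp_less_Suc)
  then show ?thesis using regular_if_dim_fixed_max[OF assms] by blast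
qed

lemma regular_apply:
  assumes V: "invariant V" and p: "regular V p" and A: "A \<in> H"
  shows "regular V (A \<star> p)"
proof -
  obtain C where C: "C \<in> H" "\<And>x. A \<star> C \<star> x = x" "\<And>x. C \<star> A \<star> x = x"
    using obtain_inverse[OF A] by metis
  show ?thesis
    unfolding regular_def
  proof (intro conjI ballI)
    show "A \<star> p \<in> V" using V A regular_mem[OF p] by (rule invariant_apply)
    fix q assume "q \<in> V"
    then obtain B where B: "B \<in> H" "\<And>D. D \<in> H \<Longrightarrow> D \<star> p = p \<Longrightarrow> D \<star> B \<star> q = B \<star> q"
      using p by (auto simp: regular_def)
    have "D \<star> (A * B) \<star> q = (A * B) \<star> q" if D: "D \<in> H" "D \<star> A \<star> p = A \<star> p" for D
    proof -
      have "(C * D * A) \<star> B \<star> q = B \<star> q"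
        by (rule B(2)) (use D C A in \<open>auto intro: mult_mem\<close>)
      then have "A \<star> C \<star> D \<star> A \<star> B \<star> q = A \<star> B \<star> q" by simp
      then show ?thesis using C(2) by simp
    qed
    then show "\<exists>B\<in>H. \<forall>D\<in>H. D \<star> A \<star> p = A \<star> p \<longrightarrow> D \<star> B \<star> q = B \<star> q"
      using mult_mem[OF A B(1)] by blast
  qed
qed

text \<open>The point of minimal norm in the convex hull of the orbit of \<open>v\<close> under the stabilizer is
  fixed by the stabilizer, hence orthogonal to \<open>v\<close>.\<close>

lemma inner_nonpos_if_orthogonal_fixed:
  assumes V: "invariant V" and v: "v \<in> V" "\<And>w. w \<in> fixed V q \<Longrightarrow> v \<bullet> w = 0"
  shows "\<exists>A\<in>H. A \<star> q = q \<and> (A \<star> v) \<bullet> v \<le> 0"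
proof (rule ccontr)
  assume "\<not> ?thesis"
  then have pos: "A \<in> H \<Longrightarrow> A \<star> q = q \<Longrightarrow> v \<bullet> (A \<star> v) > 0" for A
    by (auto simp: inner_commute not_le)
  define L where "L = H \<inter> {A. A \<star> q = q}"
  define C where "C = convex hull ((\<lambda>A. A \<star> v) ` L)"
  have "compact L" unfolding L_def using compact_H closed_stabilizer by (rule compact_Int_closed)
  then have cpt: "compact C"
    unfolding C_def
    by (intro compact_convex_hull compact_continuous_image linear_continuous_on endo.bounded_linear_left)
  have "1 \<in> L" by (simp add: L_def one_mem)
  then have ne: "C \<noteq> {}" unfolding C_def by auto
  have cvx: "convex C" by (simp add: C_def)
  define c where "c = closest_point C 0"
  have c: "c \<in> C" "\<And>y. y \<in> C \<Longrightarrow> dist 0 c \<le> dist 0 y"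
    using closest_point_exists[of C 0] compact_imp_closed[OF cpt] ne by (auto simp: c_def)
  have CV: "C \<subseteq> V"
    unfolding C_def
  proof (rule hull_minimal)
    show "(\<lambda>A. A \<star> v) ` L \<subseteq> V" using V v(1) by (auto simp: L_def invariant_def)
    show "convex V" using invariant_subspace[OF V] by (rule subspace_imp_convex)
  qed
  have "A \<star> c = c" if A: "A \<in> H" "A \<star> q = q" for A
  proof -
    have "(\<star>) A ` C = convex hull ((\<star>) A ` ((\<lambda>A. A \<star> v) ` L))"
      unfolding C_def by (rule convex_hull_linear_image) simp
    also have "\<dots> \<subseteq> C"
      unfolding C_def
    proof (rule hull_mono, clarify)
      fix B assume "B \<in> L"
      then have "A * B \<in> L" using A by (simp add: L_def mult_mem)
      then show "A \<star> B \<star> v \<in> (\<lambda>A. A \<star> v) ` L" by (intro image_eqI[of _ _ "A * B"]) auto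
    qed
    finally have "A \<star> c \<in> C" using c(1) by blast
    moreover have "\<And>y. y \<in> C \<Longrightarrow> dist 0 (A \<star> c) \<le> dist 0 y"
      using c(2) norm_apply[OF A(1)] by simp
    ultimately show ?thesis
      unfolding c_def using closest_point_unique[OF cvx compact_imp_closed[OF cpt]] by metis
  qed
  then have "c \<in> fixed V q" using c(1) CV by (auto simp: fixed_def)
  then have "v \<bullet> c = 0" by (rule v(2))
  moreover have "C \<subseteq> {y. v \<bullet> y > 0}"
    unfolding C_def by (rule hull_minimal) (use pos in \<open>auto simp: L_def convex_halfspace_gt\<close>)
  ultimately show False using c(1) by auto
qed

text \<open>A nonregular \<open>q\<close> has a smaller fixed space than \<open>p\<close>, hence
  some unit vector fixed by the isotropy group of \<open>p\<close> is turned by a right angle or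
  more by an element fixing \<open>q\<close>. As \<open>q\<close> tends to \<open>p\<close>,
  compactness yields an element fixing \<open>p\<close> that does so with a vector it has to
  fix.\<close>

lemma regular_open:
  assumes V: "invariant V" and p: "regular V p"
  shows "\<exists>d>0. \<forall>q\<in>V. dist q p < d \<longrightarrow> regular V q"
proof (rule ccontr)
  assume "\<not> ?thesis"
  then have "\<forall>n. \<exists>q\<in>V. dist q p < inverse (real (Suc n)) \<and> \<not> regular V q"
    by (metis inverse_positive_iff_positive of_nat_0_less_iff zero_less_Suc)
  then obtain q where q: "\<And>n. q n \<in> V" "\<And>n. dist (q n) p < inverse (real (Suc n))" "\<And>n. \<not> regular V (q n)"
    by metis
  have "(\<lambda>n. dist (q n) p) \<longlonglongrightarrow> 0"
    by (rule Lim_null_comparison[OF always_eventually LIMSEQ_inverse_real_of_nat])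
      (use q(2) less_imp_le in auto)
  then have qp: "q \<longlonglongrightarrow> p" by (rule tendsto_dist_iff[THEN iffD2])
  have "\<exists>v A. v \<in> fixed V p \<and> norm v = 1 \<and> A \<in> H \<and> A \<star> q n = q n \<and> (A \<star> v) \<bullet> v \<le> 0" for n
  proof -
    have "dim (fixed V (q n)) < dim (fixed V p)"
    proof (rule ccontr)
      assume "\<not> ?thesis"
      moreover have "\<forall>r\<in>V. dim (fixed V r) \<le> dim (fixed V p)"
        using p regular_iff_dim_fixed_max[OF V] by blast
      ultimately have "regular V (q n)"
        using regular_if_dim_fixed_max[OF V q(1)[of n]] by (meson not_less order_trans)
      then show False using q(3) by blast
    qed
    then obtain w where w: "w \<noteq> 0" "w \<in> fixed V p" "\<And>y. y \<in> fixed V (q n) \<Longrightarrow> w \<bullet> y = 0"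
      using exists_orthogonal_if_dim_less[OF subspace_fixed[OF V] subspace_fixed[OF V]] by blast
    define u where "u = (1 / norm w) *\<^sub>R w"
    have v: "u \<in> fixed V p" unfolding u_def using subspace_fixed[OF V] w(2) by (rule subspace_scale)
    moreover have "norm u = 1" using w(1) by (simp add: u_def)
    moreover have "u \<bullet> y = 0" if "y \<in> fixed V (q n)" for y
      using w(3)[OF that] by (simp add: u_def)
    moreover have "u \<in> V" using v by (simp add: fixed_def)
    ultimately show ?thesis
      using inner_nonpos_if_orthogonal_fixed[OF V, of u "q n"] by blast
  qed
  then obtain v A where v: "\<And>n. v n \<in> fixed V p" "\<And>n. norm (v n) = 1"
    and A: "\<And>n. A n \<in> H" "\<And>n. A n \<star> q n = q n" "\<And>n. (A n \<star> v n) \<bullet> v n \<le> 0"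
    by metis
  obtain A' r where A': "A' \<in> H" and r: "strict_mono r" and Ar: "(A \<circ> r) \<longlonglongrightarrow> A'"
    using compact_H A(1) unfolding compact_def by metis
  have "bounded (range (\<lambda>n. v (r n)))"
    unfolding bounded_iff using v(2) by (auto intro!: exI[of _ 1])
  then obtain v' s where s: "strict_mono s" and v': "((\<lambda>n. v (r n)) \<circ> s) \<longlonglongrightarrow> v'"
    using bounded_imp_convergent_subsequence by blast
  then have v': "(\<lambda>n. v (r (s n))) \<longlonglongrightarrow> v'" by (simp add: comp_def)
  have As: "(\<lambda>n. A (r (s n))) \<longlonglongrightarrow> A'"
    using LIMSEQ_subseq_LIMSEQ[OF Ar s] by (simp add: comp_def)
  have qs: "(\<lambda>n. q (r (s n))) \<longlonglongrightarrow> p"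
    using LIMSEQ_subseq_LIMSEQ[OF qp strict_mono_o[OF r s]] by (simp add: comp_def)
  have "(\<lambda>n. A (r (s n)) \<star> q (r (s n))) \<longlonglongrightarrow> A' \<star> p"
    by (rule endo.tendsto[OF As qs])
  then have A'p: "A' \<star> p = p" unfolding A(2) using qs by (rule LIMSEQ_unique)
  have "closed (fixed V p)" using subspace_fixed[OF V] by (rule closed_subspace)
  then have "v' \<in> fixed V p" using v(1) v' by (rule closed_sequentially)
  then have "A' \<star> v' = v'" using A' A'p by (simp add: fixed_def)
  moreover have "(\<lambda>n. (A (r (s n)) \<star> v (r (s n))) \<bullet> v (r (s n))) \<longlonglongrightarrow> (A' \<star> v') \<bullet> v'"
    by (intro tendsto_inner endo.tendsto As v')
  then have "(A' \<star> v') \<bullet> v' \<le> 0" by (rule LIMSEQ_le_const2) (use A(3) in blast)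
  moreover have "norm v' = 1"
    using tendsto_norm[OF v'] unfolding v(2) by (simp add: LIMSEQ_const_iff)
  ultimately show False by (simp add: norm_eq_1)
qed

end

section \<open>Linear sections and copolarity\<close>

context compact_isometry_group
begin

text \<open>First derivative test for \<open>(exp (t *\<^sub>R X) \<star> p) \<bullet> w\<close> at
  its maximum \<open>t = 0\<close>.\<close>

lemma lie_algebra_inner_zero_if_max:
  assumes max: "\<And>A. A \<in> H \<Longrightarrow> (A \<star> p) \<bullet> w \<le> p \<bullet> w" and X: "X \<in> lie_algebra"
  shows "w \<bullet> (X \<star> p) = 0"
proof -
  have "((\<lambda>t. exp (t *\<^sub>R X) \<star> p) has_vector_derivative X \<star> p) (at 0)"
    using bounded_linear.has_vector_derivative[OF endo.bounded_linear_left[of p]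
        exp_scaleR_has_vector_derivative_0[of X]] .
  then have "((\<lambda>t. (exp (t *\<^sub>R X) \<star> p) \<bullet> w) has_vector_derivative (X \<star> p) \<bullet> w) (at 0)"
    by (rule bounded_linear.has_vector_derivative[OF bounded_linear_inner_left])
  then have "((\<lambda>t. (exp (t *\<^sub>R X) \<star> p) \<bullet> w) has_real_derivative (X \<star> p) \<bullet> w) (at 0)"
    by (simp add: has_real_derivative_iff_has_vector_derivative)
  then have "(X \<star> p) \<bullet> w = 0"
    by (rule DERIV_local_max[of _ _ _ 1]) (use max exp_mem[OF X] in auto)
  then show ?thesis by (simp add: inner_commute)
qed

lemma lie_algebra_apply_mem:
  assumes V: "invariant V" and X: "X \<in> lie_algebra" and p: "p \<in> V"
  shows "X \<star> p \<in> V"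
proof -
  have d: "((\<lambda>t. exp (t *\<^sub>R X) \<star> p) has_vector_derivative X \<star> p) (at 0)"
    using bounded_linear.has_vector_derivative[OF endo.bounded_linear_left[of p]
        exp_scaleR_has_vector_derivative_0[of X]] .
  let ?t = "\<lambda>n. inverse (real (Suc n))"
  have lim: "(\<lambda>n. (1 / ?t n) *\<^sub>R (exp (?t n *\<^sub>R X) \<star> p - exp (0 *\<^sub>R X) \<star> p)) \<longlonglongrightarrow> X \<star> p"
    by (rule has_vector_derivative_sequentially[OF d LIMSEQ_inverse_real_of_nat]) simp
  have "(1 / ?t n) *\<^sub>R (exp (?t n *\<^sub>R X) \<star> p - exp (0 *\<^sub>R X) \<star> p) \<in> V" for n
    using invariant_apply[OF V exp_mem[OF X] p] invariant_subspace[OF V]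
    by (intro subspace_scale subspace_diff)
  then show ?thesis
    by (rule closed_sequentially[OF closed_subspace[OF invariant_subspace[OF V]] _ lim])
qed

lemma subspace_nrm: "invariant V \<Longrightarrow> subspace (nrm V p)"
  using invariant_subspace[of V]
  by (auto simp: subspace_def mem_nrm_iff inner_add_left simp del: inner_scaleR_left
      intro: trans[OF inner_scaleR_left])

lemma nrm_subset: "nrm V p \<subseteq> V"
  by (auto simp: mem_nrm_iff)

lemma self_mem_nrm:
  assumes "p \<in> V" shows "p \<in> nrm V p"
proof -
  have "(A \<star> p) \<bullet> p \<le> p \<bullet> p" if "A \<in> H" for A
    using norm_cauchy_schwarz[of "A \<star> p" p] norm_apply[OF that, of p]
    by (simp add: norm_eq_sqrt_inner)
  then show ?thesis
    using assms lie_algebra_inner_zero_if_max by (simp add: mem_nrm_iff)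
qed

text \<open>A point of the orbit of \<open>q\<close> closest to \<open>p\<close> is normal to the
  orbit of \<open>p\<close>, because moving \<open>p\<close> by \<open>A\<close> has the effect on
  inner products of moving that point by the inverse of \<open>A\<close>.\<close>

lemma orbit_meets_nrm:
  assumes V: "invariant V" and pq: "p \<in> V" "q \<in> V"
  shows "\<exists>A\<in>H. A \<star> q \<in> nrm V p"
proof -
  obtain B where B: "B \<in> H" "\<And>A. A \<in> H \<Longrightarrow> norm (p - B \<star> q) \<le> norm (p - A \<star> q)"
    using closest_point_in_orbit[of UNIV p q] by auto
  have "(A \<star> p) \<bullet> (B \<star> q) \<le> p \<bullet> (B \<star> q)" if A: "A \<in> H" for A
  proof -
    obtain C where C: "C \<in> H" "\<And>x. A \<star> C \<star> x = x" using obtain_inverse[OF A] by metis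
    have "norm (p - B \<star> q) \<le> norm (p - C \<star> B \<star> q)"
      using B(2)[OF mult_mem[OF C(1) B(1)]] by simp
    then have "p \<bullet> (C \<star> B \<star> q) \<le> p \<bullet> (B \<star> q)" by (rule norm_diff_le_imp_inner_le[OF C(1)])
    then show ?thesis using inner_apply[OF A, of p "C \<star> B \<star> q"] C(2) by simp
  qed
  then have "B \<star> q \<in> nrm V p"
    using lie_algebra_inner_zero_if_max invariant_apply[OF V B(1) pq(2)] by (simp add: mem_nrm_iff)
  then show ?thesis using B(1) by blast
qed

lemma nrm_apply:
  assumes V: "invariant V" and A: "A \<in> H"
  shows "nrm V (A \<star> p) = (\<star>) A ` nrm V p"
proof -
  have sub: "B \<star> v \<in> nrm V (B \<star> q)" if B: "B \<in> H" and v: "v \<in> nrm V q" for B q v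
  proof -
    obtain C where C: "C \<in> H" "C * B = 1" "\<And>x. B \<star> C \<star> x = x" using obtain_inverse[OF B] by metis
    have "(B \<star> v) \<bullet> (X \<star> B \<star> q) = 0" if X: "X \<in> lie_algebra" for X
    proof -
      have "v \<bullet> ((C * X * B) \<star> q) = 0"
        using v lie_algebra_conjugate[OF X C(1) B C(2)] by (simp only: mem_nrm_iff)
      then show ?thesis
        using inner_apply[OF B, of v "C \<star> X \<star> B \<star> q"] C(3) by simp
    qed
    then show ?thesis using v V B by (simp add: mem_nrm_iff invariant_apply)
  qed
  obtain C where C: "C \<in> H" "\<And>x. A \<star> C \<star> x = x" "\<And>x. C \<star> A \<star> x = x" using obtain_inverse[OF A] by metis
  show ?thesis
  proof (intro equalityI subsetI)
    fix v assume "v \<in> nrm V (A \<star> p)"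
    then have "C \<star> v \<in> nrm V p" using sub[OF C(1)] C(3) by metis
    then show "v \<in> (\<star>) A ` nrm V p" using C(2) by (metis image_eqI)
  qed (use sub[OF A] in blast)
qed

lemma dim_nrm:
  assumes V: "invariant V" and p: "p \<in> V"
  shows "dim (nrm V p) + dim ((\<lambda>X. X \<star> p) ` lie_algebra) = dim V"
proof -
  have "subspace ((\<lambda>X. X \<star> p) ` lie_algebra)"
    by (intro linear_subspace_image subspace_lie_algebra bounded_linear.linear endo.bounded_linear_left)
  moreover have "(\<lambda>X. X \<star> p) ` lie_algebra \<subseteq> V" using lie_algebra_apply_mem[OF V _ p] by blast
  moreover have "nrm V p = {y \<in> V. \<forall>x\<in>(\<lambda>X. X \<star> p) ` lie_algebra. orthogonal x y}"
    by (auto simp: mem_nrm_iff orthogonal_def inner_commute)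
  ultimately show ?thesis
    using dim_subspace_orthogonal_to_vectors[of "(\<lambda>X. X \<star> p) ` lie_algebra" V]
      invariant_subspace[OF V] by simp
qed

lemma dim_apply: "A \<in> H \<Longrightarrow> dim ((\<star>) A ` S) = dim S"
  by (rule dim_image_eq) (use inj_apply in \<open>auto intro: inj_on_subset\<close>)

text \<open>Regular orbits have the largest dimension: if \<open>X \<star> p = 0\<close>, then all
  \<open>exp (t *\<^sub>R X)\<close> fix \<open>p\<close>, hence also \<open>B \<star> q\<close>,
  and so \<open>X\<close> kills \<open>B \<star> q\<close>.\<close>

lemma dim_nrm_le:
  assumes V: "invariant V" and p: "regular V p" and q: "q \<in> V"
  shows "dim (nrm V p) \<le> dim (nrm V q)"
proof -
  obtain B where B: "B \<in> H" "\<And>A. A \<in> H \<Longrightarrow> A \<star> p = p \<Longrightarrow> A \<star> B \<star> q = B \<star> q"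
    using p q unfolding regular_def by blast
  have "X \<star> B \<star> q = 0" if X: "X \<in> lie_algebra" "X \<star> p = 0" for X
  proof -
    have "exp (t *\<^sub>R X) \<star> B \<star> q = B \<star> q" for t
      using B(2) exp_mem[OF X(1)] exp_fixes_if_lie_algebra_zero[OF X(2)] by blast
    then have "((\<lambda>t. B \<star> q) has_vector_derivative X \<star> B \<star> q) (at (0::real))"
      using bounded_linear.has_vector_derivative[OF endo.bounded_linear_left[of "B \<star> q"]
          exp_scaleR_has_vector_derivative_0[of X]] by simp
    then show ?thesis
      using vector_derivative_unique_at has_vector_derivative_const by blast
  qed
  then have "dim ((\<lambda>X. X \<star> B \<star> q) ` lie_algebra) \<le> dim ((\<lambda>X. X \<star> p) ` lie_algebra)"
    by (intro dim_image_le_dim_image bounded_linear.linear endo.bounded_linear_left subspace_lie_algebra)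
  moreover have "dim (nrm V (B \<star> q)) = dim (nrm V q)"
    by (simp add: nrm_apply[OF V B(1)] dim_apply[OF B(1)])
  ultimately show ?thesis
    using dim_nrm[OF V regular_mem[OF p]] dim_nrm[OF V invariant_apply[OF V B(1) q]] by linarith
qed

lemma dim_nrm_regular:
  "invariant V \<Longrightarrow> regular V p \<Longrightarrow> regular V q \<Longrightarrow> dim (nrm V p) = dim (nrm V q)"
  by (intro order_antisym dim_nrm_le) (simp_all add: regular_mem)

text \<open>What (C2) to (C4) amount to for a linear subspace, which is connected, complete, totally
  geodesic and its own tangent space. The codimension is kept apart, as it is the same at all
  regular points.\<close>

definition linear_section :: "'v set \<Rightarrow> 'v set \<Rightarrow> bool" where
  "linear_section V S \<longleftrightarrow> subspace S \<and> S \<subseteq> V \<and> (\<forall>q\<in>V. \<exists>A\<in>H. A \<star> q \<in> S) \<and>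
     (\<forall>p\<in>S. regular V p \<longrightarrow> nrm V p \<subseteq> S \<and> (\<forall>A\<in>H. A \<star> p \<in> S \<longrightarrow> (\<star>) A ` S = S))"

definition minimal_section :: "'v set \<Rightarrow> 'v \<Rightarrow> 'v set" where
  "minimal_section V p = \<Inter>{S. linear_section V S \<and> p \<in> S}"

lemma image_invariant: assumes V: "invariant V" and A: "A \<in> H" shows "(\<star>) A ` V = V"
proof -
  obtain C where C: "C \<in> H" "\<And>x. A \<star> C \<star> x = x" using obtain_inverse[OF A] by metis
  have "x \<in> (\<star>) A ` V" if "x \<in> V" for x
    using C invariant_apply[OF V C(1) that] by (metis image_eqI)
  then show ?thesis using invariant_apply[OF V A] by blast
qed

lemma linear_section_self: "invariant V \<Longrightarrow> linear_section V V"
  unfolding linear_section_def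
  using one_mem nrm_subset image_invariant by (auto simp: invariant_subspace invariant_apply)

text \<open>A single regular point of \<open>S\<close> yields (C2), because its normal space lies in
  \<open>S\<close> and meets every orbit.\<close>

lemma linear_section_if_regular:
  assumes V: "invariant V" and S: "subspace S" "S \<subseteq> V" and p: "p \<in> S" "regular V p"
    and nrm: "\<And>q. q \<in> S \<Longrightarrow> regular V q \<Longrightarrow> nrm V q \<subseteq> S"
    and image: "\<And>q A. q \<in> S \<Longrightarrow> regular V q \<Longrightarrow> A \<in> H \<Longrightarrow> A \<star> q \<in> S \<Longrightarrow> (\<star>) A ` S = S"
  shows "linear_section V S"
  unfolding linear_section_def
  using S nrm image orbit_meets_nrm[OF V regular_mem[OF p(2)]] nrm[OF p] by blast

text \<open>If \<open>A\<close> takes a regular point of the intersection into the intersection,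
  then it preserves each section through \<open>p\<close>, and so does its inverse.\<close>

lemma linear_section_minimal_section:
  assumes V: "invariant V" and p: "regular V p"
  shows "linear_section V (minimal_section V p)"
proof (rule linear_section_if_regular[OF V _ _ _ p])
  have mem: "V \<in> {S. linear_section V S \<and> p \<in> S}"
    using linear_section_self[OF V] regular_mem[OF p] by blast
  show "subspace (minimal_section V p)"
    unfolding minimal_section_def by (rule subspace_Inter) (auto simp: linear_section_def)
  show "minimal_section V p \<subseteq> V" "p \<in> minimal_section V p"
    unfolding minimal_section_def using mem by auto
  show "nrm V q \<subseteq> minimal_section V p" if "q \<in> minimal_section V p" "regular V q" for q
    using that unfolding minimal_section_def linear_section_def by blast
  show "(\<star>) A ` minimal_section V p = minimal_section V p"
    if q: "q \<in> minimal_section V p" "regular V q" and A: "A \<in> H" "A \<star> q \<in> minimal_section V p" for q A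
  proof -
    have im: "(\<star>) A ` S = S" if "linear_section V S" "p \<in> S" for S
      using q A that unfolding minimal_section_def linear_section_def by blast
    obtain C where C: "\<And>x. A \<star> C \<star> x = x" "\<And>x. C \<star> A \<star> x = x"
      using obtain_inverse[OF A(1)] by metis
    show ?thesis
    proof (intro equalityI subsetI)
      fix x assume "x \<in> (\<star>) A ` minimal_section V p"
      then show "x \<in> minimal_section V p" using im unfolding minimal_section_def by blast
    next
      fix x assume x: "x \<in> minimal_section V p"
      have "C \<star> x \<in> S" if S: "linear_section V S" "p \<in> S" for S
      proof -
        have "x \<in> (\<star>) A ` S" using x im[OF S] S unfolding minimal_section_def by blast
        then show ?thesis using C(2) by auto
      qed
      then have "C \<star> x \<in> minimal_section V p" by (simp add: minimal_section_def)
      then show "x \<in> (\<star>) A ` minimal_section V p" using C(1) by (metis image_eqI)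
    qed
  qed
qed

lemma mem_minimal_section: "p \<in> minimal_section V p"
  by (simp add: minimal_section_def)

lemma minimal_section_subset: "linear_section V S \<Longrightarrow> p \<in> S \<Longrightarrow> minimal_section V p \<subseteq> S"
  unfolding minimal_section_def by blast

lemma nrm_subset_minimal_section:
  "invariant V \<Longrightarrow> regular V p \<Longrightarrow> nrm V p \<subseteq> minimal_section V p"
  using linear_section_minimal_section mem_minimal_section unfolding linear_section_def by blast

lemma linear_section_image:
  assumes V: "invariant V" and S: "linear_section V S" and A: "A \<in> H"
  shows "linear_section V ((\<star>) A ` S)"
proof -
  obtain C where C: "C \<in> H" "\<And>x. A \<star> C \<star> x = x" "\<And>x. C \<star> A \<star> x = x" using obtain_inverse[OF A] by metis
  obtain p0 where p0: "regular V p0" using regular_exists[OF V] by blast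
  then obtain B where B: "B \<in> H" "B \<star> p0 \<in> S"
    using S regular_mem[OF p0] unfolding linear_section_def by blast
  show ?thesis
  proof (rule linear_section_if_regular[OF V])
    show "subspace ((\<star>) A ` S)"
      using S by (intro linear_subspace_image) (auto simp: linear_section_def)
    show "(\<star>) A ` S \<subseteq> V"
      using S invariant_apply[OF V A] by (auto simp: linear_section_def)
    show "A \<star> B \<star> p0 \<in> (\<star>) A ` S" using B by blast
    show "regular V (A \<star> B \<star> p0)" using V p0 A B(1) by (intro regular_apply)
    show "nrm V q \<subseteq> (\<star>) A ` S" if q: "q \<in> (\<star>) A ` S" "regular V q" for q
    proof -
      have "C \<star> q \<in> S" using q(1) C(3) by auto
      moreover have "regular V (C \<star> q)" using V q(2) C(1) by (rule regular_apply)
      ultimately have "nrm V (C \<star> q) \<subseteq> S" using S by (simp add: linear_section_def)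
      then show ?thesis using nrm_apply[OF V A, of "C \<star> q"] C(2) by auto
    qed
    show "(\<star>) D ` (\<star>) A ` S = (\<star>) A ` S"
      if q: "q \<in> (\<star>) A ` S" "regular V q" and D: "D \<in> H" "D \<star> q \<in> (\<star>) A ` S" for q D
    proof -
      have "C \<star> q \<in> S" using q(1) C(3) by auto
      moreover have "regular V (C \<star> q)" using V q(2) C(1) by (rule regular_apply)
      moreover have "(C * D * A) \<star> C \<star> q \<in> S" using D(2) C by auto
      moreover have "C * D * A \<in> H" using A C(1) D(1) by (intro mult_mem)
      ultimately have "(\<star>) (C * D * A) ` S = S" using S unfolding linear_section_def by blast
      then have "(\<star>) A ` (\<star>) (C * D * A) ` S = (\<star>) A ` S" by simp
      then show ?thesis by (simp add: image_image C(2))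
    qed
  qed
qed

text \<open>The smaller section at \<open>r\<close> contains some \<open>A \<star> p\<close>, so
  \<open>A\<close> preserves the section at \<open>p\<close>. The preimage under \<open>A\<close> of
  the section at \<open>r\<close> is a section through \<open>p\<close> and contains the minimal
  one; apply \<open>A\<close>.\<close>

lemma minimal_section_unique:
  assumes V: "invariant V" and p: "regular V p" and r: "regular V r" "r \<in> minimal_section V p"
  shows "minimal_section V r = minimal_section V p"
proof -
  have sp: "linear_section V (minimal_section V p)" by (rule linear_section_minimal_section[OF V p])
  have sr: "linear_section V (minimal_section V r)" by (rule linear_section_minimal_section[OF V r(1)])
  have sub: "minimal_section V r \<subseteq> minimal_section V p"
    using sp r(2) by (rule minimal_section_subset)
  obtain A where A: "A \<in> H" "A \<star> p \<in> minimal_section V r"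
    using sr regular_mem[OF p] unfolding linear_section_def by blast
  have im: "(\<star>) A ` minimal_section V p = minimal_section V p"
    using sp p mem_minimal_section A sub unfolding linear_section_def by blast
  obtain C where C: "C \<in> H" "\<And>x. A \<star> C \<star> x = x" "\<And>x. C \<star> A \<star> x = x" using obtain_inverse[OF A(1)] by metis
  have "p \<in> (\<star>) C ` minimal_section V r" using A(2) C(3) by (metis image_eqI)
  then have "minimal_section V p \<subseteq> (\<star>) C ` minimal_section V r"
    by (intro minimal_section_subset linear_section_image[OF V sr C(1)])
  then have "(\<star>) A ` minimal_section V p \<subseteq> (\<star>) A ` (\<star>) C ` minimal_section V r"
    by (rule image_mono)
  then show ?thesis using sub im by (simp add: image_image C(2))
qed

lemma minimal_section_apply:
  assumes V: "invariant V" and p: "regular V p" and A: "A \<in> H"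
  shows "minimal_section V (A \<star> p) = (\<star>) A ` minimal_section V p"
proof -
  have sub: "minimal_section V (B \<star> q) \<subseteq> (\<star>) B ` minimal_section V q"
    if "B \<in> H" "regular V q" for B q
    using linear_section_image[OF V linear_section_minimal_section[OF V that(2)] that(1)]
      mem_minimal_section by (intro minimal_section_subset) blast+
  obtain C where C: "C \<in> H" "\<And>x. A \<star> C \<star> x = x" "\<And>x. C \<star> A \<star> x = x" using obtain_inverse[OF A] by metis
  have "minimal_section V (C \<star> A \<star> p) \<subseteq> (\<star>) C ` minimal_section V (A \<star> p)"
    by (rule sub[OF C(1) regular_apply[OF V p A]])
  then have "(\<star>) A ` minimal_section V p \<subseteq> (\<star>) A ` (\<star>) C ` minimal_section V (A \<star> p)"
    unfolding C(3) by (rule image_mono)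
  then show ?thesis using sub[OF A p] by (simp add: image_image C(2))
qed

lemma dim_minimal_section:
  assumes V: "invariant V" and p: "regular V p" and q: "regular V q"
  shows "dim (minimal_section V p) = dim (minimal_section V q)"
proof -
  obtain A where A: "A \<in> H" "A \<star> q \<in> minimal_section V p"
    using linear_section_minimal_section[OF V p] regular_mem[OF q] unfolding linear_section_def by blast
  have "minimal_section V (A \<star> q) = minimal_section V p"
    by (rule minimal_section_unique[OF V p regular_apply[OF V q A(1)] A(2)])
  then show ?thesis using minimal_section_apply[OF V q A(1)] dim_apply[OF A(1)] by metis
qed

lemma regular_if_stabilizer_subset:
  assumes "regular V r" "p \<in> V" "\<And>A. A \<in> H \<Longrightarrow> A \<star> p = p \<Longrightarrow> A \<star> r = r"
  shows "regular V p"
  using assms unfolding regular_def by meson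

end

section \<open>Invariant orthogonal decompositions\<close>

locale invariant_decomposition = compact_isometry_group H
  for H :: "'v::euclidean_space endo set" +
  fixes V V1 V2 :: "'v set"
  assumes V: "invariant V" and V1: "invariant V1" and V2: "invariant V2"
    and V_eq: "V = {x + y | x y. x \<in> V1 \<and> y \<in> V2}"
    and orth: "x \<in> V1 \<Longrightarrow> y \<in> V2 \<Longrightarrow> orthogonal x y"
begin

lemma sum_mem: "x \<in> V1 \<Longrightarrow> y \<in> V2 \<Longrightarrow> x + y \<in> V"
  using V_eq by blast

lemma fixes_sum:
  assumes A: "A \<in> H" and xy: "x \<in> V1" "y \<in> V2" and fx: "A \<star> (x + y) = x + y"
  shows "A \<star> x = x" "A \<star> y = y"
proof -
  let ?a = "A \<star> x - x" and ?b = "A \<star> y - y"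
  have "?a \<in> V1" "?b \<in> V2"
    using V1 V2 A xy by (simp_all add: invariant_apply invariant_subspace subspace_diff)
  then have "?a \<bullet> ?b = 0" using orth by (simp add: orthogonal_def)
  moreover have b: "?b = - ?a" using fx by (simp add: endo.add_right algebra_simps)
  ultimately have "?a \<bullet> ?a = 0" by (simp only: b inner_minus_right)
  then show "A \<star> x = x" by simp
  then show "A \<star> y = y" using b by simp
qed

text \<open>For a Lie algebra element \<open>X\<close>, the part \<open>X \<star> y\<close> of the
  tangent vector \<open>X \<star> (p + y)\<close> lies in \<open>V2\<close> and is orthogonal to
  \<open>V1\<close>.\<close>

lemma nrm_sum_Int:
  assumes "p \<in> V1" "y \<in> V2"
  shows "nrm V (p + y) \<inter> V1 = nrm V1 p"
proof -
  have eq: "v \<bullet> (X \<star> (p + y)) = v \<bullet> (X \<star> p)" if "v \<in> V1" "X \<in> lie_algebra" for v X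
    using orth[OF that(1) lie_algebra_apply_mem[OF V2 that(2) assms(2)]]
    by (simp add: orthogonal_def endo.add_right inner_add_right)
  have "V1 \<subseteq> V"
    using sum_mem[of _ 0] invariant_subspace[OF V2] by (auto simp: subspace_0)
  then show ?thesis using eq by (auto simp: mem_nrm_iff)
qed

text \<open>Move a regular \<open>r1 + r2\<close> by \<open>B\<close> so that the isotropy group of
  \<open>p\<close> fixes \<open>B \<star> r1\<close>, as regularity of \<open>p\<close> permits.
  Whatever fixes \<open>p + B \<star> r2\<close> fixes both summands and therefore
  \<open>B \<star> (r1 + r2)\<close>.\<close>

lemma ex_regular_sum:
  assumes p: "regular V1 p"
  shows "\<exists>y\<in>V2. regular V (p + y)"
proof -
  obtain r1 r2 where r: "regular V (r1 + r2)" "r1 \<in> V1" "r2 \<in> V2"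
    using regular_exists[OF V] regular_mem V_eq by blast
  obtain B where B: "B \<in> H" "\<And>A. A \<in> H \<Longrightarrow> A \<star> p = p \<Longrightarrow> A \<star> B \<star> r1 = B \<star> r1"
    using p r(2) unfolding regular_def by blast
  have Br2: "B \<star> r2 \<in> V2" using V2 B(1) r(3) by (rule invariant_apply)
  have "regular V (p + B \<star> r2)"
  proof (rule regular_if_stabilizer_subset)
    show "regular V (B \<star> (r1 + r2))" using V r(1) B(1) by (rule regular_apply)
    show "p + B \<star> r2 \<in> V" using regular_mem[OF p] Br2 by (rule sum_mem)
    fix A assume A: "A \<in> H" "A \<star> (p + B \<star> r2) = p + B \<star> r2"
    then have "A \<star> p = p" "A \<star> B \<star> r2 = B \<star> r2"
      using fixes_sum[OF A(1) regular_mem[OF p] Br2] by auto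
    then show "A \<star> B \<star> (r1 + r2) = B \<star> (r1 + r2)"
      using B(2)[OF A(1)] by (simp add: endo.add_right)
  qed
  then show ?thesis using Br2 by blast
qed

text \<open>Kleiner's lemma for the isotropy group of \<open>p\<close>: take \<open>p + x\<close>
  regular and a shortest segment from \<open>x\<close> to the orbit of \<open>y\<close> under that
  group. An element fixing \<open>p\<close> and a point \<open>z\<close> of the segment before its
  end fixes \<open>x\<close>, so \<open>p + z\<close> is regular. Choose \<open>z\<close> near the
  end \<open>B \<star> y\<close> and carry it back by \<open>C\<close>.\<close>

lemma regular_sum_dense:
  assumes p: "regular V1 p" and y: "y \<in> V2" and e: "e > 0"
  shows "\<exists>z\<in>V2. dist z y < e \<and> regular V (p + z)"
proof -
  obtain x where x: "x \<in> V2" "regular V (p + x)" using ex_regular_sum[OF p] by blast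
  obtain B where B: "B \<in> H" "B \<star> p = p"
    and min: "\<And>A. A \<in> H \<Longrightarrow> A \<star> p = p \<Longrightarrow> norm (x - B \<star> y) \<le> norm (x - A \<star> y)"
    using closest_point_in_orbit[OF closed_stabilizer[of p], of x y] by auto
  obtain C where C: "C \<in> H" "\<And>x. B \<star> C \<star> x = x" "\<And>x. C \<star> B \<star> x = x"
    using obtain_inverse[OF B(1)] by metis
  define n where "n = norm (x - B \<star> y)"
  \<comment> \<open>Chosen such that \<open>0 < s \<le> 1\<close> and \<open>s * n < e\<close>, the
    latter being the distance from \<open>z\<close> to \<open>B \<star> y\<close>.\<close>
  define s where "s = e / (e + n + 1)"
  have n: "n \<ge> 0" by (simp add: n_def)
  have s: "0 < s" "s \<le> 1" using e n by (simp_all add: s_def)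
  have "e * n < e * (e + n + 1)" using e by simp
  then have sn: "s * n < e" using e n by (simp add: s_def pos_divide_less_eq)
  \<comment> \<open>Written with parameter \<open>1 - s\<close> to match the form of the segment in
    Kleiner's lemma.\<close>
  define z where "z = (1 - (1 - s)) *\<^sub>R x + (1 - s) *\<^sub>R (B \<star> y)"
  have z: "z \<in> V2"
    unfolding z_def using invariant_subspace[OF V2] x(1) invariant_apply[OF V2 B(1) y]
    by (intro subspace_add subspace_scale)
  have "regular V (p + z)"
  proof (rule regular_if_stabilizer_subset[OF x(2) sum_mem[OF regular_mem[OF p] z]])
    fix A assume A: "A \<in> H" "A \<star> (p + z) = p + z"
    then have Ap: "A \<star> p = p" and Az: "A \<star> z = z"
      using fixes_sum[OF A(1) regular_mem[OF p] z] by auto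
    have le: "norm (x - B \<star> y) \<le> norm (x - A \<star> B \<star> y)"
      using min[OF mult_mem[OF A(1) B(1)]] Ap B(2) by simp
    have "A \<star> x = x"
      by (rule fixes_start_of_minimal_segment[OF A(1) le _ _ Az[unfolded z_def]]) (use s in auto)
    then show "A \<star> (p + x) = p + x" using Ap by (simp add: endo.add_right)
  qed
  then have "regular V (C \<star> (p + z))" using C(1) by (rule regular_apply[OF V])
  moreover have "C \<star> p = p" using C(3) B(2) by metis
  ultimately have "regular V (p + C \<star> z)" by (simp add: endo.add_right)
  moreover have "dist (C \<star> z) y < e"
  proof -
    have "dist (C \<star> z) y = norm (C \<star> (z - B \<star> y))"
      by (simp add: dist_norm endo.diff_right C(3))
    also have "\<dots> = norm (z - B \<star> y)" by (rule norm_apply[OF C(1)])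
    also have "z - B \<star> y = s *\<^sub>R (x - B \<star> y)" by (simp add: z_def algebra_simps)
    finally show ?thesis using sn s by (simp add: n_def)
  qed
  moreover have "C \<star> z \<in> V2" using V2 C(1) z by (rule invariant_apply)
  ultimately show ?thesis by blast
qed

text \<open>Openness is part of the statement because the induction perturbs \<open>z\<close> to
  meet the next condition and must not lose the earlier ones; the perturbation stays within half of
  \<open>d\<close>.\<close>

lemma finite_regular_sum_open_dense:
  assumes "finite F" "\<And>p. p \<in> F \<Longrightarrow> regular V1 p" "y \<in> V2" "e > 0"
  shows "\<exists>z\<in>V2. \<exists>d>0. dist z y < e \<and> (\<forall>w\<in>V2. dist w z < d \<longrightarrow> (\<forall>p\<in>F. regular V (p + w)))"
  using assms
proof (induction F arbitrary: e rule: finite_induct)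
  case empty
  then show ?case by (intro bexI[of _ y] exI[of _ 1]) auto
next
  case (insert f F)
  obtain z d where z: "z \<in> V2" "d > 0" "dist z y < e / 2"
    "\<And>w p. w \<in> V2 \<Longrightarrow> dist w z < d \<Longrightarrow> p \<in> F \<Longrightarrow> regular V (p + w)"
    using insert.IH[of "e / 2"] insert.prems by auto
  obtain z' where z': "z' \<in> V2" "dist z' z < min (d / 2) (e / 2)" "regular V (f + z')"
    using regular_sum_dense[of f z "min (d / 2) (e / 2)"] insert.prems z(1,2) by auto
  obtain d' where d': "d' > 0" "\<And>q. q \<in> V \<Longrightarrow> dist q (f + z') < d' \<Longrightarrow> regular V q"
    using regular_open[OF V z'(3)] by blast
  have "regular V (p + w)" if w: "w \<in> V2" "dist w z' < min d' (d / 2)" and p: "p \<in> insert f F" for w p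
  proof (cases "p = f")
    case True
    have "f + w \<in> V" using regular_mem[of V1 f] insert.prems(1) w(1) by (intro sum_mem) auto
    then show ?thesis using d'(2)[of "f + w"] w(2) True by (simp add: dist_norm)
  next
    case False
    have "dist w z < d" using dist_triangle[of w z z'] w(2) z'(2) by simp
    then show ?thesis using z(4) w(1) p False by blast
  qed
  moreover have "dist z' y < e" using dist_triangle[of z' y z] z'(2) z(3) by simp
  ultimately show ?case
    using z'(1) d'(1) z(2) by (intro bexI[of _ z'] exI[of _ "min d' (d / 2)"]) auto
qed

text \<open>The generic sets form a proper filter, because the conditions on \<open>y\<close> are open and dense.\<close>

definition generic :: "('v \<Rightarrow> bool) \<Rightarrow> bool" where
  "generic P \<longleftrightarrow> (\<exists>F. finite F \<and> (\<forall>p\<in>F. regular V1 p) \<and>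
     (\<forall>y\<in>V2. (\<forall>p\<in>F. regular V (p + y)) \<longrightarrow> P y))"

lemma genericE:
  assumes "generic P" obtains y where "y \<in> V2" "P y"
proof -
  obtain F where F: "finite F" "\<And>p. p \<in> F \<Longrightarrow> regular V1 p"
      "\<And>y. y \<in> V2 \<Longrightarrow> (\<forall>p\<in>F. regular V (p + y)) \<Longrightarrow> P y"
    using assms unfolding generic_def by blast
  have "0 \<in> V2" using invariant_subspace[OF V2] by (rule subspace_0)
  then obtain z d where "z \<in> V2" "d > 0" "\<forall>w\<in>V2. dist w z < d \<longrightarrow> (\<forall>p\<in>F. regular V (p + w))"
    using finite_regular_sum_open_dense[OF F(1,2), of 0 1] by auto
  then show ?thesis using that F(3)[of z] by auto
qed

lemma generic_regular: "regular V1 p \<Longrightarrow> generic (\<lambda>y. regular V (p + y))"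
  unfolding generic_def by (intro exI[of _ "{p}"]) auto

lemma generic_mono: "generic P \<Longrightarrow> (\<And>y. y \<in> V2 \<Longrightarrow> P y \<Longrightarrow> Q y) \<Longrightarrow> generic Q"
  unfolding generic_def by meson

lemma generic_conj:
  assumes "generic P" "generic Q" shows "generic (\<lambda>y. P y \<and> Q y)"
proof -
  obtain F F' where
    "finite F" "\<forall>p\<in>F. regular V1 p" "\<forall>y\<in>V2. (\<forall>p\<in>F. regular V (p + y)) \<longrightarrow> P y"
    "finite F'" "\<forall>p\<in>F'. regular V1 p" "\<forall>y\<in>V2. (\<forall>p\<in>F'. regular V (p + y)) \<longrightarrow> Q y"
    using assms unfolding generic_def by blast
  then show ?thesis unfolding generic_def by (intro exI[of _ "F \<union> F'"]) auto
qed

lemma generic_ball: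
  "finite B \<Longrightarrow> (\<And>b. b \<in> B \<Longrightarrow> generic (P b)) \<Longrightarrow> generic (\<lambda>y. \<forall>b\<in>B. P b y)"
proof (induction B rule: finite_induct)
  case empty
  then show ?case unfolding generic_def by (intro exI[of _ "{}"]) auto
next
  case (insert b B)
  then have "generic (\<lambda>y. P b y \<and> (\<forall>b\<in>B. P b y))" by (intro generic_conj) auto
  then show ?case by (rule generic_mono) auto
qed

text \<open>\<open>A\<close> carries the conditions given by \<open>F\<close> to those given by its
  image; this is the source of equivariance.\<close>

lemma generic_apply:
  assumes P: "generic P" and A: "A \<in> H" and B: "\<And>x. A \<star> B \<star> x = x" "B \<in> H"
  shows "generic (\<lambda>y. P (B \<star> y))"
proof -
  obtain F where F: "finite F" "\<forall>p\<in>F. regular V1 p"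
    "\<forall>y\<in>V2. (\<forall>p\<in>F. regular V (p + y)) \<longrightarrow> P y"
    using P unfolding generic_def by blast
  have "P (B \<star> y)" if y: "y \<in> V2" "\<forall>p\<in>(\<star>) A ` F. regular V (p + y)" for y
  proof -
    have "regular V (p + B \<star> y)" if "p \<in> F" for p
    proof -
      have "regular V (A \<star> (p + B \<star> y))" using y(2) that B(1) by (simp add: endo.add_right)
      then have "regular V (B \<star> A \<star> (p + B \<star> y))" by (rule regular_apply[OF V _ B(2)])
      moreover have "B \<star> A \<star> x = x" for x
        using inj_apply[OF A] B(1) by (metis injD)
      ultimately show ?thesis by simp
    qed
    then show ?thesis using F(3) invariant_apply[OF V2 B(2) y(1)] by blast
  qed
  moreover have "\<forall>p\<in>(\<star>) A ` F. regular V1 p" using F(2) A regular_apply[OF V1] by blast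
  ultimately show ?thesis
    unfolding generic_def using F(1) by (intro exI[of _ "(\<star>) A ` F"]) auto
qed

section \<open>The section of a summand formed by generic membership\<close>

definition generic_section :: "'v \<Rightarrow> 'v set" where
  "generic_section p = {v \<in> V1. generic (\<lambda>y. v \<in> minimal_section V (p + y))}"

lemma subspace_minimal_section: "regular V p \<Longrightarrow> subspace (minimal_section V p)"
  using linear_section_minimal_section[OF V] by (simp add: linear_section_def)

lemma subspace_generic_section:
  assumes p: "regular V1 p" shows "subspace (generic_section p)"
  unfolding subspace_def
proof (intro conjI ballI allI)
  show "0 \<in> generic_section p"
    unfolding generic_section_def
    using invariant_subspace[OF V1] generic_mono[OF generic_regular[OF p]] subspace_minimal_section
    by (simp add: subspace_0)
next
  fix x y assume x: "x \<in> generic_section p" and y: "y \<in> generic_section p"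
  have "generic (\<lambda>z. regular V (p + z) \<and> x \<in> minimal_section V (p + z) \<and> y \<in> minimal_section V (p + z))"
    using x y by (intro generic_conj generic_regular p) (simp_all add: generic_section_def)
  then have "generic (\<lambda>z. x + y \<in> minimal_section V (p + z))"
    by (rule generic_mono) (simp add: subspace_minimal_section subspace_add)
  then show "x + y \<in> generic_section p"
    using x y invariant_subspace[OF V1] by (simp add: generic_section_def subspace_add)
next
  fix c :: real and x assume x: "x \<in> generic_section p"
  have "generic (\<lambda>z. regular V (p + z) \<and> x \<in> minimal_section V (p + z))"
    using x by (intro generic_conj generic_regular p) (simp_all add: generic_section_def)
  then have "generic (\<lambda>z. c *\<^sub>R x \<in> minimal_section V (p + z))"
    by (rule generic_mono) (simp add: subspace_minimal_section subspace_scale)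
  then show "c *\<^sub>R x \<in> generic_section p"
    using x invariant_subspace[OF V1] by (simp add: generic_section_def subspace_scale)
qed

text \<open>The generic set of \<open>y\<close> depends on the vector; a finite basis gives one that
  serves all vectors of the subspace.\<close>

lemma generic_section_subset_minimal_section:
  assumes p: "regular V1 p"
  shows "generic (\<lambda>y. generic_section p \<subseteq> minimal_section V (p + y))"
proof -
  obtain B where B: "B \<subseteq> generic_section p" "independent B" "generic_section p \<subseteq> span B"
    using basis_exists[of "generic_section p"] by metis
  have "generic (\<lambda>y. regular V (p + y) \<and> (\<forall>b\<in>B. b \<in> minimal_section V (p + y)))"
    using B(1) independent_imp_finite[OF B(2)] p
    by (intro generic_conj generic_regular generic_ball) (auto simp: generic_section_def)
  then show ?thesis
  proof (rule generic_mono)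
    fix y assume "regular V (p + y) \<and> (\<forall>b\<in>B. b \<in> minimal_section V (p + y))"
    then have "span B \<subseteq> minimal_section V (p + y)"
      by (intro span_minimal subspace_minimal_section) auto
    then show "generic_section p \<subseteq> minimal_section V (p + y)" using B(3) by blast
  qed
qed

lemma nrm_subset_generic_section:
  assumes p: "regular V1 p" shows "nrm V1 p \<subseteq> generic_section p"
proof
  fix v assume v: "v \<in> nrm V1 p"
  have "generic (\<lambda>y. v \<in> minimal_section V (p + y))"
    using generic_regular[OF p]
  proof (rule generic_mono)
    fix y assume "y \<in> V2" "regular V (p + y)"
    then show "v \<in> minimal_section V (p + y)"
      using v nrm_sum_Int[OF regular_mem[OF p], of y] nrm_subset_minimal_section[OF V] by blast
  qed
  then show "v \<in> generic_section p" using v nrm_subset by (auto simp: generic_section_def)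
qed

text \<open>For generic \<open>y\<close> the section through \<open>p + y\<close> contains \<open>p\<close> and \<open>q\<close>, hence the regular point \<open>q + y\<close>,
  and so it is also the minimal section through \<open>q + y\<close>.\<close>

lemma generic_section_unique:
  assumes p: "regular V1 p" and q: "regular V1 q" "q \<in> generic_section p"
  shows "generic_section q = generic_section p"
proof -
  have "generic (\<lambda>y. regular V (p + y) \<and> regular V (q + y) \<and> q \<in> minimal_section V (p + y))"
    using q by (intro generic_conj generic_regular p) (simp_all add: generic_section_def)
  then have eq: "generic (\<lambda>y. minimal_section V (q + y) = minimal_section V (p + y))"
  proof (rule generic_mono)
    fix y assume y: "y \<in> V2"
      and r: "regular V (p + y) \<and> regular V (q + y) \<and> q \<in> minimal_section V (p + y)"
    have "p \<in> nrm V (p + y)"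
      using nrm_sum_Int[OF regular_mem[OF p] y] self_mem_nrm[OF regular_mem[OF p]] by blast
    then have "p \<in> minimal_section V (p + y)" using nrm_subset_minimal_section[OF V] r by blast
    moreover have "subspace (minimal_section V (p + y))" using r subspace_minimal_section by blast
    ultimately have "(p + y - p) + q \<in> minimal_section V (p + y)"
      using r mem_minimal_section by (meson subspace_add subspace_diff)
    then have "q + y \<in> minimal_section V (p + y)" by (simp add: add.commute)
    then show "minimal_section V (q + y) = minimal_section V (p + y)"
      using r by (intro minimal_section_unique[OF V]) auto
  qed
  have "generic (\<lambda>y. v \<in> minimal_section V (p + y)) \<longleftrightarrow> generic (\<lambda>y. v \<in> minimal_section V (q + y))" for v
  proof
    assume "generic (\<lambda>y. v \<in> minimal_section V (p + y))"
    from generic_conj[OF this eq] show "generic (\<lambda>y. v \<in> minimal_section V (q + y))"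
      by (rule generic_mono) blast
  next
    assume "generic (\<lambda>y. v \<in> minimal_section V (q + y))"
    from generic_conj[OF this eq] show "generic (\<lambda>y. v \<in> minimal_section V (p + y))"
      by (rule generic_mono) blast
  qed
  then show ?thesis by (simp add: generic_section_def)
qed

lemma generic_section_apply:
  assumes p: "regular V1 p" and A: "A \<in> H"
  shows "generic_section (A \<star> p) = (\<star>) A ` generic_section p"
proof -
  have sub: "D \<star> v \<in> generic_section (D \<star> q)"
    if q: "regular V1 q" and v: "v \<in> generic_section q" and D: "D \<in> H" for D q v
  proof -
    obtain C where C: "C \<in> H" "\<And>x. D \<star> C \<star> x = x" using obtain_inverse[OF D] by metis
    have "generic (\<lambda>y. regular V (q + y) \<and> v \<in> minimal_section V (q + y))"
      using v by (intro generic_conj generic_regular q) (simp_all add: generic_section_def)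
    then have "generic (\<lambda>y. regular V (q + C \<star> y) \<and> v \<in> minimal_section V (q + C \<star> y))"
      by (rule generic_apply) (use D C in auto)
    then have "generic (\<lambda>y. D \<star> v \<in> minimal_section V (D \<star> q + y))"
    proof (rule generic_mono)
      fix y assume y: "regular V (q + C \<star> y) \<and> v \<in> minimal_section V (q + C \<star> y)"
      then have "minimal_section V (D \<star> (q + C \<star> y)) = (\<star>) D ` minimal_section V (q + C \<star> y)"
        by (intro minimal_section_apply V D) auto
      then show "D \<star> v \<in> minimal_section V (D \<star> q + y)"
        using y by (auto simp: endo.add_right C(2))
    qed
    then show ?thesis
      using v invariant_apply[OF V1 D] by (simp add: generic_section_def)
  qed
  obtain C where C: "C \<in> H" "\<And>x. A \<star> C \<star> x = x" "\<And>x. C \<star> A \<star> x = x" using obtain_inverse[OF A] by metis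
  show ?thesis
  proof (intro equalityI subsetI)
    fix v assume "v \<in> generic_section (A \<star> p)"
    then have "C \<star> v \<in> generic_section (C \<star> A \<star> p)"
      by (intro sub regular_apply V1 p A C)
    then show "v \<in> (\<star>) A ` generic_section p" using C by (metis image_eqI)
  qed (use sub[OF p _ A] in blast)
qed

lemma linear_section_generic_section:
  assumes p: "regular V1 p" shows "linear_section V1 (generic_section p)"
proof (rule linear_section_if_regular[OF V1 subspace_generic_section[OF p] _ _ p])
  show "generic_section p \<subseteq> V1" by (auto simp: generic_section_def)
  show "p \<in> generic_section p"
    using nrm_subset_generic_section[OF p] self_mem_nrm[OF regular_mem[OF p]] by blast
  show "nrm V1 q \<subseteq> generic_section p" if "q \<in> generic_section p" "regular V1 q" for q
    using nrm_subset_generic_section[OF that(2)] generic_section_unique[OF p that(2,1)] by simp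
  show "(\<star>) A ` generic_section p = generic_section p"
    if q: "q \<in> generic_section p" "regular V1 q" and A: "A \<in> H" "A \<star> q \<in> generic_section p" for q A
    using generic_section_apply[OF q(2) A(1)] generic_section_unique[OF p q(2,1)]
      generic_section_unique[OF p regular_apply[OF V1 q(2) A(1)] A(2)] by simp
qed

theorem copolarity_summand_le:
  assumes p: "regular V p" and q: "regular V1 q"
    and k: "dim (minimal_section V p) \<le> dim (nrm V p) + k"
  shows "dim (minimal_section V1 q) \<le> dim (nrm V1 q) + k"
proof -
  obtain y where y: "y \<in> V2"
    and "regular V (q + y) \<and> generic_section q \<subseteq> minimal_section V (q + y)"
    using generic_conj[OF generic_regular[OF q] generic_section_subset_minimal_section[OF q]]
    by (rule genericE)
  then have r: "regular V (q + y)" and sub: "generic_section q \<subseteq> minimal_section V (q + y)" by simp_all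
  let ?S = "generic_section q" and ?N = "nrm V (q + y)" and ?M = "minimal_section V (q + y)"
  have M: "subspace ?M" by (rule subspace_minimal_section[OF r])
  \<comment> \<open>As \<open>?S + ?N\<close> lies in \<open>?M\<close> and
    \<open>?S \<inter> ?N\<close> in the normal space of \<open>V1\<close>, the codimension of the
    latter in \<open>?S\<close> is at most that of \<open>?N\<close> in \<open>?M\<close>.\<close>
  have "dim {a + b |a b. a \<in> ?S \<and> b \<in> ?N} + dim (?S \<inter> ?N) = dim ?S + dim ?N"
    by (rule dim_sums_Int[OF subspace_generic_section[OF q] subspace_nrm[OF V]])
  moreover have "{a + b |a b. a \<in> ?S \<and> b \<in> ?N} \<subseteq> ?M"
    using sub nrm_subset_minimal_section[OF V r] subspace_add[OF M] by blast
  then have "dim {a + b |a b. a \<in> ?S \<and> b \<in> ?N} \<le> dim ?M" by (rule dim_subset)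
  moreover have "?S \<inter> ?N \<subseteq> nrm V1 q"
    using nrm_sum_Int[OF regular_mem[OF q] y] by (auto simp: generic_section_def)
  then have "dim (?S \<inter> ?N) \<le> dim (nrm V1 q)" by (rule dim_subset)
  moreover have "dim ?M \<le> dim ?N + k"
    using k dim_minimal_section[OF V r p] dim_nrm_regular[OF V r p] by simp
  moreover have "minimal_section V1 q \<subseteq> ?S"
    using linear_section_generic_section[OF q] nrm_subset_generic_section[OF q]
      self_mem_nrm[OF regular_mem[OF q]] by (intro minimal_section_subset) auto
  then have "dim (minimal_section V1 q) \<le> dim ?S" by (rule dim_subset)
  ultimately show ?thesis by linarith
qed

end

section \<open>The linear group of an orthogonal representation\<close>

lemma tendsto_endoI:
  fixes f :: "'b \<Rightarrow> 'v::euclidean_space endo"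
  assumes "\<And>b. b \<in> Basis \<Longrightarrow> ((\<lambda>x. f x \<star> b) \<longlongrightarrow> l \<star> b) F"
  shows "(f \<longlongrightarrow> l) F"
proof -
  have "((\<lambda>x. \<Sum>b\<in>Basis. norm ((f x - l) \<star> b)) \<longlongrightarrow> (\<Sum>b\<in>(Basis::'v set). 0)) F"
    by (intro tendsto_sum) (use assms in \<open>simp add: endo.diff_left LIM_zero tendsto_norm_zero\<close>)
  then have z: "((\<lambda>x. \<Sum>b\<in>Basis. norm ((f x - l) \<star> b)) \<longlongrightarrow> 0) F" by simp
  have "((\<lambda>x. f x - l) \<longlongrightarrow> 0) F"
    by (rule Lim_null_comparison[OF always_eventually z]) (use norm_endo_euclidean_le in blast)
  then show ?thesis by (rule LIM_zero_cancel)
qed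

lemma orthogonal_projection_exists:
  fixes V :: "'v::euclidean_space set"
  assumes V: "subspace V"
  shows "\<exists>P. linear P \<and> (\<forall>x. P x \<in> V \<and> (\<forall>y\<in>V. (x - P x) \<bullet> y = 0)) \<and> (\<forall>x\<in>V. P x = x)"
proof -
  obtain B where B: "B \<subseteq> V" "pairwise orthogonal B" "\<And>b. b \<in> B \<Longrightarrow> norm b = 1" "independent B" "span B = V"
    using orthonormal_basis_subspace[OF V] by metis
  have fin: "finite B" using B(4) by (rule independent_imp_finite)
  define P where "P x = (\<Sum>b\<in>B. (x \<bullet> b) *\<^sub>R b)" for x
  have "linear P"
    unfolding P_def
    by (intro linearI) (simp_all add: inner_add_left scaleR_add_left sum.distrib scaleR_sum_right)
  moreover have PV: "P x \<in> V" for x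
    unfolding P_def using B(1) V by (intro subspace_sum subspace_scale) auto
  moreover have P_id: "P x = x" if "x \<in> V" for x
    unfolding P_def by (rule orthonormal_basis_expand[OF B(2,3) _ fin]) (use that B(5) in auto)
  moreover have "(x - P x) \<bullet> y = 0" if y: "y \<in> V" for x y
  proof -
    have "x \<bullet> y = x \<bullet> P y" using P_id[OF y] by simp
    also have "\<dots> = P x \<bullet> y"
      by (simp add: P_def inner_sum_left inner_sum_right inner_commute mult.commute)
    finally show ?thesis by (simp add: inner_diff_left)
  qed
  ultimately show ?thesis by blast
qed

context orthogonal_representation
begin

definition proj :: "'v \<Rightarrow> 'v" where
  "proj = (SOME P. linear P \<and> (\<forall>x. P x \<in> V \<and> (\<forall>y\<in>V. (x - P x) \<bullet> y = 0)) \<and> (\<forall>x\<in>V. P x = x))"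

lemma proj: "linear proj" "proj x \<in> V" "y \<in> V \<Longrightarrow> (x - proj x) \<bullet> y = 0" "x \<in> V \<Longrightarrow> proj x = x"
  using someI_ex[OF orthogonal_projection_exists[OF subspace_space]] unfolding proj_def[symmetric] by blast+

text \<open>The action is given on \<open>V\<close> only. Letting it be trivial on the orthogonal
  complement makes it a group of isometries of the whole type, so one \<open>H\<close> serves
  \<open>V\<close> and all its invariant subspaces.\<close>

definition ext :: "'g \<Rightarrow> 'v endo" where
  "ext g = Endo (\<lambda>x. \<rho> g (proj x) + (x - proj x))"

lemma act_mem: "g \<in> carrier G \<Longrightarrow> x \<in> V \<Longrightarrow> \<rho> g x \<in> V"
  using element_image by blast

lemma ext_apply:
  assumes g: "g \<in> carrier G" shows "ext g \<star> x = \<rho> g (proj x) + (x - proj x)"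
  unfolding ext_def
proof (rule Endo_apply, rule linearI)
  fix x y and c :: real
  show "\<rho> g (proj (x + y)) + (x + y - proj (x + y)) = \<rho> g (proj x) + (x - proj x) + (\<rho> g (proj y) + (y - proj y))"
    by (simp add: linear_add[OF proj(1)] act_add[OF g proj(2) proj(2)])
  show "\<rho> g (proj (c *\<^sub>R x)) + (c *\<^sub>R x - proj (c *\<^sub>R x)) = c *\<^sub>R (\<rho> g (proj x) + (x - proj x))"
    by (simp add: linear_scale[OF proj(1)] act_scaleR[OF g proj(2)] algebra_simps)
qed

lemma ext_apply_mem: "g \<in> carrier G \<Longrightarrow> x \<in> V \<Longrightarrow> ext g \<star> x = \<rho> g x"
  by (simp add: ext_apply proj(4))

lemma proj_diff: "proj (x - proj x) = 0"
  by (simp add: linear_diff[OF proj(1)] proj(4)[OF proj(2)])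

lemma ext_mult:
  assumes "g \<in> carrier G" "h \<in> carrier G" shows "ext (g \<otimes> h) = ext g * ext h"
proof (rule endo_eqI)
  fix x
  have "proj (ext h \<star> x) = \<rho> h (proj x)"
    using assms proj(4)[OF act_mem[OF assms(2) proj(2)]]
    by (simp add: ext_apply linear_add[OF proj(1)] proj_diff)
  then show "ext (g \<otimes> h) \<star> x = (ext g * ext h) \<star> x"
    using assms by (simp add: ext_apply composition_rule[OF proj(2)])
qed

lemma ext_one: "ext \<one> = 1"
proof (rule endo_eqI)
  fix x
  have "\<rho> \<one> (proj x) = proj x" using id_eq_one proj(2) by (metis restrict_apply')
  then show "ext \<one> \<star> x = 1 \<star> x" by (simp add: ext_apply)
qed

lemma ext_inv:
  assumes "g \<in> carrier G" shows "ext g * ext (inv g) = 1" "ext (inv g) * ext g = 1"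
  using assms by (simp_all add: ext_mult[symmetric] ext_one)

lemma ext_inv_apply:
  assumes "g \<in> carrier G" shows "ext g \<star> ext (inv g) \<star> x = x" "ext (inv g) \<star> ext g \<star> x = x"
  using ext_inv[OF assms] by (simp_all flip: endo_mult_apply)

lemma norm_ext_apply:
  assumes g: "g \<in> carrier G" shows "norm (ext g \<star> x) = norm x"
proof -
  have orth: "(norm (y + (x - proj x)))\<^sup>2 = (norm y)\<^sup>2 + (norm (x - proj x))\<^sup>2" if "y \<in> V" for y
    using proj(3)[OF that, of x]
    by (simp add: power2_norm_eq_inner inner_add_left inner_add_right inner_commute)
  have "(norm (ext g \<star> x))\<^sup>2 = (norm (proj x + (x - proj x)))\<^sup>2"
    unfolding ext_apply[OF g] orth[OF act_mem[OF g proj(2)]] orth[OF proj(2)]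
    by (simp add: act_norm[OF g proj(2)])
  then show ?thesis by simp
qed

text \<open>Continuity in the operator norm reduces to continuity on basis vectors, which is that of
  the action.\<close>

lemma compact_ext: "compact (ext ` carrier G)"
proof -
  have act: "continuous_map T euclidean (\<lambda>g. \<rho> g (proj x))" for x
  proof -
    have "continuous_map T (prod_topology T (top_of_set V)) (\<lambda>g. (g, proj x))"
      by (intro continuous_map_pairedI) (simp_all add: proj(2))
    from continuous_map_compose[OF this act_continuous]
    show ?thesis by (auto simp: comp_def continuous_map_in_subtopology)
  qed
  have "continuous_map T euclidean ext"
    unfolding continuous_map_atin
  proof
    fix g assume g: "g \<in> topspace T"
    have "(ext \<longlongrightarrow> ext g) (atin T g)"
    proof (rule tendsto_endoI)
      fix b :: 'v
      have "((\<lambda>h. \<rho> h (proj b) + (b - proj b)) \<longlongrightarrow> \<rho> g (proj b) + (b - proj b)) (atin T g)"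
        using act[of b] g by (intro tendsto_intros) (simp add: continuous_map_atin)
      moreover have "eventually (\<lambda>h. \<rho> h (proj b) + (b - proj b) = ext h \<star> b) (atin T g)"
        unfolding eventually_atin using g topspace_eq openin_topspace[of T]
        by (intro disjI2 exI[of _ "topspace T"]) (auto simp: ext_apply)
      ultimately have "((\<lambda>h. ext h \<star> b) \<longlongrightarrow> \<rho> g (proj b) + (b - proj b)) (atin T g)"
        by (rule Lim_transform_eventually)
      then show "((\<lambda>h. ext h \<star> b) \<longlongrightarrow> ext g \<star> b) (atin T g)"
        using g topspace_eq by (simp add: ext_apply)
    qed
    then show "limitin euclidean ext (ext g) (atin T g)" by simp
  qed
  then have "compactin euclidean (ext ` topspace T)"
    using compact unfolding compact_space_def by (intro image_compactin)
  then show ?thesis by (simp add: topspace_eq)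
qed

sublocale linear: compact_isometry_group "ext ` carrier G"
proof
  show "1 \<in> ext ` carrier G" using ext_one by (metis image_eqI one_closed)
  show "A * B \<in> ext ` carrier G" if AB: "A \<in> ext ` carrier G" "B \<in> ext ` carrier G" for A B
  proof -
    obtain g h where "g \<in> carrier G" "h \<in> carrier G" "A = ext g" "B = ext h" using AB by blast
    then show ?thesis by (intro image_eqI[of _ _ "g \<otimes> h"]) (simp_all add: ext_mult)
  qed
  show "\<exists>B\<in>ext ` carrier G. A * B = 1 \<and> B * A = 1" if "A \<in> ext ` carrier G" for A
    using that ext_inv inv_closed by blast
  show "norm (A \<star> x) = norm x" if "A \<in> ext ` carrier G" for A x
    using that norm_ext_apply by blast
qed (rule compact_ext)

lemma invariant_ext:
  assumes "subspace W" "W \<subseteq> V" "\<And>g. g \<in> carrier G \<Longrightarrow> \<rho> g ` W \<subseteq> W"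
  shows "linear.invariant W"
proof -
  have "ext g \<star> x \<in> W" if "g \<in> carrier G" "x \<in> W" for g x
    using that assms(2,3) ext_apply_mem[of g x] by blast
  then show ?thesis using assms(1) by (auto simp: linear.invariant_def)
qed

end

text \<open>The subrepresentations of \<open>\<rho>\<close> are given by restricted functions, hence the extra parameter \<open>\<sigma>\<close>.\<close>

locale subrepresentation = orthogonal_representation G T E \<A> V \<rho>
  for G :: "('g, 'm) monoid_scheme" (structure)
    and T :: "'g topology"
    and E :: "'e::euclidean_space set"
    and \<A> :: "('g set \<times> ('g \<Rightarrow> 'e)) set"
    and V :: "'v::euclidean_space set"
    and \<rho> :: "'g \<Rightarrow> 'v \<Rightarrow> 'v" +
  fixes W :: "'v set" and \<sigma> :: "'g \<Rightarrow> 'v \<Rightarrow> 'v"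
  assumes W: "linear.invariant W" "W \<subseteq> V"
    and \<sigma>: "g \<in> carrier G \<Longrightarrow> x \<in> W \<Longrightarrow> \<sigma> g x = \<rho> g x"
begin

lemma \<sigma>_eq: "g \<in> carrier G \<Longrightarrow> x \<in> W \<Longrightarrow> \<sigma> g x = ext g \<star> x"
  using \<sigma> W(2) by (auto simp: ext_apply_mem)

lemma \<sigma>_image: "g \<in> carrier G \<Longrightarrow> S \<subseteq> W \<Longrightarrow> \<sigma> g ` S = (\<star>) (ext g) ` S"
  by (rule image_cong) (auto simp: \<sigma>_eq)

lemma subspace_W: "subspace W"
  using W(1) by (rule linear.invariant_subspace)

lemma orbit_eq: "p \<in> W \<Longrightarrow> orbit G \<sigma> p = linear.orb p"
  unfolding orbit_def linear.orb_def image_image using \<sigma>_eq[of _ p] by (auto simp: image_iff) metis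

lemma stabilizer_eq: "p \<in> W \<Longrightarrow> stabilizer G \<sigma> p = {g \<in> carrier G. ext g \<star> p = p}"
  unfolding stabilizer_def using \<sigma>_eq by auto

text \<open>The conjugate of \<open>h\<close> by \<open>g\<close> fixes \<open>q\<close> iff
  \<open>h\<close> fixes \<open>ext (inv g) \<star> q\<close>; thus the witness \<open>B\<close> of
  \<open>regular\<close> corresponds to the inverse of the conjugating element.\<close>

lemma conjugate_stabilizer_subset_iff:
  assumes g: "g \<in> carrier G" and pq: "p \<in> W" "q \<in> W"
  shows "g <# stabilizer G \<sigma> p #> inv g \<subseteq> stabilizer G \<sigma> q \<longleftrightarrow>
    (\<forall>A\<in>ext ` carrier G. A \<star> p = p \<longrightarrow> A \<star> ext (inv g) \<star> q = ext (inv g) \<star> q)"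
proof -
  have "g <# stabilizer G \<sigma> p #> inv g = {g \<otimes> h \<otimes> inv g |h. h \<in> carrier G \<and> ext h \<star> p = p}"
    unfolding stabilizer_eq[OF pq(1)] l_coset_def r_coset_def by auto
  moreover have "g \<otimes> h \<otimes> inv g \<in> stabilizer G \<sigma> q \<longleftrightarrow> ext h \<star> ext (inv g) \<star> q = ext (inv g) \<star> q"
    if h: "h \<in> carrier G" for h
  proof -
    have "g \<otimes> h \<otimes> inv g \<in> stabilizer G \<sigma> q \<longleftrightarrow> ext g \<star> ext h \<star> ext (inv g) \<star> q = q"
      using g h by (simp add: stabilizer_eq[OF pq(2)] ext_mult)
    also have "\<dots> \<longleftrightarrow> ext h \<star> ext (inv g) \<star> q = ext (inv g) \<star> q"
      using ext_inv_apply[OF g] by metis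
    finally show ?thesis .
  qed
  ultimately show ?thesis by auto
qed

lemma regular_point_iff: "regular_point G W \<sigma> p \<longleftrightarrow> linear.regular W p"
proof
  assume "regular_point G W \<sigma> p"
  then obtain Q where Q: "Q \<in> orbits G W \<sigma>" "p \<in> Q"
    and conj: "\<And>q. q \<in> W \<Longrightarrow> \<exists>g\<in>carrier G. g <# stabilizer G \<sigma> p #> inv g \<subseteq> stabilizer G \<sigma> q"
    unfolding regular_point_def principal_orbit_def by blast
  obtain x where "x \<in> W" "p \<in> linear.orb x"
    using Q orbit_eq unfolding orbits_def by auto
  then have p: "p \<in> W" using W(1) by (auto simp: linear.orb_def linear.invariant_def)
  show "linear.regular W p"
    unfolding linear.regular_def
  proof (intro conjI ballI p)
    fix q assume q: "q \<in> W"
    obtain g where g: "g \<in> carrier G" "g <# stabilizer G \<sigma> p #> inv g \<subseteq> stabilizer G \<sigma> q"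
      using conj[OF q] by blast
    then show "\<exists>B\<in>ext ` carrier G. \<forall>A\<in>ext ` carrier G. A \<star> p = p \<longrightarrow> A \<star> B \<star> q = B \<star> q"
      using conjugate_stabilizer_subset_iff[OF g(1) p q]
      by (intro bexI[of _ "ext (inv g)"]) auto
  qed
next
  assume reg: "linear.regular W p"
  have p: "p \<in> W" using reg by (rule linear.regular_mem)
  have "\<exists>g\<in>carrier G. g <# stabilizer G \<sigma> p' #> inv g \<subseteq> stabilizer G \<sigma> q"
    if p': "p' \<in> orbit G \<sigma> p" and q: "q \<in> W" for p' q
  proof -
    have reg': "linear.regular W p'"
      using p' linear.regular_apply[OF W(1) reg] by (auto simp: orbit_eq[OF p] linear.orb_def)
    then obtain b where b: "b \<in> carrier G"
      "\<forall>A\<in>ext ` carrier G. A \<star> p' = p' \<longrightarrow> A \<star> ext b \<star> q = ext b \<star> q"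
      using q unfolding linear.regular_def by blast
    then show ?thesis
      using conjugate_stabilizer_subset_iff[OF inv_closed[OF b(1)] linear.regular_mem[OF reg'] q]
      by (intro bexI[of _ "inv b"]) auto
  qed
  then have "principal_orbit G W \<sigma> (orbit G \<sigma> p)"
    unfolding principal_orbit_def orbits_def using p by blast
  moreover have "p \<in> orbit G \<sigma> p"
    using linear.orbI[OF linear.one_mem, of p] by (simp add: orbit_eq[OF p])
  ultimately show "regular_point G W \<sigma> p" unfolding regular_point_def by blast
qed

text \<open>The orbit of \<open>0\<close> is a single point, so (C2) puts \<open>0\<close> into
  \<open>S\<close> and the flatness theorem makes \<open>S\<close> linear. Then \<open>S\<close> is
  its own tangent space and the remaining conditions translate literally.\<close>

lemma k_section_iff:
  "k_section G W \<sigma> k S \<longleftrightarrow> linear.linear_section W S \<and>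
     (\<forall>p\<in>S. linear.regular W p \<longrightarrow> dim S = dim (linear.nrm W p) + k)"
  (is "?L \<longleftrightarrow> ?R")
proof
  assume L: ?L
  then have SW: "S \<subseteq> W" and meets: "\<forall>Q\<in>orbits G W \<sigma>. S \<inter> Q \<noteq> {}"
    unfolding k_section_def by blast+
  have meets': "\<exists>A\<in>ext ` carrier G. A \<star> q \<in> S" if q: "q \<in> W" for q
  proof -
    have "orbit G \<sigma> q \<in> orbits G W \<sigma>" using q by (auto simp: orbits_def)
    then have "S \<inter> linear.orb q \<noteq> {}" using meets by (auto simp: orbit_eq[OF q])
    then show ?thesis by (auto simp: linear.orb_def)
  qed
  have "0 \<in> S" using meets'[OF subspace_0[OF subspace_W]] by (auto simp: endo.zero_right)
  then have S: "subspace S"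
    using L subspace_if_totally_geodesic[OF subspace_W SW] unfolding k_section_def by blast
  have "tangent_space S p = S \<and> orbit G \<sigma> p = linear.orb p" if "p \<in> S" for p
    using that SW tangent_space_subspace[OF S] orbit_eq by blast
  moreover have "\<sigma> g p = ext g \<star> p \<and> \<sigma> g ` S = (\<star>) (ext g) ` S" if "g \<in> carrier G" "p \<in> S" for g p
    using that SW \<sigma>_eq \<sigma>_image by blast
  ultimately show ?R
    using L S SW meets' unfolding k_section_def linear.linear_section_def regular_point_iff by auto
next
  assume R: ?R
  then have S: "subspace S" and SW: "S \<subseteq> W" and meets: "\<And>q. q \<in> W \<Longrightarrow> \<exists>A\<in>ext ` carrier G. A \<star> q \<in> S"
    unfolding linear.linear_section_def by blast+
  have "tangent_space S p = S \<and> orbit G \<sigma> p = linear.orb p" if "p \<in> S" for p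
    using that SW tangent_space_subspace[OF S] orbit_eq by blast
  moreover have "\<sigma> g p = ext g \<star> p \<and> \<sigma> g ` S = (\<star>) (ext g) ` S" if "g \<in> carrier G" "p \<in> S" for g p
    using that SW \<sigma>_eq \<sigma>_image by blast
  moreover have "S \<inter> Q \<noteq> {}" if Q: "Q \<in> orbits G W \<sigma>" for Q
  proof -
    obtain q where q: "q \<in> W" "Q = linear.orb q" using Q orbit_eq unfolding orbits_def by blast
    then show ?thesis using meets[OF q(1)] linear.orbI by blast
  qed
  moreover have "connected S" using subspace_imp_convex[OF S] by (rule convex_connected)
  ultimately show ?L
    using R S SW complete_submanifold_subspace[OF S] totally_geodesic_subspace[OF S]
    unfolding k_section_def linear.linear_section_def regular_point_iff by auto
qed

text \<open>Normal spaces at regular points have equal dimension and those at points of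
  \<open>S\<close> lie in \<open>S\<close>, so the difference of dimensions is a suitable
  \<open>k\<close>.\<close>

lemma ex_k_section_iff: "(\<exists>k. k_section G W \<sigma> k S) \<longleftrightarrow> linear.linear_section W S"
proof
  assume S: "linear.linear_section W S"
  obtain p0 where p0: "linear.regular W p0" using linear.regular_exists[OF W(1)] by blast
  have "dim S = dim (linear.nrm W p) + (dim S - dim (linear.nrm W p0))"
    if p: "p \<in> S" "linear.regular W p" for p
  proof -
    have "linear.nrm W p \<subseteq> S" using S p by (simp add: linear.linear_section_def)
    then have "dim (linear.nrm W p) \<le> dim S" by (rule dim_subset)
    then show ?thesis using linear.dim_nrm_regular[OF W(1) p(2) p0] by simp
  qed
  then show "\<exists>k. k_section G W \<sigma> k S" using S by (auto simp: k_section_iff)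
qed (auto simp: k_section_iff)

lemma minimal_section_through_iff:
  assumes p: "linear.regular W p"
  shows "minimal_section_through G W \<sigma> p S \<longleftrightarrow> S = linear.minimal_section W p"
proof -
  let ?M = "linear.minimal_section W p"
  have through: "S \<in> sections_through G W \<sigma> p \<longleftrightarrow> linear.linear_section W S \<and> p \<in> S" for S
    unfolding sections_through_def ex_k_section_iff by blast
  have M: "?M \<in> sections_through G W \<sigma> p"
    unfolding through
    using linear.linear_section_minimal_section[OF W(1) p] linear.mem_minimal_section by blast
  have least: "?M \<subseteq> S" if "S \<in> sections_through G W \<sigma> p" for S
    using that linear.minimal_section_subset unfolding through by blast
  show ?thesis
    unfolding minimal_section_through_def
  proof (intro iffI conjI ballI impI)
    assume S: "S \<in> sections_through G W \<sigma> p \<and> (\<forall>S'\<in>sections_through G W \<sigma> p. S' \<subseteq> S \<longrightarrow> S' = S)"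
    then have "?M \<subseteq> S" by (intro least) simp
    then show "S = ?M" using S M by auto
  next
    assume S: "S = ?M"
    then show "S \<in> sections_through G W \<sigma> p" using M by simp
    show "S' = S" if "S' \<in> sections_through G W \<sigma> p" "S' \<subseteq> S" for S'
      using least[OF that(1)] that(2) S by simp
  qed
qed

text \<open>Each regular point has exactly one minimal section, and its dimension and that of the
  normal space do not depend on the point, so exactly one \<open>k\<close> satisfies the condition
  under \<open>THE\<close>. By \<open>le\<close> the natural number difference \<open>?k\<close> is
  exact.\<close>

lemma dim_minimal_section_eq_copol:
  assumes p: "linear.regular W p"
  shows "dim (linear.minimal_section W p) = dim (linear.nrm W p) + copol G W \<sigma>"
proof -
  let ?k = "dim (linear.minimal_section W p) - dim (linear.nrm W p)"
  have le: "dim (linear.nrm W p) \<le> dim (linear.minimal_section W p)"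
    using linear.nrm_subset_minimal_section[OF W(1) p] by (rule dim_subset)
  have k: "k_section G W \<sigma> k (linear.minimal_section W q) \<longleftrightarrow> k = ?k" if q: "linear.regular W q" for q k
  proof -
    have dims: "dim (linear.minimal_section W q) = dim (linear.nrm W r) + k \<longleftrightarrow> k = ?k"
      if r: "linear.regular W r" for r
      using linear.dim_minimal_section[OF W(1) q p] linear.dim_nrm_regular[OF W(1) r p] le by auto
    then show ?thesis
      using q linear.linear_section_minimal_section[OF W(1) q] linear.mem_minimal_section
      unfolding k_section_iff by blast
  qed
  have "(\<exists>q S. regular_point G W \<sigma> q \<and> minimal_section_through G W \<sigma> q S \<and> k_section G W \<sigma> k S)
      \<longleftrightarrow> k = ?k" for k
    unfolding regular_point_iff using k minimal_section_through_iff p by metis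
  then have "copol G W \<sigma> = ?k" unfolding copol_def by simp
  then show ?thesis using le by simp
qed

end

section \<open>Copolarity of a summand\<close>

context orthogonal_representation
begin

lemma copol_summand_le:
  assumes "subspace V1" and "subspace V2"
    and V_eq: "V = {x + y | x y. x \<in> V1 \<and> y \<in> V2}"
    and orth: "\<And>x y. x \<in> V1 \<Longrightarrow> y \<in> V2 \<Longrightarrow> orthogonal x y"
    and inv1: "\<And>g. g \<in> carrier G \<Longrightarrow> \<rho> g ` V1 \<subseteq> V1"
    and inv2: "\<And>g. g \<in> carrier G \<Longrightarrow> \<rho> g ` V2 \<subseteq> V2"
  shows "copol G V1 (\<lambda>g. restrict (\<rho> g) V1) \<le> copol G V \<rho>"
proof -
  have sub: "V1 \<subseteq> V" "V2 \<subseteq> V"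
    using V_eq subspace_0[OF assms(1)] subspace_0[OF assms(2)] by force+
  have V: "linear.invariant V" using subspace_space act_mem by (intro invariant_ext) auto
  have V1: "linear.invariant V1" by (rule invariant_ext[OF assms(1) sub(1) inv1])
  have V2: "linear.invariant V2" by (rule invariant_ext[OF assms(2) sub(2) inv2])
  interpret invariant_decomposition "ext ` carrier G" V V1 V2
    by unfold_locales (use V V1 V2 V_eq orth in auto)
  \<comment> \<open>\<open>V\<close> as a subrepresentation of itself, so that both copolarities are
    computed by the same lemma.\<close>
  interpret whole: subrepresentation G T E \<A> V \<rho> V \<rho>
    by unfold_locales (use V in auto)
  interpret part: subrepresentation G T E \<A> V \<rho> V1 "\<lambda>g. restrict (\<rho> g) V1"
    by unfold_locales (use V1 sub in auto)
  obtain p q where p: "linear.regular V p" and q: "linear.regular V1 q"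
    using linear.regular_exists[OF V] linear.regular_exists[OF V1] by blast
  have "dim (linear.minimal_section V1 q) \<le> dim (linear.nrm V1 q) + copol G V \<rho>"
    by (rule copolarity_summand_le[OF p q]) (simp add: whole.dim_minimal_section_eq_copol[OF p])
  then show ?thesis using part.dim_minimal_section_eq_copol[OF q] by simp
qed

end

theorem theorem13:
  fixes G :: "('g, 'm) monoid_scheme"
    and T :: "'g topology"
    and E :: "'e::euclidean_space set"
    and \<A> :: "('g set \<times> ('g \<Rightarrow> 'e)) set"
    and V V1 V2 :: "'v::euclidean_space set"
    and \<rho> :: "'g \<Rightarrow> 'v \<Rightarrow> 'v"
    and k :: nat
  assumes "orthogonal_representation G T E \<A> V \<rho>"
    and "subspace V1" and "subspace V2"
    and "V = {x + y | x y. x \<in> V1 \<and> y \<in> V2}"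
    and "\<And>x y. x \<in> V1 \<Longrightarrow> y \<in> V2 \<Longrightarrow> orthogonal x y"
    and "\<And>g. g \<in> carrier G \<Longrightarrow> \<rho> g ` V1 \<subseteq> V1"
    and "\<And>g. g \<in> carrier G \<Longrightarrow> \<rho> g ` V2 \<subseteq> V2"
    and "copol G V \<rho> \<le> k"
  shows "copol G V1 (\<lambda>g. restrict (\<rho> g) V1) \<le> k \<and>
         copol G V2 (\<lambda>g. restrict (\<rho> g) V2) \<le> k"
proof
  interpret orthogonal_representation G T E \<A> V \<rho> by (rule assms(1))
  show "copol G V1 (\<lambda>g. restrict (\<rho> g) V1) \<le> k"
    using copol_summand_le[OF assms(2-7)] assms(8) by (rule order_trans)
  \<comment> \<open>The second bound is the first one for the decomposition with its summands
    exchanged.\<close>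
  have orth: "orthogonal x y" if "x \<in> V2" "y \<in> V1" for x y
    using assms(5)[OF that(2,1)] by (simp add: orthogonal_commute)
  have "V = {y + x | y x. y \<in> V2 \<and> x \<in> V1}"
    unfolding assms(4) by (metis (no_types, opaque_lifting) add.commute)
  then have "copol G V2 (\<lambda>g. restrict (\<rho> g) V2) \<le> copol G V \<rho>"
    by (rule copol_summand_le[OF assms(3,2) _ orth assms(7,6)])
  then show "copol G V2 (\<lambda>g. restrict (\<rho> g) V2) \<le> k"
    using assms(8) by (rule order_trans)
qed

end
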